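(* Let $X,Y\subset\mathbb{R}$ be compact and $Z=[\underline z_-,\overline z_-]\cup[\underline z_+,\overline z_+]\subset\mathbb{R}$. Let $\mu_X\in\mathcal{P}(X)$, $\mu_Y\in\mathcal{P}(Y)$, $\mu_Z\in\mathcal{P}(Z)$ satisfy $\mu_X\preceq_c\mu_Y\preceq_c\mu_Z$, where $\mu_X$ is non-atomic, $\mu_Y=a_1\delta_{y_1}+a_2\delta_{y_2}$ with $a_1,a_2>0$, and $\overline z_-<y_1<y_2<\underline z_+$. Suppose $c(x,y,z)=c_1(x,y)+c_2(y,z)+c_3(x,z)$, where $c_1,c_2,c_3$ are continuous, the partial derivative $\partial_x c_3$ exists, and $c_3$ satisfies the martingale Spence–Mirrlees condition. Then the three-period martingale optimal transport problem $$\inf_{\pi\in\Pi_M(\mu_X,\mu_Y,\mu_Z)}\int c(x,y,z)\,d\pi$$ has a unique optimal solution $\pi$.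
   Context: $\mathcal{P}(X)$ is the set of Borel probability measures on $X$. Convex order: $\mu\preceq_c\nu$ means $\int\varphi\,d\mu\le\int\varphi\,d\nu$ for all convex $\varphi:\mathbb{R}\to\mathbb{R}$. $\Pi_M(\mu_X,\mu_Y,\mu_Z)$ is the set of probability measures $\pi$ on $X\times Y\times Z$ with marginals $\mu_X,\mu_Y,\mu_Z$ such that under $\pi$ the conditional mean of $y$ given $x$ is $x$, and the conditional mean of $z$ given $(x,y)$ is $y$, $\pi$-a.s. Martingale Spence–Mirrlees condition for $c_3$: $\partial_x c_3(x,z)$ is strictly concave in $z$ for each $x$, or, more generally, $z\mapsto c_3(x',z)-c_3(x,z)$ is strictly concave on $Z$ for each $x<x'$ in $X$; the latter general form is the condition meant here (it follows from the former when $X$ is an interval). Strict concavity of $g$ on $Z$ means $g((1-\lambda)z^-+\lambda z^+)>(1-\lambda)g(z^-)+\lambda g(z^+)$ whenever $z^-<z^+$, $\lambda\in(0,1)$ and $z^-,z^+,(1-\lambda)z^-+\lambda z^+\in Z$. *)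

theory Defs
  imports "HOL-Probability.Probability"
begin

text \<open>Measures on a subset \<open>S\<close> live on the space \<open>S\<close> itself, with the trace of the Borel sets
  as sigma-algebra, so nothing is assumed about cost functions outside their domains.\<close>

definition borel_probs :: "'a::topological_space set \<Rightarrow> 'a measure set" where
  "borel_probs S = space (prob_algebra (restrict_space borel S))"

text \<open>The next definition is only meaningful for measures with finite first moment for which the
  convex functions considered are integrable (otherwise the Bochner integral is \<open>0\<close> by
  convention). For measures in \<open>borel_probs S\<close> with \<open>S\<close> compact this is automatic.\<close>

definition convex_order :: "real measure \<Rightarrow> real measure \<Rightarrow> bool" (infix "\<preceq>\<^sub>c" 50) where
  "\<mu> \<preceq>\<^sub>c \<nu> \<longleftrightarrow>
     (\<forall>\<phi>. convex_on UNIV \<phi> \<longrightarrow> (\<integral>x. \<phi> x \<partial>\<mu>) \<le> (\<integral>x. \<phi> x \<partial>\<nu>))"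

definition atom :: "'a measure \<Rightarrow> 'a set \<Rightarrow> bool" where
  "atom M A \<longleftrightarrow> A \<in> sets M \<and> emeasure M A > 0 \<and>
     (\<forall>B\<in>sets M. B \<subseteq> A \<longrightarrow> emeasure M B = 0 \<or> emeasure M B = emeasure M A)"

definition non_atomic :: "'a measure \<Rightarrow> bool" where
  "non_atomic M \<longleftrightarrow> (\<nexists>A. atom M A)"

text \<open>The conditional mean of \<open>f\<close> given the random element \<open>T\<close>; the conditioning sigma-algebra is
  the one generated by \<open>T\<close>.\<close>

definition cond_mean ::
  "'a measure \<Rightarrow> ('a \<Rightarrow> real) \<Rightarrow> ('a \<Rightarrow> 'b::topological_space) \<Rightarrow> 'a \<Rightarrow> real" where
  "cond_mean M f T = real_cond_exp M (vimage_algebra (space M) T borel) f"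

definition martingale_couplings ::
  "real set \<Rightarrow> real set \<Rightarrow> real set \<Rightarrow> real measure \<Rightarrow> real measure \<Rightarrow> real measure
    \<Rightarrow> (real \<times> real \<times> real) measure set" where
  "martingale_couplings X Y Z \<mu>X \<mu>Y \<mu>Z = {\<pi> \<in> borel_probs (X \<times> Y \<times> Z).
     distr \<pi> (restrict_space borel X) (\<lambda>(x, y, z). x) = \<mu>X \<and>
     distr \<pi> (restrict_space borel Y) (\<lambda>(x, y, z). y) = \<mu>Y \<and>
     distr \<pi> (restrict_space borel Z) (\<lambda>(x, y, z). z) = \<mu>Z \<and>
     (AE \<omega> in \<pi>. cond_mean \<pi> (\<lambda>(x, y, z). y) (\<lambda>(x, y, z). x) \<omega> = fst \<omega>) \<and>
     (AE \<omega> in \<pi>. cond_mean \<pi> (\<lambda>(x, y, z). z) (\<lambda>(x, y, z). (x, y)) \<omega> = fst (snd \<omega>))}"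

text \<open>The set \<open>S\<close> need not be convex: only convex combinations lying in \<open>S\<close> are tested.\<close>

definition strictly_concave_on :: "real set \<Rightarrow> (real \<Rightarrow> real) \<Rightarrow> bool" where
  "strictly_concave_on S g \<longleftrightarrow>
     (\<forall>u\<in>S. \<forall>v\<in>S. \<forall>t. u < v \<and> 0 < t \<and> t < 1 \<and> (1 - t) * u + t * v \<in> S \<longrightarrow>
        g ((1 - t) * u + t * v) > (1 - t) * g u + t * g v)"

definition martingale_spence_mirrlees ::
  "real set \<Rightarrow> real set \<Rightarrow> (real \<Rightarrow> real \<Rightarrow> real) \<Rightarrow> bool" where
  "martingale_spence_mirrlees X Z c \<longleftrightarrow>
     (\<forall>x\<in>X. \<forall>x'\<in>X. x < x' \<longrightarrow> strictly_concave_on Z (\<lambda>z. c x' z - c x z))"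

definition mot_optimal ::
  "real set \<Rightarrow> real set \<Rightarrow> real set \<Rightarrow> real measure \<Rightarrow> real measure \<Rightarrow> real measure
    \<Rightarrow> (real \<Rightarrow> real \<Rightarrow> real \<Rightarrow> real) \<Rightarrow> (real \<times> real \<times> real) measure \<Rightarrow> bool" where
  "mot_optimal X Y Z \<mu>X \<mu>Y \<mu>Z c \<pi> \<longleftrightarrow>
     is_arg_min (\<lambda>\<pi>. \<integral>(x, y, z). c x y z \<partial>\<pi>)
       (\<lambda>\<pi>. \<pi> \<in> martingale_couplings X Y Z \<mu>X \<mu>Y \<mu>Z) \<pi>"

end

theory Submission
  imports Defs
begin

text \<open>Since \<open>y\<close> takes only two values and has conditional mean \<open>x\<close>, the law of \<open>(x, y)\<close> is determined
  by \<open>\<mu>X\<close>, and a coupling amounts to a pair of measures on the \<open>(x, z)\<close> plane, its slices at \<open>y\<^sub>1\<close> and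
  \<open>y\<^sub>2\<close>. In an optimal coupling each slice minimises the integral of \<open>c\<^sub>3\<close> among slices with the same
  marginals and the same conditional mean \<open>y\<^sub>i\<close>. If \<open>x < x'\<close>, and \<open>x\<close> is coupled with two points on
  either side of a point coupled with \<open>x'\<close>, then exchanging mass lowers the cost by the
  Spence-Mirrlees condition. As \<open>y\<^sub>i\<close> lies in the gap of \<open>Z\<close>, mass on both components of \<open>Z\<close> is
  always present, so the coupling is antitone on the lower and monotone on the upper component.
  Since \<open>\<mu>X\<close> has no atoms, each slice is carried by two graphs, with weights forced by the
  mean. Applied to the average of two optimal couplings this shows that they coincide. Existence is
  weak compactness.\<close>

subsection \<open>Sums of measures and bounded Borel test functions\<close>

text \<open>No conditional kernel is ever constructed. Marginals and conditional means are integral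
  identities against bounded Borel functions; these are linear, so they pass to averages at once,
  and to weak limits after a detour through continuous functions. Within a slice \<open>y\<close> is
  constant, so \<open>c\<^sub>1\<close> and \<open>c\<^sub>2\<close> integrate against fixed
  marginals; this is why only \<open>c\<^sub>3\<close> decides. The exchange cannot be done at
  single points, which are null: pieces of positive mass are rearranged, and the conditional mean
  must survive over almost every abscissa, not only in total. Low mass and high mass to the left of
  a threshold might sit over different abscissae, and then could not be removed together with a
  prescribed mean. The position of \<open>y\<close> in the gap excludes this, because it forces mass
  on both components over almost every abscissa. Two optimal couplings could be carried by different
  graphs; the average supplies graphs common to both, and the comparison needs common ones.\<close>

definition add_measure :: "'a measure \<Rightarrow> 'a measure \<Rightarrow> 'a measure" where
  "add_measure M N = measure_of (space M) (sets M) (\<lambda>A. emeasure M A + emeasure N A)"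

lemma sets_add_measure [simp, measurable_cong]: "sets (add_measure M N) = sets M"
  and space_add_measure [simp]: "space (add_measure M N) = space M"
  by (simp_all add: add_measure_def)

lemma emeasure_add_measure:
  assumes "sets N = sets M"
  shows "emeasure (add_measure M N) A = emeasure M A + emeasure N A"
\<comment> \<open>Outside the sigma-algebra all three measures take the default value
  \<open>0\<close>, so no measurability of \<open>A\<close> is required.\<close>
proof (cases "A \<in> sets M")
  case True
  show ?thesis unfolding add_measure_def
  proof (rule emeasure_measure_of_sigma[OF _ _ _ True])
    show "sigma_algebra (space M) (sets M)" by (rule sets.sigma_algebra_axioms)
    show "positive (sets M) (\<lambda>A. emeasure M A + emeasure N A)"
      by (simp add: positive_def)
    show "countably_additive (sets M) (\<lambda>A. emeasure M A + emeasure N A)"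
    proof (rule countably_additiveI)
      fix F :: "nat \<Rightarrow> _" assume F: "range F \<subseteq> sets M" "disjoint_family F" "\<Union> (range F) \<in> sets M"
      have "(\<Sum>i. emeasure M (F i) + emeasure N (F i)) = (\<Sum>i. emeasure M (F i)) + (\<Sum>i. emeasure N (F i))"
        by (rule suminf_add[symmetric]) auto
      then show "(\<Sum>i. emeasure M (F i) + emeasure N (F i))
          = emeasure M (\<Union> (range F)) + emeasure N (\<Union> (range F))"
        using F assms by (simp add: suminf_emeasure)
    qed
  qed
qed (use assms in \<open>simp add: emeasure_notin_sets\<close>)

lemma nn_integral_add_measure:
  assumes N [measurable_cong]: "sets N = sets M" and f: "f \<in> borel_measurable M"
  shows "(\<integral>\<^sup>+x. f x \<partial>add_measure M N) = (\<integral>\<^sup>+x. f x \<partial>M) + (\<integral>\<^sup>+x. f x \<partial>N)"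
  using f
proof induct
  case (cong f g)
  moreover have "space N = space M" using sets_eq_imp_space_eq[OF N] .
  ultimately show ?case by (simp cong: nn_integral_cong_simp)
next
  case (set A)
  then show ?case using N by (simp add: emeasure_add_measure)
next
  case (mult u c)
  then show ?case by (simp add: nn_integral_cmult distrib_left measurable_cong_sets[OF N refl])
next
  case (add u v)
  then show ?case by (simp add: nn_integral_add measurable_cong_sets[OF N refl] ac_simps)
next
  case (seq U)
  have "(\<integral>\<^sup>+x. (SUP i. U i) x \<partial>add_measure M N) = (SUP i. (\<integral>\<^sup>+x. U i x \<partial>M) + (\<integral>\<^sup>+x. U i x \<partial>N))"
    using seq by (simp add: nn_integral_monotone_convergence_SUP image_comp)
  also have "\<dots> = (SUP i. (\<integral>\<^sup>+x. U i x \<partial>M)) + (SUP i. (\<integral>\<^sup>+x. U i x \<partial>N))"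
    using seq(4) by (intro ennreal_SUP_add) (auto simp: incseq_def le_fun_def intro!: nn_integral_mono)
  also have "\<dots> = (\<integral>\<^sup>+x. (SUP i. U i) x \<partial>M) + (\<integral>\<^sup>+x. (SUP i. U i) x \<partial>N)"
    using seq by (simp add: nn_integral_monotone_convergence_SUP image_comp measurable_cong_sets[OF N refl])
  finally show ?case .
qed

lemma AE_add_measure_iff:
  assumes N: "sets N = sets M"
  shows "(AE x in add_measure M N. P x) \<longleftrightarrow> (AE x in M. P x) \<and> (AE x in N. P x)"
proof -
  have sp: "space N = space M" using sets_eq_imp_space_eq[OF N] .
  show ?thesis
  proof (intro iffI conjI)
    assume "AE x in add_measure M N. P x"
    then obtain Z where Z: "{x \<in> space M. \<not> P x} \<subseteq> Z" "Z \<in> sets M"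
      and Z0: "emeasure (add_measure M N) Z = 0"
      by (metis AE_E sets_add_measure space_add_measure)
    from Z0 have "emeasure M Z = 0" "emeasure N Z = 0" by (simp_all add: emeasure_add_measure[OF N])
    show "AE x in M. P x" by (rule AE_I[OF Z(1) \<open>emeasure M Z = 0\<close> Z(2)])
    have "{x \<in> space N. \<not> P x} \<subseteq> Z" "Z \<in> sets N" using Z N sp by simp_all
    then show "AE x in N. P x" using \<open>emeasure N Z = 0\<close> by (auto intro: AE_I)
  next
    assume *: "(AE x in M. P x) \<and> (AE x in N. P x)"
    from AE_E[OF conjunct1[OF *]] obtain Z
      where Z: "{x \<in> space M. \<not> P x} \<subseteq> Z" "emeasure M Z = 0" "Z \<in> sets M" .
    from AE_E[OF conjunct2[OF *]] obtain W
      where "{x \<in> space N. \<not> P x} \<subseteq> W" "emeasure N W = 0" "W \<in> sets N" .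
    then have W: "{x \<in> space M. \<not> P x} \<subseteq> W" "emeasure N W = 0" "W \<in> sets M"
      using N sp by simp_all
    \<comment> \<open>Each exceptional set may be charged by the other measure; the intersection
      still contains all bad points and is null for both.\<close>
    have "emeasure M (Z \<inter> W) = 0" "emeasure N (Z \<inter> W) = 0"
      using Z W N emeasure_eq_0[of Z M "Z \<inter> W"] emeasure_eq_0[of W N "Z \<inter> W"] by simp_all
    then show "AE x in add_measure M N. P x"
      using Z W by (intro AE_I[where N="Z \<inter> W"]) (auto simp: emeasure_add_measure[OF N])
  qed
qed

lemma finite_measure_add_measure:
  assumes "sets N = sets M" "finite_measure M" "finite_measure N"
  shows "finite_measure (add_measure M N)"
proof (rule finite_measureI)
  have "space N = space M" using sets_eq_imp_space_eq[OF assms(1)] .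
  then show "emeasure (add_measure M N) (space (add_measure M N)) \<noteq> \<infinity>"
    using finite_measure.emeasure_finite[OF assms(2)] finite_measure.emeasure_finite[OF assms(3)]
    by (simp add: emeasure_add_measure[OF assms(1)])
qed

lemma
  fixes f :: "'a \<Rightarrow> real"
  assumes N [measurable_cong]: "sets N = sets M" and M: "integrable M f" and N': "integrable N f"
  shows integrable_add_measure: "integrable (add_measure M N) f"
    and integral_add_measure: "(\<integral>x. f x \<partial>add_measure M N) = (\<integral>x. f x \<partial>M) + (\<integral>x. f x \<partial>N)"
proof -
  have f [measurable]: "f \<in> borel_measurable M" using M by auto
  have fin: "(\<integral>\<^sup>+x. ennreal (s * f x) \<partial>L) < \<infinity>" if "integrable L f" for L s
  proof -
    have "integrable L (\<lambda>x. s * f x)" using that by simp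
    then show ?thesis unfolding real_integrable_def by (simp add: less_top)
  qed
  \<comment> \<open>The sign \<open>s\<close> is taken to be \<open>1\<close> and \<open>-1\<close>:
    truncation by \<open>ennreal\<close> then yields the positive and the negative part of
    \<open>f\<close>.\<close>
  have add: "(\<integral>\<^sup>+x. ennreal (s * f x) \<partial>add_measure M N)
      = (\<integral>\<^sup>+x. ennreal (s * f x) \<partial>M) + (\<integral>\<^sup>+x. ennreal (s * f x) \<partial>N)" for s
    by (rule nn_integral_add_measure[OF N]) simp
  have f': "f \<in> borel_measurable (add_measure M N)" by simp
  show i: "integrable (add_measure M N) f"
    using add[of 1] add[of "-1"] fin[OF M, of 1] fin[OF N', of 1] fin[OF M, of "-1"] fin[OF N', of "-1"] f'
    by (simp add: real_integrable_def less_top)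
  show "(\<integral>x. f x \<partial>add_measure M N) = (\<integral>x. f x \<partial>M) + (\<integral>x. f x \<partial>N)"
    using add[of 1] add[of "-1"] fin[OF M, of 1] fin[OF N', of 1] fin[OF M, of "-1"] fin[OF N', of "-1"]
    by (simp add: real_lebesgue_integral_def i M N' enn2real_plus)
qed

text \<open>The test class for all constraints. It contains indicators, is stable under products and
  Borel substitutions, and is integrated by each finite Borel measure, so identities tested on it
  need no integrability conditions.\<close>

definition bounded_borel :: "('a::topological_space \<Rightarrow> real) set" where
  "bounded_borel = {h \<in> borel_measurable borel. bounded (range h)}"

lemma bounded_borelI:
  assumes "h \<in> borel_measurable borel" "\<And>x. \<bar>h x\<bar> \<le> B"
  shows "h \<in> bounded_borel"
  using assms by (auto simp: bounded_borel_def bounded_iff)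

lemma bounded_borel_measurable [measurable_dest]: "h \<in> bounded_borel \<Longrightarrow> h \<in> borel_measurable borel"
  by (simp add: bounded_borel_def)

lemma bounded_borel_bound:
  assumes "h \<in> bounded_borel"
  obtains B where "B \<ge> 0" "\<And>x. \<bar>h x\<bar> \<le> B"
proof -
  obtain B where B: "\<And>x. \<bar>h x\<bar> \<le> B" using assms by (auto simp: bounded_borel_def bounded_iff)
  from B[of undefined] have "B \<ge> 0" by linarith
  then show ?thesis using B that by blast
qed

lemma bounded_borel_const [simp, intro]: "(\<lambda>_. c) \<in> bounded_borel"
  by (rule bounded_borelI[of _ "\<bar>c\<bar>"]) auto

lemma bounded_borel_indicator [intro]: "A \<in> sets borel \<Longrightarrow> indicator A \<in> bounded_borel"
  by (rule bounded_borelI[of _ 1]) (auto simp: indicator_def)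

lemma bounded_borel_mult:
  assumes "f \<in> bounded_borel" "g \<in> bounded_borel" shows "(\<lambda>x. f x * g x) \<in> bounded_borel"
proof -
  obtain B where B: "B \<ge> 0" "\<And>x. \<bar>f x\<bar> \<le> B" using bounded_borel_bound[OF assms(1)] by blast
  obtain C where C: "C \<ge> 0" "\<And>x. \<bar>g x\<bar> \<le> C" using bounded_borel_bound[OF assms(2)] by blast
  note * = B C
  note [measurable] = bounded_borel_measurable[OF assms(1)] bounded_borel_measurable[OF assms(2)]
  show ?thesis
    using * by (intro bounded_borelI[of _ "B * C"]) (auto simp: abs_mult intro!: mult_mono)
qed

lemma bounded_borel_add:
  assumes "f \<in> bounded_borel" "g \<in> bounded_borel" shows "(\<lambda>x. f x + g x) \<in> bounded_borel"
proof -
  obtain B where B: "B \<ge> 0" "\<And>x. \<bar>f x\<bar> \<le> B" using bounded_borel_bound[OF assms(1)] by blast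
  obtain C where C: "C \<ge> 0" "\<And>x. \<bar>g x\<bar> \<le> C" using bounded_borel_bound[OF assms(2)] by blast
  note * = B C
  note [measurable] = bounded_borel_measurable[OF assms(1)] bounded_borel_measurable[OF assms(2)]
  show ?thesis
  proof (rule bounded_borelI[of _ "B + C"])
    show "\<bar>f x + g x\<bar> \<le> B + C" for x using *(2)[of x] *(4)[of x] by linarith
  qed simp
qed

lemma bounded_borel_diff:
  assumes "f \<in> bounded_borel" "g \<in> bounded_borel" shows "(\<lambda>x. f x - g x) \<in> bounded_borel"
  using bounded_borel_add[OF assms(1) bounded_borel_mult[OF bounded_borel_const[of "-1"] assms(2)]] by simp

lemma bounded_borel_compose:
  assumes "h \<in> bounded_borel" "g \<in> borel_measurable borel" shows "(\<lambda>x. h (g x)) \<in> bounded_borel"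
proof -
  obtain B where "\<And>x. \<bar>h x\<bar> \<le> B" using bounded_borel_bound[OF assms(1)] by blast
  moreover note [measurable] = bounded_borel_measurable[OF assms(1)] assms(2)
  ultimately show ?thesis by (intro bounded_borelI[of _ B]) auto
qed

lemma integrable_bounded_borel:
  assumes "finite_measure M" "sets M = sets borel" "h \<in> bounded_borel"
  shows "integrable M h"
proof -
  obtain B where "\<And>x. \<bar>h x\<bar> \<le> B" using bounded_borel_bound[OF assms(3)] by blast
  then show ?thesis
    using assms by (intro finite_measure.integrable_const_bound[where B=B])
      (auto simp: bounded_borel_def measurable_cong_sets[OF assms(2) refl])
qed

text \<open>Closed sets form an intersection-stable generator, and the indicator of a closed set is
  a bounded pointwise limit of continuous functions. This recovers Borel information from weak
  limits.\<close>

lemma measure_eqI_bounded_continuous: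
  fixes M N :: "'a::metric_space measure"
  assumes M: "finite_measure M" "sets M = sets borel" and N: "finite_measure N" "sets N = sets borel"
    and eq: "\<And>h :: 'a \<Rightarrow> real. continuous_on UNIV h \<Longrightarrow> (\<And>x. 0 \<le> h x \<and> h x \<le> 1) \<Longrightarrow> (\<integral>x. h x \<partial>M) = (\<integral>x. h x \<partial>N)"
  shows "M = N"
proof (rule measure_eqI_generator_eq)
  interpret M: finite_measure M by fact
  interpret N: finite_measure N by fact
  note [measurable_cong] = M(2) N(2)
  show "Int_stable (Collect (closed :: 'a set \<Rightarrow> bool))" by (auto simp: Int_stable_def)
  show "sets M = sigma_sets UNIV (Collect closed)" "sets N = sigma_sets UNIV (Collect closed)"
    using M N by (auto simp: borel_eq_closed)
  show "range (\<lambda>_. UNIV) \<subseteq> Collect (closed :: 'a set \<Rightarrow> bool)" "(\<Union>i::nat. UNIV) = UNIV"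
    "emeasure M UNIV \<noteq> \<infinity>" for i :: nat by auto
  fix C :: "'a set" assume "C \<in> Collect closed"
  then have C: "closed C" by simp
  show "emeasure M C = emeasure N C"
  \<comment> \<open>\<open>infdist\<close> to the empty set is \<open>0\<close> by convention, so
    the approximants below would be constantly \<open>1\<close>; the empty set is split off.\<close>
  proof (cases "C = {}")
    case False
    define h where "h n x = max 0 (1 - real n * infdist x C)" for n x
    have h: "continuous_on UNIV (h n)" "0 \<le> h n x" "h n x \<le> 1" for n x
      unfolding h_def by (auto intro!: continuous_intros simp: infdist_nonneg)
    have [measurable]: "h n \<in> borel_measurable borel" for n
      using h(1) by (rule borel_measurable_continuous_onI)
    have lim: "(\<lambda>n. h n x) \<longlonglongrightarrow> indicator C x" for x
    proof (cases "x \<in> C")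
      case True then show ?thesis by (simp add: h_def)
    next
      case False
      then have "infdist x C > 0" using C \<open>C \<noteq> {}\<close> by (meson infdist_pos_not_in_closed)
      then obtain m where m: "1 / infdist x C < real m" using reals_Archimedean2 by blast
      have "h n x = 0" if "n \<ge> m" for n
      proof -
        have "1 < real m * infdist x C" using m \<open>infdist x C > 0\<close> by (simp add: field_simps)
        also have "\<dots> \<le> real n * infdist x C" using that \<open>infdist x C > 0\<close> by (intro mult_right_mono) auto
        finally show ?thesis by (simp add: h_def)
      qed
      then have "\<forall>\<^sub>F n in sequentially. h n x = indicator C x"
        using False by (auto simp: eventually_sequentially)
      then show ?thesis by (rule tendsto_eventually)
    qed
    have "C \<in> sets borel" using C by simp
    then have l1: "(\<lambda>n. \<integral>x. h n x \<partial>M) \<longlonglongrightarrow> (\<integral>x. indicator C x \<partial>M)"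
      using h lim by (intro integral_dominated_convergence[where w="\<lambda>_. 1"]) auto
    have l2: "(\<lambda>n. \<integral>x. h n x \<partial>N) \<longlonglongrightarrow> (\<integral>x. indicator C x \<partial>N)"
      using \<open>C \<in> sets borel\<close> h lim by (intro integral_dominated_convergence[where w="\<lambda>_. 1"]) auto
    have *: "(\<lambda>n. \<integral>x. h n x \<partial>M) = (\<lambda>n. \<integral>x. h n x \<partial>N)" using h by (intro ext eq) auto
    have "(\<integral>x. indicator C x \<partial>M) = (\<integral>x. indicator C x \<partial>N :: real)"
      by (rule LIMSEQ_unique[OF l1 l2[folded *]])
    then have "measure M C = measure N C" using M N \<open>C \<in> sets borel\<close> by simp
    then show ?thesis by (simp add: M.emeasure_eq_measure N.emeasure_eq_measure)
  qed simp
qed simp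

lemma measure_eqI_bounded_borel:
  assumes M: "finite_measure M" "sets M = sets borel" and N: "finite_measure N" "sets N = sets borel"
    and eq: "\<And>h :: 'a::topological_space \<Rightarrow> real. h \<in> bounded_borel \<Longrightarrow> (\<integral>x. h x \<partial>M) = (\<integral>x. h x \<partial>N)"
  shows "M = N"
proof (rule measure_eqI)
  fix A assume A: "A \<in> sets M"
  interpret M: finite_measure M by fact
  interpret N: finite_measure N by fact
  have "measure M A = measure N A"
    using eq[OF bounded_borel_indicator[of A]] A M N by simp
  then show "emeasure M A = emeasure N A" by (simp add: M.emeasure_eq_measure N.emeasure_eq_measure)
qed (use M N in simp)

lemma borel_measurable_fst [measurable]: "fst \<in> borel_measurable (borel :: (real \<times> real) measure)"
  and borel_measurable_snd [measurable]: "snd \<in> borel_measurable (borel :: (real \<times> real) measure)"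
  by (auto intro!: borel_measurable_continuous_onI continuous_intros)

lemma bounded_borel_fst: "h \<in> bounded_borel \<Longrightarrow> (\<lambda>w :: real \<times> real. h (fst w)) \<in> bounded_borel"
  and bounded_borel_snd: "h \<in> bounded_borel \<Longrightarrow> (\<lambda>w :: real \<times> real. h (snd w)) \<in> bounded_borel"
  by (auto intro: bounded_borel_compose)

lemma bounded_borel_pair:
  fixes h :: "real \<times> real \<Rightarrow> real"
  assumes "h \<in> bounded_borel" "f \<in> borel_measurable borel" "g \<in> borel_measurable borel"
  shows "(\<lambda>x. h (f x, g x)) \<in> bounded_borel"
  by (rule bounded_borel_compose[OF assms(1)]) (use assms in \<open>simp add: borel_prod[symmetric]\<close>)

lemma bounded_borel_times_indicator: "A \<in> sets borel \<Longrightarrow> B \<in> sets borel \<Longrightarrow> (\<lambda>w :: real \<times> real. indicator (A \<times> B) w) \<in> bounded_borel"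
  by (intro bounded_borel_indicator borel_Times)

lemmas bounded_borel_intros = bounded_borel_const bounded_borel_mult bounded_borel_add bounded_borel_diff
  bounded_borel_fst bounded_borel_snd bounded_borel_times_indicator

text \<open>Shifting the weight \<open>\<phi>\<close> by a constant turns the claim into the equality of two positive measures.\<close>

lemma weighted_integral_zero_bounded_borel:
  fixes \<xi> :: "'a \<Rightarrow> 'b::metric_space"
  assumes M: "finite_measure M" and [measurable]: "\<phi> \<in> borel_measurable M" "\<xi> \<in> borel_measurable M"
    and B: "AE w in M. \<bar>\<phi> w\<bar> \<le> B"
    and eq: "\<And>h. continuous_on UNIV h \<Longrightarrow> (\<And>x. 0 \<le> h x \<and> h x \<le> 1) \<Longrightarrow> (\<integral>w. h (\<xi> w) * \<phi> w \<partial>M) = (0::real)"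
    and h: "h \<in> bounded_borel"
  shows "(\<integral>w. h (\<xi> w) * \<phi> w \<partial>M) = 0"
proof -
  interpret M: finite_measure M by fact
  define P where "P = distr (density M (\<lambda>w. ennreal (\<phi> w + B))) borel \<xi>"
  define Q where "Q = distr (density M (\<lambda>_. ennreal B)) borel \<xi>"
  have i: "integrable M \<phi>" using B by (intro M.integrable_const_bound[where B=B]) auto
  have fin: "finite_measure (distr (density M (\<lambda>w. ennreal (\<psi> w))) borel \<xi>)" if "integrable M \<psi>" for \<psi>
    using that by (intro finite_measureI)
      (auto simp: emeasure_distr emeasure_density real_integrable_def cong: nn_integral_cong_simp)
  have ih: "integrable M (\<lambda>w. h (\<xi> w) * \<phi> w)" "integrable M (\<lambda>w. h (\<xi> w))" if hb: "h \<in> bounded_borel" for h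
  proof -
    note [measurable] = bounded_borel_measurable[OF hb]
    obtain C where C: "C \<ge> 0" "\<And>x. \<bar>h x\<bar> \<le> C" using bounded_borel_bound[OF hb] by blast
    show "integrable M (\<lambda>w. h (\<xi> w))" using C by (intro M.integrable_const_bound[where B=C]) auto
    show "integrable M (\<lambda>w. h (\<xi> w) * \<phi> w)"
      using B C by (intro M.integrable_const_bound[where B="C*B"]) (auto simp: abs_mult intro!: mult_mono elim!: eventually_mono)
  qed
  have PQ: "(\<integral>x. h x \<partial>P) - (\<integral>x. h x \<partial>Q) = (\<integral>w. h (\<xi> w) * \<phi> w \<partial>M)" if h: "h \<in> bounded_borel" for h
  proof -
    note [measurable] = bounded_borel_measurable[OF h]
    have nn: "AE w in M. 0 \<le> \<phi> w + B" using B by eventually_elim linarith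
    have "(\<integral>x. h x \<partial>P) = (\<integral>w. (\<phi> w + B) * h (\<xi> w) \<partial>M)"
      unfolding P_def using nn by (simp add: integral_distr integral_density)
    \<comment> \<open>Nonnegativity of \<open>B\<close> is claimed only almost everywhere: for the
      zero measure the assumed bound says nothing about \<open>B\<close>.\<close>
    moreover have "AE w in M. B \<ge> 0" using B by eventually_elim linarith
    then have nn': "AE w in M. 0 \<le> B" by simp
    have "(\<integral>x. h x \<partial>Q) = (\<integral>w. B * h (\<xi> w) \<partial>M)"
      unfolding Q_def using nn' by (simp add: integral_distr integral_density)
    ultimately show ?thesis
      using ih[OF h] by (simp add: algebra_simps)
  qed
  have "P = Q"
  proof (rule measure_eqI_bounded_continuous)
    show "finite_measure P" "finite_measure Q" unfolding P_def Q_def using i by (auto intro!: fin)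
    fix h :: "'b \<Rightarrow> real" assume h: "continuous_on UNIV h" "\<And>x. 0 \<le> h x \<and> h x \<le> 1"
    then have "h \<in> bounded_borel"
      by (intro bounded_borelI[of _ 1]) (auto intro: borel_measurable_continuous_onI)
    from PQ[OF this] eq[OF h] show "(\<integral>x. h x \<partial>P) = (\<integral>x. h x \<partial>Q)" by simp
  qed (auto simp: P_def Q_def)
  then show ?thesis using PQ[OF h] by simp
qed

subsection \<open>Weak compactness in the plane\<close>

text \<open>The quotient \<open>arccos (cos (pi * t)) / pi\<close> is the distance from
  \<open>t\<close> to the nearest even integer, so continuity and period \<open>2\<close> come from
  the cosine instead of a case distinction modulo \<open>2\<close>.\<close>

definition schoenberg_bump :: "real \<Rightarrow> real" where
  "schoenberg_bump t = min 1 (max 0 (3 * arccos (cos (pi * t)) / pi - 1))"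

text \<open>The coordinates of Schoenberg's space-filling curve: the bump, which has period \<open>2\<close>, vanishes on
  \<open>[0, 1/3]\<close> and is \<open>1\<close> on \<open>[2/3, 1]\<close>, so on ternary expansions with digits \<open>0\<close> and \<open>2\<close> it reads off the
  digits, which become binary digits of the two coordinates.\<close>

definition schoenberg :: "nat \<Rightarrow> real \<Rightarrow> real" where
  "schoenberg j t = (\<Sum>k. (1/2) ^ Suc k * schoenberg_bump (3 ^ (2 * k + j) * t))"

lemma schoenberg_bump_bounds: "0 \<le> schoenberg_bump t" "schoenberg_bump t \<le> 1"
  by (simp_all add: schoenberg_bump_def)

lemma continuous_on_schoenberg_bump: "continuous_on A schoenberg_bump"
  unfolding schoenberg_bump_def by (intro continuous_intros) auto

lemma schoenberg_bump_periodic: "schoenberg_bump (2 * of_int m + t) = schoenberg_bump t"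
proof -
  have "cos (pi * (2 * of_int m + t)) = cos (pi * t + of_int m * (2 * pi))" by (simp add: algebra_simps)
  also have "\<dots> = cos (pi * t)" using cos_int_2pin sin_int_2pin[of m] by (simp add: cos_add mult.commute)
  finally show ?thesis by (simp add: schoenberg_bump_def)
qed

lemma schoenberg_bump_unit:
  assumes "0 \<le> t" "t \<le> 1" shows "schoenberg_bump t = min 1 (max 0 (3 * t - 1))"
proof -
  have "arccos (cos (pi * t)) = pi * t" using assms by (intro arccos_cos) auto
  then show ?thesis by (simp add: schoenberg_bump_def)
qed

lemma continuous_on_schoenberg: "continuous_on UNIV (schoenberg j)"
proof -
  have "uniform_limit UNIV (\<lambda>n t. \<Sum>k<n. (1/2) ^ Suc k * schoenberg_bump (3 ^ (2 * k + j) * t))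
      (\<lambda>t. \<Sum>k. (1/2) ^ Suc k * schoenberg_bump (3 ^ (2 * k + j) * t)) sequentially"
  proof (rule Weierstrass_m_test)
    show "norm ((1/2) ^ Suc k * schoenberg_bump (3 ^ (2 * k + j) * t)) \<le> (1/2) ^ Suc k" for k t
      using schoenberg_bump_bounds by (simp add: abs_mult)
    show "summable (\<lambda>k. (1/2::real) ^ Suc k)" by simp
  qed
  then show ?thesis unfolding schoenberg_def
    by (rule uniform_limit_theorem[rotated])
      (auto intro!: always_eventually continuous_intros continuous_on_compose2[OF continuous_on_schoenberg_bump])
qed

lemma binary_expansion:
  fixes u :: real assumes "0 \<le> u" "u < 1"
  obtains b :: "nat \<Rightarrow> nat" where "\<And>n. b n \<in> {0, 1}" "(\<lambda>n. (1/2) ^ Suc n * real (b n)) sums u"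
proof -
  \<comment> \<open>Consecutive dyadic floors differ by the new digit; in the partial sums these
    differences telescope to the truncation of \<open>u\<close> to \<open>n\<close> binary
    places.\<close>
  define b where "b n = nat (\<lfloor>2 ^ Suc n * u\<rfloor> - 2 * \<lfloor>2 ^ n * u\<rfloor>)" for n
  have fl: "\<lfloor>2 ^ Suc n * u\<rfloor> - 2 * \<lfloor>2 ^ n * u\<rfloor> \<in> {0, 1}" for n
  proof -
    have "2 ^ Suc n * u = 2 * (2 ^ n * u)" by simp
    then have "2 * \<lfloor>2 ^ n * u\<rfloor> \<le> \<lfloor>2 ^ Suc n * u\<rfloor>" "\<lfloor>2 ^ Suc n * u\<rfloor> < 2 * \<lfloor>2 ^ n * u\<rfloor> + 2"
      using floor_correct[of "2^n * u"] floor_correct[of "2 * (2^n * u)"] by linarith+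
    then show ?thesis by auto
  qed
  have rb: "real (b n) = of_int (\<lfloor>2 ^ Suc n * u\<rfloor> - 2 * \<lfloor>2 ^ n * u\<rfloor>)" for n
  proof -
    have "0 \<le> \<lfloor>2 ^ Suc n * u\<rfloor> - 2 * \<lfloor>2 ^ n * u\<rfloor>" using fl[of n] by auto
    then show ?thesis unfolding b_def by (rule of_nat_nat)
  qed
  have part: "(\<Sum>k<n. (1/2) ^ Suc k * real (b k)) = of_int \<lfloor>2 ^ n * u\<rfloor> / 2 ^ n" for n
  proof (induction n)
    case 0
    \<comment> \<open>The strict bound \<open>u < 1\<close> enters here: there is no integer part to
      be represented.\<close>
    have "\<lfloor>u\<rfloor> = 0" using assms by (simp add: floor_eq_iff)
    then show ?case by simp
  next
    case (Suc n)
    then show ?case unfolding sum.lessThan_Suc rb by (simp add: field_simps power_divide)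
  qed
  have "(\<lambda>n. of_int \<lfloor>2 ^ n * u\<rfloor> / 2 ^ n) \<longlonglongrightarrow> u"
  proof (rule tendsto_sandwich)
    have "(\<lambda>n. u - (1/2) ^ n) \<longlonglongrightarrow> u - 0"
      by (intro tendsto_intros LIMSEQ_realpow_zero) auto
    then show "(\<lambda>n. u - (1/2) ^ n) \<longlonglongrightarrow> u" by simp
    show "\<forall>\<^sub>F n in sequentially. u - (1/2) ^ n \<le> of_int \<lfloor>2 ^ n * u\<rfloor> / 2 ^ n"
    proof (rule always_eventually, rule allI)
      fix n
      have "2 ^ n * u - 1 \<le> of_int \<lfloor>2 ^ n * u\<rfloor>" by linarith
      then have "(2 ^ n * u - 1) / 2 ^ n \<le> of_int \<lfloor>2 ^ n * u\<rfloor> / 2 ^ n" by (rule divide_right_mono) simp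
      moreover have "(2 ^ n * u - 1) / 2 ^ n = u - (1/2) ^ n" by (simp add: diff_divide_distrib power_one_over)
      ultimately show "u - (1/2) ^ n \<le> of_int \<lfloor>2 ^ n * u\<rfloor> / 2 ^ n" by simp
    qed
    show "\<forall>\<^sub>F n in sequentially. of_int \<lfloor>2 ^ n * u\<rfloor> / 2 ^ n \<le> u"
    proof (rule always_eventually, rule allI)
      fix n
      have "of_int \<lfloor>2 ^ n * u\<rfloor> \<le> 2 ^ n * u" by linarith
      then show "of_int \<lfloor>2 ^ n * u\<rfloor> / 2 ^ n \<le> u" by (simp add: field_simps)
    qed
  qed simp
  then have "(\<lambda>n. (1/2) ^ Suc n * real (b n)) sums u" unfolding sums_def part .
  moreover have "b n \<in> {0, 1}" for n using fl[of n] by (auto simp: b_def)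
  ultimately show ?thesis using that by blast
qed

text \<open>Multiplication by \<open>3 ^ k\<close> shifts ternary digits across the point. With
  digits \<open>0\<close> and \<open>2\<close> the part that leaves is an even integer and is
  removed by the period; the rest lies in \<open>[0, 1/3]\<close> or \<open>[2/3, 1]\<close>
  according to its first digit, and the bump is constant on each of these.\<close>

lemma ternary_digits_schoenberg_bump:
  fixes a :: "nat \<Rightarrow> nat" assumes a: "\<And>n. a n \<in> {0, 1}"
  obtains t where "0 \<le> t" "t \<le> 1" "\<And>k. schoenberg_bump (3 ^ k * t) = real (a k)"
proof -
  \<comment> \<open>\<open>r k\<close> has the ternary digits \<open>2 * a k\<close>,
    \<open>2 * a (k + 1)\<close> and so on; the point sought is \<open>r 0\<close>.\<close>
  define r where "r k = (\<Sum>n. 2 * real (a (n + k)) * (1/3) ^ Suc n)" for k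
  have le: "2 * real (a (n + k)) * (1/3) ^ Suc n \<le> 2 * (1/3) ^ Suc n" for n k
    using a[of "n + k"] by auto
  have geo: "(\<lambda>n. 2 * (1/3::real) ^ Suc n) sums 1"
    using sums_mult[OF geometric_sums[of "1/3::real"], of "2/3"] by (simp add: ac_simps)
  have sum: "summable (\<lambda>n. 2 * real (a (n + k)) * (1/3) ^ Suc n)" for k
    using le[of _ k] by (intro summable_comparison_test'[OF sums_summable[OF geo], where N=0]) simp
  have r01: "0 \<le> r k" "r k \<le> 1" for k
  proof -
    show "0 \<le> r k" unfolding r_def by (intro suminf_nonneg sum) auto
    have "r k \<le> (\<Sum>n. 2 * (1/3) ^ Suc n)"
      unfolding r_def by (intro suminf_le le sum sums_summable[OF geo])
    then show "r k \<le> 1" using sums_unique[OF geo] by simp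
  qed
  have rec: "3 * r k = 2 * real (a k) + r (Suc k)" for k
  proof -
    have "r k = 2 * real (a k) / 3 + (\<Sum>n. 2 * real (a (Suc n + k)) * (1/3) ^ Suc (Suc n))"
      unfolding r_def using suminf_split_head[OF sum[of k]] by simp
    also have "(\<Sum>n. 2 * real (a (Suc n + k)) * (1/3) ^ Suc (Suc n)) = (1/3) * r (Suc k)"
      unfolding r_def using suminf_mult[OF sum[of "Suc k"], of "1/3"] by (simp add: mult.assoc mult.left_commute)
    finally show ?thesis by simp
  qed
  have shift: "\<exists>m::int. 3 ^ k * r 0 = 2 * of_int m + r k" for k
  proof (induction k)
    case 0 show ?case by (intro exI[of _ 0]) simp
  next
    case (Suc k)
    then obtain m :: int where "3 ^ k * r 0 = 2 * of_int m + r k" by blast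
    then have "3 ^ Suc k * r 0 = 2 * of_int (3 * m + int (a k)) + r (Suc k)"
      using rec[of k] by simp
    then show ?case by blast
  qed
  have "schoenberg_bump (3 ^ k * r 0) = real (a k)" for k
  proof -
    obtain m :: int where "3 ^ k * r 0 = 2 * of_int m + r k" using shift by blast
    then have "schoenberg_bump (3 ^ k * r 0) = min 1 (max 0 (3 * r k - 1))"
      using r01[of k] by (simp add: schoenberg_bump_periodic schoenberg_bump_unit)
    then show ?thesis using rec[of k] a[of k] r01[of "Suc k"] by auto
  qed
  then show ?thesis using that r01[of 0] by blast
qed

text \<open>The digits are interleaved: ternary positions \<open>2 * k\<close> carry the binary
  digits of \<open>u\<close>, positions \<open>2 * k + 1\<close> those of \<open>v\<close>, and
  \<open>schoenberg j\<close> reads the positions \<open>2 * k + j\<close>.\<close>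

lemma schoenberg_surj:
  assumes "0 \<le> u" "u < 1" "0 \<le> v" "v < 1"
  obtains t where "0 \<le> t" "t \<le> 1" "schoenberg 0 t = u" "schoenberg 1 t = v"
proof -
  obtain b where b: "\<And>n. b n \<in> {0, 1::nat}" "(\<lambda>n. (1/2) ^ Suc n * real (b n)) sums u"
    using binary_expansion[OF assms(1,2)] by blast
  obtain c where c: "\<And>n. c n \<in> {0, 1::nat}" "(\<lambda>n. (1/2) ^ Suc n * real (c n)) sums v"
    using binary_expansion[OF assms(3,4)] by blast
  define a where "a n = (if even n then b (n div 2) else c (n div 2))" for n
  have "a n \<in> {0, 1}" for n using b c by (simp add: a_def)
  then obtain t where t: "0 \<le> t" "t \<le> 1" "\<And>k. schoenberg_bump (3 ^ k * t) = real (a k)"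
    using ternary_digits_schoenberg_bump[of a] by blast
  have "schoenberg 0 t = u" "schoenberg 1 t = v"
    unfolding schoenberg_def t(3) using sums_unique[OF b(2)] sums_unique[OF c(2)] by (simp_all add: a_def)
  then show ?thesis using that t by blast
qed

lemma peano_curve:
  fixes K :: "(real \<times> real) set" assumes "bounded K"
  obtains \<gamma> :: "real \<Rightarrow> real \<times> real" where "continuous_on UNIV \<gamma>" "K \<subseteq> \<gamma> ` {0..1}"
proof -
  \<comment> \<open>The norm bound is strict because the normalised coordinates must stay below
    \<open>1\<close> to have a binary expansion.\<close>
  obtain R where R: "R > 0" "\<And>w. w \<in> K \<Longrightarrow> norm w < R"
    using assms by (meson bounded_pos_less)
  define \<gamma> where "\<gamma> t = (R * (2 * schoenberg 0 t - 1), R * (2 * schoenberg 1 t - 1))" for t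
  have "continuous_on UNIV \<gamma>"
    unfolding \<gamma>_def by (intro continuous_intros continuous_on_schoenberg)
  moreover have "w \<in> \<gamma> ` {0..1}" if "w \<in> K" for w
  proof -
    obtain x z where w: "w = (x, z)" by (cases w)
    have "\<bar>x\<bar> < R" "\<bar>z\<bar> < R"
      using R(2)[OF that] norm_fst_le[of x z] norm_snd_le[of z x] by (auto simp: w)
    then obtain t where "0 \<le> t" "t \<le> 1" "schoenberg 0 t = (x / R + 1) / 2" "schoenberg 1 t = (z / R + 1) / 2"
      using schoenberg_surj[of "(x / R + 1) / 2" "(z / R + 1) / 2"] R(1) by (auto simp: field_simps abs_less_iff)
    then have "\<gamma> t = w" using R(1) by (simp add: \<gamma>_def w field_simps)
    then show ?thesis using \<open>0 \<le> t\<close> \<open>t \<le> 1\<close> by auto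
  qed
  ultimately show ?thesis using that by blast
qed

text \<open>The section takes the least preimage, which is lower semicontinuous.\<close>

lemma borel_section:
  fixes \<gamma> :: "real \<Rightarrow> 'a::{t2_space}"
  assumes "continuous_on UNIV \<gamma>" "K \<subseteq> \<gamma> ` {0..1}" "closed K"
  obtains \<sigma> where "\<sigma> \<in> borel_measurable borel" "\<And>w. \<sigma> w \<in> {0..1}" "\<And>w. w \<in> K \<Longrightarrow> \<gamma> (\<sigma> w) = w"
proof -
  define S where "S w = {0..1} \<inter> \<gamma> -` {w}" for w
  define \<sigma> where "\<sigma> w = (if w \<in> K then Inf (S w) else 0)" for w
  have closed: "closed (S w)" for w
    unfolding S_def using assms(1) by (intro closed_Int closed_vimage) (auto simp: continuous_on_eq_continuous_at)
  have S: "Inf (S w) \<in> S w" "\<And>t. t \<in> S w \<Longrightarrow> Inf (S w) \<le> t" if "w \<in> K" for w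
  proof -
    have "S w \<noteq> {}" "bdd_below (S w)" using assms(2) that by (auto simp: S_def intro!: bdd_belowI[of _ 0])
    then show "Inf (S w) \<in> S w" "\<And>t. t \<in> S w \<Longrightarrow> Inf (S w) \<le> t"
      using closed closed_contains_Inf by (auto intro: cInf_lower)
  qed
  have "\<sigma> \<in> borel_measurable borel"
  proof (rule borel_measurableI_le)
    fix t :: real
    \<comment> \<open>Since \<open>\<sigma> w\<close> is the least preimage in the unit interval, it
      is at most \<open>t\<close> exactly if some preimage is; within \<open>K\<close> the sublevel
      set is therefore cut out by a compact image. Off \<open>K\<close> the value is the default
      \<open>0\<close>.\<close>
    have "{w \<in> space borel. \<sigma> w \<le> t} = (if t < 0 then {} else - K \<union> K \<inter> \<gamma> ` {0..min t 1})"
    proof (cases "t < 0")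
      case True
      have "\<sigma> w \<ge> 0" for w using S(1)[of w] by (auto simp: \<sigma>_def S_def)
      then show ?thesis using True by (auto simp: not_le intro: less_le_trans)
    next
      case False
      have "\<sigma> w \<le> t \<longleftrightarrow> w \<in> \<gamma> ` {0..min t 1}" if "w \<in> K" for w
      proof
        assume "\<sigma> w \<le> t" then show "w \<in> \<gamma> ` {0..min t 1}"
          using S(1)[OF that] that by (auto simp: \<sigma>_def S_def intro!: image_eqI[of _ _ "Inf (S w)"])
      next
        assume "w \<in> \<gamma> ` {0..min t 1}"
        then obtain r where "r \<in> S w" "r \<le> t" by (auto simp: S_def)
        then show "\<sigma> w \<le> t" using S(2)[OF that] that by (force simp: \<sigma>_def)
      qed
      then show ?thesis using False by (auto simp: \<sigma>_def)
    qed
    moreover have "closed (\<gamma> ` {0..min t 1})"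
      by (intro compact_imp_closed compact_continuous_image) (auto intro: continuous_on_subset[OF assms(1)])
    ultimately show "{w \<in> space borel. \<sigma> w \<le> t} \<in> sets borel"
      using assms(3) by (simp only:) (simp add: sets.Un sets.Int)
  qed
  moreover have "\<sigma> w \<in> {0..1}" for w using S(1)[of w] by (auto simp: \<sigma>_def S_def)
  moreover have "\<gamma> (\<sigma> w) = w" if "w \<in> K" for w using S(1)[OF that] that by (auto simp: \<sigma>_def S_def)
  ultimately show ?thesis using that by blast
qed

section \<open>Weak sequential compactness of measures carried by a compact set of the plane\<close>

definition weak_limit :: "(nat \<Rightarrow> 'a::topological_space measure) \<Rightarrow> 'a measure \<Rightarrow> bool" where
  "weak_limit N L \<longleftrightarrow> (\<forall>g :: 'a \<Rightarrow> real. continuous_on UNIV g \<longrightarrow> bounded (range g) \<longrightarrow>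
    (\<lambda>n. \<integral>w. g w \<partial>N n) \<longlonglongrightarrow> (\<integral>w. g w \<partial>L))"

lemma weak_limitD:
  fixes g :: "'a::topological_space \<Rightarrow> real"
  assumes "weak_limit N L" "continuous_on UNIV g" "bounded (range g)"
  shows "(\<lambda>n. \<integral>w. g w \<partial>N n) \<longlonglongrightarrow> (\<integral>w. g w \<partial>L)"
  using assms by (simp add: weak_limit_def)

text \<open>Pulling the measures back to the line along a Borel section of the space-filling curve reduces
  compactness in the plane to Helly's selection theorem.\<close>

lemma weak_limit_plane:
  fixes N :: "nat \<Rightarrow> (real \<times> real) measure"
  assumes K: "compact K" and fin: "\<And>n. finite_measure (N n)" and sets: "\<And>n. sets (N n) = sets borel"
    and mass: "\<And>n. measure (N n) UNIV = a" and a: "a > 0" and supp: "\<And>n. AE w in N n. w \<in> K"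
  obtains r L where "strict_mono (r :: nat \<Rightarrow> nat)" "finite_measure L" "sets L = sets borel" "AE w in L. w \<in> K"
    "weak_limit (\<lambda>n. N (r n)) L"
proof -
  obtain \<gamma> :: "real \<Rightarrow> real \<times> real" where \<gamma>: "continuous_on UNIV \<gamma>" "K \<subseteq> \<gamma> ` {0..1}"
    using peano_curve[OF compact_imp_bounded[OF K]] by blast
  obtain \<sigma> :: "real \<times> real \<Rightarrow> real" where \<sigma>: "\<sigma> \<in> borel_measurable borel" "\<And>w. \<sigma> w \<in> {0..1}" "\<And>w. w \<in> K \<Longrightarrow> \<gamma> (\<sigma> w) = w"
    using borel_section[OF \<gamma> compact_imp_closed[OF K]] by blast
  note [measurable_cong] = sets
  note [measurable] = borel_measurable_continuous_onI[OF \<gamma>(1)] \<sigma>(1)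
  \<comment> \<open>Helly's theorem concerns probability distributions on the line, so the common
    mass \<open>a\<close> is divided out here and multiplied back in \<open>L\<close>.\<close>
  define \<rho> where "\<rho> n = distr (density (N n) (\<lambda>_. ennreal (1 / a))) borel \<sigma>" for n
  have space: "space (N n) = UNIV" for n using sets_eq_imp_space_eq[OF sets[of n]] by simp
  have prob: "prob_space (\<rho> n)" for n
  proof
    have "emeasure (N n) UNIV = ennreal a"
      using finite_measure.emeasure_eq_measure[OF fin] mass by simp
    then show "emeasure (\<rho> n) (space (\<rho> n)) = 1"
      using a by (simp add: \<rho>_def emeasure_distr space emeasure_density_const ennreal_mult[symmetric])
  qed
  have rd: "real_distribution (\<rho> n)" for n
    using prob by (simp add: real_distribution_def real_distribution_axioms_def \<rho>_def)
  have unit: "AE t in \<rho> n. t \<in> {0..1}" for n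
    unfolding \<rho>_def by (subst AE_distr_iff) (use \<sigma>(2) in auto)
  have "tight \<rho>"
    unfolding tight_def
  proof (intro conjI allI impI rd)
    fix \<epsilon> :: real assume "\<epsilon> > 0"
    \<comment> \<open>The intervals in \<open>tight\<close> exclude their left end, hence
      \<open>-1\<close> rather than \<open>0\<close>.\<close>
    have "measure (\<rho> n) {-1<..1} = 1" for n
      using unit[of n] by (intro prob_space.prob_eq_1[THEN iffD2] prob) (auto simp: \<rho>_def elim!: eventually_mono)
    then show "\<exists>c d. c < d \<and> (\<forall>n. 1 - \<epsilon> < measure (\<rho> n) {c<..d})"
      using \<open>\<epsilon> > 0\<close> by (intro exI[of _ "-1"] exI[of _ 1]) simp
  qed
  from tight_imp_convergent_subsubsequence[OF this strict_mono_id] obtain r M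
    where r: "strict_mono r" and M: "real_distribution M" and conv: "weak_conv_m (\<rho> \<circ> r) M"
    by auto
  interpret M: real_distribution M by fact
  define L where "L = distr (density M (\<lambda>_. ennreal a)) borel \<gamma>"
  have L: "finite_measure L" "sets L = sets borel"
    by (auto intro!: finite_measureI simp: L_def emeasure_distr emeasure_density_const M.emeasure_eq_measure ennreal_mult_eq_top_iff)
  have lim: "(\<lambda>n. \<integral>w. g w \<partial>N (r n)) \<longlonglongrightarrow> (\<integral>w. g w \<partial>L)"
    if g: "continuous_on UNIV g" "bounded (range g)" for g :: "real \<times> real \<Rightarrow> real"
  proof -
    note [measurable] = borel_measurable_continuous_onI[OF g(1)]
    obtain B where B: "\<And>w. norm (g w) \<le> B" using g(2) by (auto simp: bounded_iff)
    have "continuous_on UNIV (\<lambda>t. g (\<gamma> t))" by (rule continuous_on_compose2[OF g(1) \<gamma>(1)]) auto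
    then have "(\<lambda>n. \<integral>t. g (\<gamma> t) \<partial>\<rho> (r n)) \<longlonglongrightarrow> (\<integral>t. g (\<gamma> t) \<partial>M)"
      using weak_conv_imp_integral_bdd_continuous_conv[OF _ M conv, of "\<lambda>t. g (\<gamma> t)" B] rd B
      by (simp add: continuous_on_eq_continuous_at)
    \<comment> \<open>As \<open>\<gamma>\<close> inverts the section on \<open>K\<close>, which
      carries \<open>N n\<close>, going to the line and back changes no integral.\<close>
    moreover have "(\<integral>t. g (\<gamma> t) \<partial>\<rho> n) = (\<integral>w. g w \<partial>N n) / a" for n
    proof -
      have "(\<integral>t. g (\<gamma> t) \<partial>\<rho> n) = (\<integral>w. g (\<gamma> (\<sigma> w)) \<partial>N n) / a"
        using a by (simp add: \<rho>_def integral_distr integral_density)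
      also have "(\<integral>w. g (\<gamma> (\<sigma> w)) \<partial>N n) = (\<integral>w. g w \<partial>N n)"
        using supp[of n] \<sigma>(3) by (intro integral_cong_AE) (auto elim!: eventually_mono)
      finally show ?thesis .
    qed
    moreover have "(\<integral>w. g w \<partial>L) = a * (\<integral>t. g (\<gamma> t) \<partial>M)"
      using a by (simp add: L_def integral_distr integral_density)
    ultimately show ?thesis using tendsto_mult_left[of _ _ _ a] a by fastforce
  qed
  have "AE w in L. w \<in> K"
  \<comment> \<open>The distance to the empty set is \<open>0\<close> by convention and would not
    detect mass; an empty \<open>K\<close> contradicts the positive mass instead.\<close>
  proof (cases "K = {}")
    case True
    have "measure (N n) UNIV = 0" for n
      using supp[of n] True by (simp add: AE_iff_measurable[OF _ refl] space measure_def sets)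
    then show ?thesis using mass a by simp
  next
    case False
    define g where "g w = min 1 (infdist w K)" for w
    have g: "continuous_on UNIV g" "0 \<le> g w" "g w \<le> 1" for w
      unfolding g_def by (auto intro!: continuous_intros simp: infdist_nonneg)
    then have [measurable]: "g \<in> borel_measurable borel" by (intro borel_measurable_continuous_onI)
    have "bounded (range g)" using g by (auto simp: bounded_iff intro!: exI[of _ 1])
    then have "(\<lambda>n. \<integral>w. g w \<partial>N (r n)) \<longlonglongrightarrow> (\<integral>w. g w \<partial>L)" using lim g by blast
    moreover have "(\<integral>w. g w \<partial>N n) = 0" for n
      using supp[of n] by (intro integral_eq_zero_AE) (auto simp: g_def elim!: eventually_mono)
    ultimately have "(\<integral>w. g w \<partial>L) = 0" by (simp add: LIMSEQ_const_iff)
    moreover have "integrable L g"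
      using g by (intro finite_measure.integrable_const_bound[OF L(1), where B=1]) (auto simp: measurable_cong_sets[OF L(2) refl])
    ultimately have "AE w in L. g w = 0"
      using g by (subst (asm) integral_nonneg_eq_0_iff_AE) auto
    then show ?thesis
    proof eventually_elim
      case (elim w)
      then have "infdist w K = 0" by (auto simp: g_def min_def split: if_splits)
      then show ?case using in_closed_iff_infdist_zero[OF compact_imp_closed[OF K] False] by simp
    qed
  qed
  moreover have "weak_limit (\<lambda>n. N (r n)) L" using lim by (simp add: weak_limit_def)
  ultimately show ?thesis using r L that by blast
qed

subsection \<open>Measures carried by graphs\<close>

text \<open>For each level \<open>p\<close> a half-line \<open>U p\<close> separates the abscissae below \<open>{z > p}\<close> from those below
  \<open>{z < p}\<close>; the countably many rational levels determine \<open>z\<close>.\<close>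

lemma antitone_measure_graph:
  fixes N :: "(real \<times> real) measure"
  assumes sets [measurable_cong]: "sets N = sets borel"
    and atomless: "\<And>s. AE w in N. fst w \<noteq> s"
    and bd: "AE w in N. zl \<le> snd w \<and> snd w \<le> zu"
    and anti: "\<And>s p. (AE w in N. \<not> (fst w < s \<and> snd w < p)) \<or> (AE w in N. \<not> (s < fst w \<and> p < snd w))"
  obtains T where "T \<in> borel_measurable borel" "AE w in N. snd w = T (fst w)"
proof -
  \<comment> \<open>\<open>s\<close> belongs to \<open>S p\<close> if there is mass to the right of
    \<open>s\<close> above level \<open>p\<close>; the hypothesis \<open>anti\<close> then forbids
    mass to the left of \<open>s\<close> below \<open>p\<close>.\<close>
  define S where "S p = {s. \<not> (AE w in N. \<not> (s < fst w \<and> p < snd w))}" for p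
  define U where "U p = (\<Union>s\<in>S p. {..<s})" for p
  have U_open: "open (U p)" for p by (auto simp: U_def)
  have down: "r \<in> S p" if "s \<in> S p" "r < s" for r s p
  proof (rule ccontr)
    assume "r \<notin> S p"
    then have "AE w in N. \<not> (r < fst w \<and> p < snd w)" by (simp add: S_def)
    then have "AE w in N. \<not> (s < fst w \<and> p < snd w)"
      by (rule eventually_mono) (use that(2) in auto)
    then show False using that(1) by (simp add: S_def)
  qed
  have low: "AE w in N. snd w < p \<longrightarrow> fst w \<notin> U p" for p
  proof -
    have "AE w in N. \<forall>r\<in>\<rat>. r \<in> S p \<longrightarrow> \<not> (fst w < r \<and> snd w < p)"
      using anti[of _ p] by (subst AE_ball_countable) (auto simp: countable_rat S_def)
    then show ?thesis
    proof eventually_elim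
      case (elim w)
      show ?case
      proof (intro impI notI)
        assume "snd w < p" "fst w \<in> U p"
        then obtain s where "s \<in> S p" "fst w < s" by (auto simp: U_def)
        then obtain r where "r \<in> \<rat>" "fst w < r" "r < s" using Rats_dense_in_real by blast
        then show False using elim down \<open>s \<in> S p\<close> \<open>snd w < p\<close> by blast
      qed
    qed
  qed
  have high: "AE w in N. p < snd w \<longrightarrow> fst w \<in> U p" for p
  proof -
    \<comment> \<open>\<open>E\<close> collects the end point of the half-line \<open>U p\<close>:
      approached by \<open>S p\<close> from the left, but not covered. There is at most one such
      abscissa, and atomlessness makes it negligible.\<close>
    define E where "E = {x. x \<notin> U p \<and> (\<forall>r\<in>\<rat>. r < x \<longrightarrow> r \<in> S p)}"
    have "x = x'" if "x \<in> E" "x' \<in> E" for x x'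
    proof -
      have "\<not> a < b" if "a \<in> E" "b \<in> E" for a b
      proof
        assume "a < b"
        then obtain r where "r \<in> \<rat>" "a < r" "r < b" using Rats_dense_in_real by blast
        then show False using that by (auto simp: E_def U_def)
      qed
      then show ?thesis using that by (meson linorder_less_linear)
    qed
    then obtain e where "E \<subseteq> {e}" by blast
    then have 1: "AE w in N. fst w \<notin> E" using atomless[of e] by (auto elim!: eventually_mono)
    have 2: "AE w in N. \<forall>r\<in>\<rat>. r \<notin> S p \<longrightarrow> \<not> (r < fst w \<and> p < snd w)"
      by (subst AE_ball_countable) (auto simp: countable_rat S_def)
    from 1 2 show ?thesis by eventually_elim (auto simp: E_def)
  qed
  \<comment> \<open>The graph is recovered as the supremum of the rational levels \<open>p\<close>
    with \<open>x\<close> in \<open>U p\<close>. Clipping the levels keeps the supremum bounded, and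
    \<open>zl\<close> stands in for levels that do not qualify.\<close>
  define T where "T x = (SUP p\<in>\<rat>. if x \<in> U p then max zl (min p zu) else zl)" for x
  have bdd: "bdd_above ((\<lambda>p. if x \<in> U p then max zl (min p zu) else zl) ` \<rat>)" for x
    by (rule bdd_aboveI[of _ "max zl zu"]) auto
  have [measurable]: "U p \<in> sets borel" for p using U_open by simp
  have T: "T \<in> borel_measurable borel"
    unfolding T_def
  proof (rule borel_measurable_cSUP)
    show "countable (\<rat> :: real set)" by (rule countable_rat)
  qed (use bdd in \<open>simp_all\<close>)
  have "AE w in N. \<forall>p\<in>\<rat>. (snd w < p \<longrightarrow> fst w \<notin> U p) \<and> (p < snd w \<longrightarrow> fst w \<in> U p)"
    using low high by (subst AE_ball_countable) (auto simp: countable_rat)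
  with bd have "AE w in N. snd w = T (fst w)"
  proof eventually_elim
    case (elim w)
    have ge: "(if fst w \<in> U p then max zl (min p zu) else zl) \<le> snd w" if "p \<in> \<rat>" for p
      using elim that by (cases "snd w < p") auto
    have "T (fst w) \<le> snd w" unfolding T_def
      using Rats_0 ge by (intro cSUP_least) auto
    moreover have "snd w \<le> T (fst w)"
    proof (rule ccontr)
      assume "\<not> snd w \<le> T (fst w)"
      then obtain p where p: "p \<in> \<rat>" "T (fst w) < p" "p < snd w" using Rats_dense_in_real by (meson not_le)
      then have "p \<le> (if fst w \<in> U p then max zl (min p zu) else zl)" using elim by auto
      also have "\<dots> \<le> T (fst w)" unfolding T_def by (rule cSUP_upper[OF p(1) bdd])
      finally show False using p by simp
    qed
    ultimately show ?case by simp
  qed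
  with T that show ?thesis by blast
qed

text \<open>On two graphs the conditional weights are forced by the conditional mean: if \<open>z \<in> {T x, U x}\<close>
  then \<open>1{z = U x} = (z - T x) / (U x - T x)\<close>, which is affine in \<open>z\<close>.\<close>

lemma measure_on_two_graphs_unique:
  fixes N N' :: "(real \<times> real) measure"
  assumes N: "finite_measure N" "sets N = sets borel" and N': "finite_measure N'" "sets N' = sets borel"
    and [measurable]: "T \<in> borel_measurable borel" "U \<in> borel_measurable borel"
    and gap: "\<And>x. T x \<le> a" "\<And>x. b \<le> U x" "a < b" and bd: "\<And>x. \<bar>T x\<bar> \<le> B" "\<And>x. \<bar>U x\<bar> \<le> B"
    and graph: "AE w in N. snd w = T (fst w) \<or> snd w = U (fst w)" "AE w in N'. snd w = T (fst w) \<or> snd w = U (fst w)"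
    and mean: "\<And>h. h \<in> bounded_borel \<Longrightarrow> (\<integral>w. h (fst w) * (snd w - y) \<partial>N) = 0"
      "\<And>h. h \<in> bounded_borel \<Longrightarrow> (\<integral>w. h (fst w) * (snd w - y) \<partial>N') = 0"
    and marg: "\<And>h. h \<in> bounded_borel \<Longrightarrow> (\<integral>w. h (fst w) \<partial>N) = (\<integral>w. h (fst w) \<partial>N')"
  shows "N = N'"
proof (rule measure_eqI_bounded_borel[OF N N'])
  fix h :: "real \<times> real \<Rightarrow> real" assume h: "h \<in> bounded_borel"
  note hm [measurable] = bounded_borel_measurable[OF h]
  have [measurable]: "h \<in> borel_measurable (borel \<Otimes>\<^sub>M borel)" using hm by (simp add: borel_prod)
  obtain C where C: "C \<ge> 0" "\<And>w. \<bar>h w\<bar> \<le> C" using bounded_borel_bound[OF h] by blast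
  \<comment> \<open>Affine interpolation of \<open>h\<close> in \<open>z\<close> between the two
    graphs: \<open>k1\<close> is the slope and \<open>k0\<close> the value at \<open>z = y\<close>.
    The slope term integrates to \<open>0\<close> by the mean condition, so only \<open>k0\<close>
    and the first marginal remain; the gap keeps the slope bounded.\<close>
  define k1 where "k1 x = (h (x, U x) - h (x, T x)) / (U x - T x)" for x
  define k0 where "k0 x = h (x, T x) + k1 x * (y - T x)" for x
  have k1: "k1 \<in> bounded_borel"
  proof (rule bounded_borelI[of _ "2 * C / (b - a)"])
    fix x
    have "\<bar>h (x, U x) - h (x, T x)\<bar> \<le> 2 * C" using C(2)[of "(x, U x)"] C(2)[of "(x, T x)"] by linarith
    moreover have "b - a \<le> U x - T x" using gap(1)[of x] gap(2)[of x] by linarith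
    ultimately show "\<bar>k1 x\<bar> \<le> 2 * C / (b - a)"
      using gap(3) C(1) unfolding k1_def abs_divide by (intro frac_le) auto
  qed (unfold k1_def, measurable)
  have k0: "k0 \<in> bounded_borel"
  proof -
    have "(\<lambda>x. h (x, T x)) \<in> bounded_borel" by (rule bounded_borel_compose[OF h]) (simp add: borel_prod[symmetric])
    moreover have "T \<in> bounded_borel" using bd by (intro bounded_borelI[of _ B]) auto
    ultimately show ?thesis unfolding k0_def using k1 by (intro bounded_borel_add bounded_borel_mult bounded_borel_diff) auto
  qed
  have *: "(\<integral>w. h w \<partial>L) = (\<integral>w. k0 (fst w) \<partial>L)"
    if L: "finite_measure L" "sets L = sets borel" "AE w in L. snd w = T (fst w) \<or> snd w = U (fst w)"
      and mean: "\<And>h. h \<in> bounded_borel \<Longrightarrow> (\<integral>w. h (fst w) * (snd w - y) \<partial>L) = 0" for L :: "(real \<times> real) measure"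
  proof -
    note [measurable_cong] = L(2)
    note [measurable] = bounded_borel_measurable[OF k0] bounded_borel_measurable[OF k1]
    obtain D where D: "D \<ge> 0" "\<And>w. \<bar>k1 w\<bar> \<le> D" using bounded_borel_bound[OF k1] by blast
    have i1: "integrable L (\<lambda>w. k0 (fst w))"
      by (rule integrable_bounded_borel[OF L(1,2) bounded_borel_compose[OF k0]]) simp
    have i2: "integrable L (\<lambda>w. k1 (fst w) * (snd w - y))"
    proof (rule finite_measure.integrable_const_bound[OF L(1), where B="D * (B + \<bar>y\<bar>)"])
      show "AE w in L. norm (k1 (fst w) * (snd w - y)) \<le> D * (B + \<bar>y\<bar>)"
        using L(3)
      proof eventually_elim
        case (elim w)
        then have "\<bar>snd w\<bar> \<le> B" using bd by auto
        then have "\<bar>snd w - y\<bar> \<le> B + \<bar>y\<bar>" by linarith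
        then show ?case using D by (auto simp: abs_mult intro!: mult_mono)
      qed
    qed simp
    have "(\<integral>w. h w \<partial>L) = (\<integral>w. k0 (fst w) + k1 (fst w) * (snd w - y) \<partial>L)"
    proof (rule integral_cong_AE)
      show "AE w in L. h w = k0 (fst w) + k1 (fst w) * (snd w - y)"
        using L(3)
      proof eventually_elim
        case (elim w)
        have "U (fst w) - T (fst w) \<noteq> 0" using gap(1)[of "fst w"] gap(2)[of "fst w"] gap(3) by linarith
        then have "k1 (fst w) * (U (fst w) - T (fst w)) = h (fst w, U (fst w)) - h (fst w, T (fst w))"
          by (simp add: k1_def)
        moreover have "snd w = T (fst w) \<and> h w = h (fst w, T (fst w)) \<or> snd w = U (fst w) \<and> h w = h (fst w, U (fst w))"
          using elim by (metis prod.collapse)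
        ultimately show ?case by (auto simp: k0_def algebra_simps)
      qed
    qed auto
    also have "\<dots> = (\<integral>w. k0 (fst w) \<partial>L) + (\<integral>w. k1 (fst w) * (snd w - y) \<partial>L)"
      by (rule Bochner_Integration.integral_add[OF i1 i2])
    finally show ?thesis using mean[OF k1] by simp
  qed
  show "(\<integral>x. h x \<partial>N) = (\<integral>x. h x \<partial>N')"
    using *[OF N graph(1) mean(1)] *[OF N' graph(2) mean(2)] marg[OF k0] by simp
qed

subsection \<open>Exchange of mass under the Spence-Mirrlees condition\<close>

text \<open>The convexity weight is \<open>(m - u) / (v - u)\<close>; clearing denominators makes
  the middle point the parameter. That \<open>m\<close> lies in \<open>S\<close> has to be assumed,
  since \<open>S\<close> may have gaps.\<close>

lemma strictly_concave_on_three_points: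
  assumes "strictly_concave_on S g" "u \<in> S" "v \<in> S" "m \<in> S" "u < m" "m < v"
  shows "(v - m) * g u + (m - u) * g v < (v - u) * g m"
proof -
  define t where "t = (m - u) / (v - u)"
  have t: "t * (v - u) = m - u" "0 < t" "t < 1" using assms(5,6) by (simp_all add: t_def divide_less_eq)
  have m: "(1 - t) * u + t * v = m"
  proof -
    have "(1 - t) * u + t * v = u + t * (v - u)" by (simp add: algebra_simps)
    then show ?thesis using t(1) by simp
  qed
  have "u < v" using assms(5,6) by simp
  then have "(1 - t) * g u + t * g v < g m"
    using assms(1)[unfolded strictly_concave_on_def, rule_format, OF assms(2,3), of t] t m assms(4) by simp
  then have "(v - u) * ((1 - t) * g u + t * g v) < (v - u) * g m"
    using assms(5,6) by (intro mult_strict_left_mono) auto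
  moreover have "(v - u) * (1 - t) = v - m" "(v - u) * t = m - u"
    using t(1) by (simp_all add: algebra_simps)
  ultimately show ?thesis by (simp add: distrib_left mult.assoc[symmetric])
qed

text \<open>For \<open>z\<close> outside the interval the nearer of \<open>p\<close> and
  \<open>q\<close> is the middle point of the three-point inequality, for \<open>z\<close> inside it
  is \<open>z\<close> itself. These are the signs of cost minus chord that decide the
  exchange.\<close>

lemma strictly_concave_on_chord:
  assumes g: "strictly_concave_on S g" and pq: "p \<in> S" "q \<in> S" "p < q" and z: "z \<in> S"
  shows "z < p \<or> q < z \<Longrightarrow> g z < g p + (g q - g p) / (q - p) * (z - p)"
    and "p \<le> z \<Longrightarrow> z \<le> q \<Longrightarrow> g p + (g q - g p) / (q - p) * (z - p) \<le> g z"
proof -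
  have eq: "(q - p) * (g p + (g q - g p) / (q - p) * (z - p)) = (q - p) * g p + (g q - g p) * (z - p)"
    using pq(3) by (simp add: field_simps)
  have less: "g z < g p + (g q - g p) / (q - p) * (z - p) \<longleftrightarrow> (q - p) * g z < (q - p) * g p + (g q - g p) * (z - p)"
    unfolding eq[symmetric] using pq(3) by simp
  show "z < p \<or> q < z \<Longrightarrow> g z < g p + (g q - g p) / (q - p) * (z - p)"
    unfolding less
    using strictly_concave_on_three_points[OF g z pq(2) pq(1)] strictly_concave_on_three_points[OF g pq(1) z pq(2)] pq(3)
    by (auto simp: algebra_simps)
  assume "p \<le> z" "z \<le> q"
  then consider "z = p" | "z = q" | "p < z" "z < q" by linarith
  then show "g p + (g q - g p) / (q - p) * (z - p) \<le> g z"
  proof cases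
    case 3
    have "\<not> (q - p) * g z < (q - p) * g p + (g q - g p) * (z - p)"
      using strictly_concave_on_three_points[OF g pq(1,2) z 3] by (simp add: algebra_simps)
    then show ?thesis unfolding less[symmetric] by simp
  qed (use pq in auto)
qed

lemma integral_pos_if_nonneg:
  fixes f :: "'a \<Rightarrow> real"
  assumes "integrable M f" "AE x in M. 0 \<le> f x" "\<not> (AE x in M. f x = 0)"
  shows "0 < (\<integral>x. f x \<partial>M)"
  using integral_nonneg_AE[OF assms(2)] integral_nonneg_eq_0_iff_AE[OF assms(1,2)] assms(3)
  by (auto simp: less_le)

text \<open>Each of the two weights is the conditional first moment about \<open>m\<close> of the opposite side,
  normalised to be bounded; hence the weighted mass has conditional mean \<open>m\<close>.\<close>

lemma balanced_removal:
  fixes N :: "(real \<times> real) measure"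
  assumes N: "finite_measure N" "sets N = sets borel" and B: "AE w in N. \<bar>snd w\<bar> \<le> B"
    and m: "p \<le> m" "m \<le> q"
    and pos: "\<not> (AE w in N. w \<notin> {..<s} \<times> {..<p})" "\<not> (AE w in N. w \<notin> {..<s} \<times> {q<..})"
    and eqv: "(\<forall>A\<in>sets borel. (AE w in N. w \<notin> A \<times> {..<p}) \<longrightarrow> (AE w in N. fst w \<notin> A)) \<or>
      (\<forall>A\<in>sets borel. (AE w in N. w \<notin> A \<times> {q<..}) \<longrightarrow> (AE w in N. fst w \<notin> A))"
  obtains fL fH :: "real \<times> real \<Rightarrow> real" where
    "fL \<in> bounded_borel" "\<And>w. 0 \<le> fL w" "\<And>w. fL w \<le> 1" "\<And>w. w \<notin> {..<s} \<times> {..<p} \<Longrightarrow> fL w = 0"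
    "fH \<in> bounded_borel" "\<And>w. 0 \<le> fH w" "\<And>w. fH w \<le> 1" "\<And>w. w \<notin> {..<s} \<times> {q<..} \<Longrightarrow> fH w = 0"
    "0 < (\<integral>w. fL w \<partial>N)" "0 < (\<integral>w. fH w \<partial>N)"
    "\<And>h. h \<in> bounded_borel \<Longrightarrow> (\<integral>w. h (fst w) * fL w * (m - snd w) \<partial>N) = (\<integral>w. h (fst w) * fH w * (snd w - m) \<partial>N)"
proof -
  interpret N: finite_measure N by fact
  note [measurable_cong] = N(2)
  have spN: "space N = UNIV" using sets_eq_imp_space_eq[OF N(2)] by simp
  \<comment> \<open>The sigma-algebra generated by the abscissa; conditioning on it replaces a
    disintegration of \<open>N\<close> into vertical fibres.\<close>
  define F where "F = vimage_algebra UNIV (fst :: real \<times> real \<Rightarrow> real) borel"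
  have F_sets: "sets F = {fst -` A | A. A \<in> sets borel}" by (simp add: F_def sets_vimage_algebra2)
  have F_fst [measurable]: "fst \<in> borel_measurable F"
    unfolding F_def by (rule measurable_vimage_algebra1) simp
  interpret S: finite_measure_subalgebra N F
  proof
    show "subalgebra N F"
    proof (rule subalgebra_def[THEN iffD2], intro conjI subsetI)
      fix E assume "E \<in> sets F"
      then obtain A where "E = fst -` A" "A \<in> sets borel" by (auto simp: F_sets)
      then have "E = A \<times> UNIV" by auto
      then show "E \<in> sets N" using \<open>A \<in> sets borel\<close> by (simp add: N(2) borel_Times)
    qed (simp add: F_def spN)
  qed
  define dL :: "real \<times> real \<Rightarrow> real" where "dL w = indicator {..<p} (snd w) * (m - snd w)" for w
  define dH :: "real \<times> real \<Rightarrow> real" where "dH w = indicator {q<..} (snd w) * (snd w - m)" for w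
  have d_meas [measurable]: "dL \<in> borel_measurable N" "dH \<in> borel_measurable N"
    unfolding dL_def dH_def by measurable
  have d_nonneg: "0 \<le> dL w" "0 \<le> dH w" for w
    using m by (auto simp: dL_def dH_def indicator_def)
  have d_bd: "AE w in N. norm (dL w) \<le> B + \<bar>m\<bar>" "AE w in N. norm (dH w) \<le> B + \<bar>m\<bar>"
  proof -
    have "norm (dL w) \<le> B + \<bar>m\<bar> \<and> norm (dH w) \<le> B + \<bar>m\<bar>" if "\<bar>snd w\<bar> \<le> B" for w
      using that by (cases "snd w < p"; cases "q < snd w"; simp add: dL_def dH_def; linarith)
    then show "AE w in N. norm (dL w) \<le> B + \<bar>m\<bar>" "AE w in N. norm (dH w) \<le> B + \<bar>m\<bar>"
      using B by (auto elim!: eventually_mono)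
  qed
  \<comment> \<open>Conditional expectations of nonnegative functions are nonnegative only almost
    everywhere; the maximum with \<open>0\<close> makes the weights below nonnegative
    everywhere.\<close>
  define gL where "gL w = max 0 (real_cond_exp N F dL w)" for w
  define gH where "gH w = max 0 (real_cond_exp N F dH w)" for w
  have g_meas [measurable]: "gL \<in> borel_measurable F" "gH \<in> borel_measurable F"
    unfolding gL_def gH_def by measurable
  have g_nonneg: "0 \<le> gL w" "0 \<le> gH w" for w by (auto simp: gL_def gH_def)
  have gL_AE: "AE w in N. real_cond_exp N F dL w = gL w"
    using S.real_cond_exp_pos[OF _ d_meas(1)] d_nonneg by (auto simp: gL_def elim!: eventually_mono)
  have gH_AE: "AE w in N. real_cond_exp N F dH w = gH w"
    using S.real_cond_exp_pos[OF _ d_meas(2)] d_nonneg by (auto simp: gH_def elim!: eventually_mono)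
  have from_F: "k \<in> borel_measurable N" if "k \<in> borel_measurable F" for k :: "real \<times> real \<Rightarrow> real"
    using measurable_from_subalg[OF S.subalg that] .
  note [measurable] = from_F[OF g_meas(1)] from_F[OF g_meas(2)]
  have cond: "integrable N (\<lambda>w. k w * g w)" "(\<integral>w. k w * g w \<partial>N) = (\<integral>w. k w * d w \<partial>N)"
    if k [measurable]: "k \<in> borel_measurable F" and C: "\<And>w. \<bar>k w\<bar> \<le> C"
      and d: "d \<in> borel_measurable N" "AE w in N. norm (d w) \<le> B + \<bar>m\<bar>" "AE w in N. real_cond_exp N F d w = g w"
      and g: "g \<in> borel_measurable N"
    for k d g :: "real \<times> real \<Rightarrow> real" and C
  proof -
    note [measurable] = from_F[OF k] d(1) g
    have int: "integrable N (\<lambda>w. k w * d w)"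
    proof (rule N.integrable_const_bound[where B="C * (B + \<bar>m\<bar>)"])
      show "AE w in N. norm (k w * d w) \<le> C * (B + \<bar>m\<bar>)"
        using d(2)
      proof eventually_elim
        case (elim w)
        have "0 \<le> C" using C[of w] by linarith
        then show ?case using elim C[of w] by (auto simp: abs_mult intro!: mult_mono)
      qed
    qed simp
    have ae: "AE w in N. k w * real_cond_exp N F d w = k w * g w" using d(3) by eventually_elim simp
    show "integrable N (\<lambda>w. k w * g w)"
      using S.real_cond_exp_intg(1)[OF int k d(1)] by (subst (asm) integrable_cong_AE[OF _ _ ae]) auto
    show "(\<integral>w. k w * g w \<partial>N) = (\<integral>w. k w * d w \<partial>N)"
      using S.real_cond_exp_intg(2)[OF int k d(1)] integral_cong_AE[OF _ _ ae] by auto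
  qed
  note condL = cond[OF _ _ d_meas(1) d_bd(1) gL_AE from_F[OF g_meas(1)]]
  note condH = cond[OF _ _ d_meas(2) d_bd(2) gH_AE from_F[OF g_meas(2)]]
  \<comment> \<open>The summand \<open>1\<close> keeps the denominator positive even where both
    conditional moments vanish.\<close>
  define \<alpha> where "\<alpha> w = indicator {..<s} (fst w) * (gH w / (1 + gL w + gH w))" for w
  define \<beta> where "\<beta> w = indicator {..<s} (fst w) * (gL w / (1 + gL w + gH w))" for w
  have ab_meas: "\<alpha> \<in> borel_measurable F" "\<beta> \<in> borel_measurable F"
    unfolding \<alpha>_def \<beta>_def by measurable
  note [measurable] = from_F[OF ab_meas(1)] from_F[OF ab_meas(2)]
  have ab: "0 \<le> \<alpha> w" "\<alpha> w \<le> 1" "0 \<le> \<beta> w" "\<beta> w \<le> 1" for w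
    using g_nonneg[of w] by (auto simp: \<alpha>_def \<beta>_def indicator_def divide_le_eq_1)
  have ab_eq: "\<alpha> w * gL w = \<beta> w * gH w" for w by (simp add: \<alpha>_def \<beta>_def)
  define fL where "fL w = \<alpha> w * indicator {..<p} (snd w)" for w
  define fH where "fH w = \<beta> w * indicator {q<..} (snd w)" for w
  have f_meas: "fL \<in> borel_measurable N" "fH \<in> borel_measurable N"
    unfolding fL_def fH_def by measurable
  have f01: "0 \<le> fL w" "fL w \<le> 1" "0 \<le> fH w" "fH w \<le> 1" for w
    using ab[of w] by (auto simp: fL_def fH_def indicator_def)
  have bal: "(\<integral>w. h (fst w) * fL w * (m - snd w) \<partial>N) = (\<integral>w. h (fst w) * fH w * (snd w - m) \<partial>N)"
    if h: "h \<in> bounded_borel" for h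
  proof -
    note [measurable] = bounded_borel_measurable[OF h]
    obtain C where C: "0 \<le> C" "\<And>x. \<bar>h x\<bar> \<le> C" using bounded_borel_bound[OF h] by blast
    have m': "(\<lambda>w. h (fst w) * \<alpha> w) \<in> borel_measurable F" "(\<lambda>w. h (fst w) * \<beta> w) \<in> borel_measurable F"
      using ab_meas by measurable
    have b': "\<bar>h (fst w) * \<alpha> w\<bar> \<le> C" "\<bar>h (fst w) * \<beta> w\<bar> \<le> C" for w
      using mult_mono[of "\<bar>h (fst w)\<bar>" C "\<alpha> w" 1] mult_mono[of "\<bar>h (fst w)\<bar>" C "\<beta> w" 1] C ab[of w]
      by (auto simp: abs_mult)
    have "(\<integral>w. h (fst w) * fL w * (m - snd w) \<partial>N) = (\<integral>w. h (fst w) * \<alpha> w * gL w \<partial>N)"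
      using condL(2)[OF m'(1) b'(1)] by (simp add: fL_def dL_def ac_simps)
    also have "\<dots> = (\<integral>w. h (fst w) * \<beta> w * gH w \<partial>N)" by (simp add: mult.assoc ab_eq)
    also have "\<dots> = (\<integral>w. h (fst w) * fH w * (snd w - m) \<partial>N)"
      using condH(2)[OF m'(2) b'(2)] by (simp add: fH_def dH_def ac_simps)
    finally show ?thesis .
  qed
  \<comment> \<open>If the conditional moment vanishes over \<open>A\<close>, so does the integral
    of \<open>d\<close> there; as \<open>d\<close> is positive on \<open>I\<close>, nothing lies in
    \<open>A \<times> I\<close>.\<close>
  have vanish: "AE w in N. w \<notin> A \<times> I"
    if A: "A \<in> sets borel" and 0: "AE w in N. fst w \<in> A \<longrightarrow> g w = 0" and g: "g \<in> borel_measurable N"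
      and d: "d \<in> borel_measurable N" "AE w in N. norm (d w) \<le> B + \<bar>m\<bar>" "AE w in N. real_cond_exp N F d w = g w"
      and dI: "\<And>w. 0 \<le> d w" "\<And>w. snd w \<in> I \<Longrightarrow> 0 < d w" for A I g d
  proof -
    have k: "(\<lambda>w. indicator A (fst w)) \<in> borel_measurable F" using A by measurable
    have kN [measurable]: "(\<lambda>w. indicator A (fst w) :: real) \<in> borel_measurable N" using from_F[OF k] .
    note [measurable] = d(1)
    have b: "\<bar>indicator A (fst w)\<bar> \<le> (1::real)" for w :: "real \<times> real" by (simp add: indicator_def)
    have "(\<integral>w. indicator A (fst w) * d w \<partial>N) = (\<integral>w. indicator A (fst w) * g w \<partial>N)"
      using cond(2)[OF k b d g] by simp
    also have "\<dots> = 0" using 0 by (intro integral_eq_zero_AE) (auto elim!: eventually_mono simp: indicator_def)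
    finally have "(\<integral>w. indicator A (fst w) * d w \<partial>N) = 0" .
    moreover have "integrable N (\<lambda>w. indicator A (fst w) * d w)"
    proof (rule Bochner_Integration.integrable_bound)
      show "integrable N d" using d(2) by (intro N.integrable_const_bound[where B="B + \<bar>m\<bar>"]) simp_all
      show "(\<lambda>w. indicator A (fst w) * d w) \<in> borel_measurable N"
        by (intro borel_measurable_times kN d(1))
    qed (simp add: indicator_def)
    ultimately have "AE w in N. indicator A (fst w) * d w = 0"
      using dI by (subst (asm) integral_nonneg_eq_0_iff_AE) auto
    then show ?thesis
    proof eventually_elim
      case (elim w)
      then show ?case using dI(2)[of w] by (auto simp: indicator_def split: if_splits)
    qed
  qed
  have dL_pos: "0 < dL w" if "snd w \<in> {..<p}" for w using that m by (simp add: dL_def)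
  have dH_pos: "0 < dH w" if "snd w \<in> {q<..}" for w using that m by (simp add: dH_def)
  \<comment> \<open>If \<open>I\<close> is charged over every set of abscissae that \<open>N\<close>
    charges, the conditional moment is almost nowhere \<open>0\<close>: its zero set is a cylinder
    over some \<open>A\<close>, to which the assumption applies.\<close>
  have AE_pos: "AE w in N. g w \<noteq> 0"
    if all: "\<forall>A\<in>sets borel. (AE w in N. w \<notin> A \<times> I) \<longrightarrow> (AE w in N. fst w \<notin> A)"
      and g: "g \<in> borel_measurable F"
      and d: "d \<in> borel_measurable N" "AE w in N. norm (d w) \<le> B + \<bar>m\<bar>" "AE w in N. real_cond_exp N F d w = g w"
      and dI: "\<And>w. 0 \<le> d w" "\<And>w. snd w \<in> I \<Longrightarrow> 0 < d w" for I d and g :: "real \<times> real \<Rightarrow> real"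
  proof -
    have "g -` {0} \<inter> space F \<in> sets F" using g by (intro measurable_sets[OF g]) simp
    moreover have "space F = UNIV" by (simp add: F_def)
    ultimately have "g -` {0} \<in> {fst -` A | A. A \<in> sets borel}" unfolding F_sets by simp
    then obtain A where A: "g -` {0} = fst -` A" "A \<in> sets borel" by blast
    have "AE w in N. w \<notin> A \<times> I"
      using A(1) by (intro vanish[OF A(2) _ from_F[OF g] d dI]) auto
    then have "AE w in N. fst w \<notin> A" using all A(2) by blast
    then show ?thesis using A(1) by (auto elim!: eventually_mono)
  qed
  have I_int: "integrable N (\<lambda>w. \<alpha> w * gL w)"
    by (rule condL(1)[OF ab_meas(1), of 1]) (use ab in auto)
  \<comment> \<open>This is where \<open>eqv\<close> enters. If nothing could be balanced, then over
    almost every abscissa left of \<open>s\<close> one of the two moments would vanish. By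
    \<open>eqv\<close> a particular one of them is almost nowhere \<open>0\<close>, so the other
    vanishes throughout, contradicting \<open>pos\<close>.\<close>
  have "\<not> (AE w in N. \<alpha> w * gL w = 0)"
  proof
    assume 0: "AE w in N. \<alpha> w * gL w = 0"
    have key: "AE w in N. fst w \<in> {..<s} \<longrightarrow> gL w = 0 \<or> gH w = 0"
      using 0
    proof eventually_elim
      case (elim w)
      have "1 + gL w + gH w \<noteq> 0" using g_nonneg[of w] by linarith
      then show ?case using elim by (auto simp: \<alpha>_def)
    qed
    from eqv show False
    proof
      assume "\<forall>A\<in>sets borel. (AE w in N. w \<notin> A \<times> {..<p}) \<longrightarrow> (AE w in N. fst w \<notin> A)"
      then have "AE w in N. gL w \<noteq> 0"
        by (rule AE_pos[OF _ g_meas(1) d_meas(1) d_bd(1) gL_AE d_nonneg(1) dL_pos])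
      then have "AE w in N. fst w \<in> {..<s} \<longrightarrow> gH w = 0" using key by eventually_elim auto
      then have "AE w in N. w \<notin> {..<s} \<times> {q<..}"
        by (intro vanish[OF _ _ from_F[OF g_meas(2)] d_meas(2) d_bd(2) gH_AE d_nonneg(2) dH_pos]) auto
      then show False using pos(2) by blast
    next
      assume "\<forall>A\<in>sets borel. (AE w in N. w \<notin> A \<times> {q<..}) \<longrightarrow> (AE w in N. fst w \<notin> A)"
      then have "AE w in N. gH w \<noteq> 0"
        by (rule AE_pos[OF _ g_meas(2) d_meas(2) d_bd(2) gH_AE d_nonneg(2) dH_pos])
      then have "AE w in N. fst w \<in> {..<s} \<longrightarrow> gL w = 0" using key by eventually_elim auto
      then have "AE w in N. w \<notin> {..<s} \<times> {..<p}"
        by (intro vanish[OF _ _ from_F[OF g_meas(1)] d_meas(1) d_bd(1) gL_AE d_nonneg(1) dL_pos]) auto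
      then show False using pos(1) by blast
    qed
  qed
  then have I_pos: "0 < (\<integral>w. \<alpha> w * gL w \<partial>N)"
    using I_int ab g_nonneg by (intro integral_pos_if_nonneg) auto
  have f_pos: "0 < (\<integral>w. f w \<partial>N)"
    if f: "f \<in> borel_measurable N" "\<And>w. 0 \<le> f w" "\<And>w. f w \<le> 1" and "(\<integral>w. f w * d w \<partial>N) = (\<integral>w. \<alpha> w * gL w \<partial>N)"
    for f d :: "real \<times> real \<Rightarrow> real"
  proof (rule integral_pos_if_nonneg)
    show "integrable N f" using f by (intro N.integrable_const_bound[where B=1]) auto
    show "\<not> (AE w in N. f w = 0)"
    proof
      assume "AE w in N. f w = 0"
      then have "(\<integral>w. f w * d w \<partial>N) = 0" by (intro integral_eq_zero_AE) (auto elim!: eventually_mono)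
      then show False using that(4) I_pos by simp
    qed
  qed (use f in simp)
  have "0 < (\<integral>w. fL w \<partial>N)"
    by (rule f_pos[OF f_meas(1) f01(1,2), of "\<lambda>w. m - snd w"])
      (use condL(2)[OF ab_meas(1), of 1] ab in \<open>simp add: fL_def dL_def ac_simps\<close>)
  moreover have "0 < (\<integral>w. fH w \<partial>N)"
    by (rule f_pos[OF f_meas(2) f01(3,4), of "\<lambda>w. snd w - m"])
      (use condH(2)[OF ab_meas(2), of 1] ab in \<open>simp add: fH_def dH_def ab_eq ac_simps\<close>)
  moreover have "fL \<in> bounded_borel" "fH \<in> bounded_borel"
    using f01 f_meas by (auto intro!: bounded_borelI[of _ 1] simp: measurable_cong_sets[OF N(2) refl])
  moreover have "fL w = 0" if "w \<notin> {..<s} \<times> {..<p}" for w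
    using that by (cases w) (auto simp: fL_def \<alpha>_def indicator_def)
  moreover have "fH w = 0" if "w \<notin> {..<s} \<times> {q<..}" for w
    using that by (cases w) (auto simp: fH_def \<beta>_def indicator_def)
  ultimately show ?thesis using f01 bal by (intro that[of fL fH]) auto
qed

text \<open>Mass of weight \<open>a\<close> contributes its abscissae and mass of weight
  \<open>b\<close> its ordinates, recombined independently. The total mass is the product of the two
  integrals, so in each use below one factor is normalised to integral \<open>1\<close>.\<close>

definition product_of_margins :: "(real \<times> real) measure \<Rightarrow> (real \<times> real \<Rightarrow> real) \<Rightarrow> (real \<times> real \<Rightarrow> real) \<Rightarrow> (real \<times> real) measure" where
  "product_of_margins N a b = distr (density N (\<lambda>w. ennreal (a w))) borel fst \<Otimes>\<^sub>M distr (density N (\<lambda>w. ennreal (b w))) borel snd"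

lemma
  assumes N: "finite_measure N" "sets N = sets borel"
    and a: "a \<in> bounded_borel" "\<And>w. 0 \<le> a w" and b: "b \<in> bounded_borel" "\<And>w. 0 \<le> b w"
  shows sets_product_of_margins: "sets (product_of_margins N a b) = sets borel"
    and finite_measure_product_of_margins: "finite_measure (product_of_margins N a b)"
    and integral_product_of_margins: "\<And>h k. h \<in> bounded_borel \<Longrightarrow> k \<in> bounded_borel \<Longrightarrow>
      (\<integral>w. h (fst w) * k (snd w) \<partial>product_of_margins N a b) = (\<integral>w. a w * h (fst w) \<partial>N) * (\<integral>w. b w * k (snd w) \<partial>N)"
    and AE_product_of_margins: "\<And>S T. S \<in> sets borel \<Longrightarrow> T \<in> sets borel \<Longrightarrow>
      AE w in N. a w \<noteq> 0 \<longrightarrow> fst w \<in> S \<Longrightarrow> AE w in N. b w \<noteq> 0 \<longrightarrow> snd w \<in> T \<Longrightarrow>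
      AE w in product_of_margins N a b. fst w \<in> S \<and> snd w \<in> T"
proof -
  define L where "L = distr (density N (\<lambda>w. ennreal (a w))) borel fst"
  define R where "R = distr (density N (\<lambda>w. ennreal (b w))) borel snd"
  note [measurable_cong] = N(2)
  note [measurable] = bounded_borel_measurable[OF a(1)] bounded_borel_measurable[OF b(1)]
  have spN: "space N = UNIV" using sets_eq_imp_space_eq[OF N(2)] by simp
  have fin: "(\<integral>\<^sup>+w. ennreal (f w) \<partial>N) \<noteq> \<infinity>" if "f \<in> bounded_borel" for f
    using integrable_bounded_borel[OF N that] by (simp add: real_integrable_def)
  have L: "finite_measure L" "sets L = sets borel"
    using fin[OF a(1)] by (auto intro!: finite_measureI simp: L_def emeasure_distr emeasure_density spN)
  have R: "finite_measure R" "sets R = sets borel"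
    using fin[OF b(1)] by (auto intro!: finite_measureI simp: R_def emeasure_distr emeasure_density spN)
  interpret L: finite_measure L by fact
  interpret R: finite_measure R by fact
  interpret P: pair_sigma_finite L R ..
  note [measurable_cong] = L(2) R(2)
  have P: "product_of_margins N a b = L \<Otimes>\<^sub>M R" by (simp add: product_of_margins_def L_def R_def)
  have "sets (L \<Otimes>\<^sub>M R) = sets (borel \<Otimes>\<^sub>M borel :: (real \<times> real) measure)"
    by (rule sets_pair_measure_cong) (fact L R)+
  then show sets: "sets (product_of_margins N a b) = sets borel" unfolding P borel_prod .
  have finP: "finite_measure (L \<Otimes>\<^sub>M R)"
    by (rule finite_measure_pair_measure) (fact L R)+
  then show "finite_measure (product_of_margins N a b)" by (simp add: P)
  show "(\<integral>w. h (fst w) * k (snd w) \<partial>product_of_margins N a b) = (\<integral>w. a w * h (fst w) \<partial>N) * (\<integral>w. b w * k (snd w) \<partial>N)"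
    if hk: "h \<in> bounded_borel" "k \<in> bounded_borel" for h k
  proof -
    note [measurable] = bounded_borel_measurable[OF hk(1)] bounded_borel_measurable[OF hk(2)]
    have "(\<lambda>w :: real \<times> real. h (fst w) * k (snd w)) \<in> bounded_borel"
      using hk by (intro bounded_borel_intros)
    then have int: "integrable (L \<Otimes>\<^sub>M R) (\<lambda>w. h (fst w) * k (snd w))"
      using finP sets by (intro integrable_bounded_borel) (simp_all add: P)
    have "(\<integral>w. h (fst w) * k (snd w) \<partial>(L \<Otimes>\<^sub>M R)) = (\<integral>x. \<integral>z. h x * k z \<partial>R \<partial>L)"
      using P.integral_fst'[OF int] by simp
    also have "\<dots> = (\<integral>x. h x \<partial>L) * (\<integral>z. k z \<partial>R)" by simp
    also have "(\<integral>x. h x \<partial>L) = (\<integral>w. a w * h (fst w) \<partial>N)"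
      using a(2) by (simp add: L_def integral_distr integral_density)
    also have "(\<integral>z. k z \<partial>R) = (\<integral>w. b w * k (snd w) \<partial>N)"
      using b(2) by (simp add: R_def integral_distr integral_density)
    finally show ?thesis by (simp add: P)
  qed
  show "AE w in product_of_margins N a b. fst w \<in> S \<and> snd w \<in> T"
    if [measurable]: "S \<in> sets borel" "T \<in> sets borel"
      and ae: "AE w in N. a w \<noteq> 0 \<longrightarrow> fst w \<in> S" "AE w in N. b w \<noteq> 0 \<longrightarrow> snd w \<in> T" for S T
  proof -
    have "AE x in L. x \<in> S"
      unfolding L_def using ae(1) by (subst AE_distr_iff) (auto simp: AE_density elim!: eventually_mono)
    moreover have "AE z in R. z \<in> T"
      unfolding R_def using ae(2) by (subst AE_distr_iff) (auto simp: AE_density elim!: eventually_mono)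
    ultimately have "AE x in L. AE z in R. x \<in> S \<and> z \<in> T" by (auto elim!: eventually_mono)
    then have "AE w in L \<Otimes>\<^sub>M R. fst w \<in> S \<and> snd w \<in> T"
      by (intro P.AE_pair_measure) auto
    then show ?thesis unfolding P .
  qed
qed

text \<open>The competitor: on \<open>{x > s, p \<le> z \<le> q}\<close> a fraction of the mass is removed and replaced, with the
  same conditional mean, by mass outside \<open>[p, q]\<close>; the latter is released at abscissae left of \<open>s\<close>,
  where it is replaced by mass in \<open>[p, q]\<close>. Up to functions that do not feel the exchange, the cost
  is \<open>c(x, z) - c(s, z) - chord\<close>, whose sign is known on each of the four regions.\<close>

lemma spence_mirrlees_improvement:
  fixes N :: "(real \<times> real) measure" and c :: "real \<times> real \<Rightarrow> real"
  assumes N: "finite_measure N" "sets N = sets borel"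
    and X: "closed X" and Z: "closed Z" "\<And>z. z \<in> Z \<Longrightarrow> \<bar>z\<bar> \<le> B"
    and supp: "AE w in N. fst w \<in> X \<and> snd w \<in> Z"
    and c: "c \<in> bounded_borel" and sm: "martingale_spence_mirrlees X Z (\<lambda>x z. c (x, z))"
    and s: "s \<in> X" and pq: "p \<in> Z" "q \<in> Z" "p < q"
    and pos: "\<not> (AE w in N. w \<notin> {..<s} \<times> {..<p})" "\<not> (AE w in N. w \<notin> {..<s} \<times> {q<..})"
      "\<not> (AE w in N. w \<notin> {s<..} \<times> {p..q})"
    and eqv: "(\<forall>A\<in>sets borel. (AE w in N. w \<notin> A \<times> {..<p}) \<longrightarrow> (AE w in N. fst w \<notin> A)) \<or>
      (\<forall>A\<in>sets borel. (AE w in N. w \<notin> A \<times> {q<..}) \<longrightarrow> (AE w in N. fst w \<notin> A))"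
  obtains N' where "finite_measure N'" "sets N' = sets borel" "AE w in N'. fst w \<in> X \<and> snd w \<in> Z"
    "\<And>h. h \<in> bounded_borel \<Longrightarrow> (\<integral>w. h (fst w) \<partial>N') = (\<integral>w. h (fst w) \<partial>N)"
    "\<And>h. h \<in> bounded_borel \<Longrightarrow> (\<integral>w. h (snd w) \<partial>N') = (\<integral>w. h (snd w) \<partial>N)"
    "\<And>h. h \<in> bounded_borel \<Longrightarrow> (\<integral>w. h (fst w) * snd w \<partial>N') = (\<integral>w. h (fst w) * snd w \<partial>N)"
    "(\<integral>w. c w \<partial>N') < (\<integral>w. c w \<partial>N)"
proof -
  interpret N: finite_measure N by fact
  note [measurable_cong] = N(2)
  have spN: "space N = UNIV" using sets_eq_imp_space_eq[OF N(2)] by simp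
  note int = integrable_bounded_borel[OF N]
  \<comment> \<open>The ordinate clipped to the bound of \<open>Z\<close>: a bounded test function
    that agrees with \<open>z\<close> on the support.\<close>
  define \<zeta> where "\<zeta> z = max (- B) (min B z)" for z
  have B0: "0 \<le> B" using Z(2)[OF pq(1)] by linarith
  have \<zeta>: "\<zeta> \<in> bounded_borel" unfolding \<zeta>_def using B0 by (intro bounded_borelI[of _ B]) auto
  have \<zeta>_eq: "\<zeta> z = z" if "\<bar>z\<bar> \<le> B" for z using that by (auto simp: \<zeta>_def)
  have pqB: "\<bar>p\<bar> \<le> B" "\<bar>q\<bar> \<le> B" using Z(2) pq by auto
  have B: "AE w in N. \<bar>snd w\<bar> \<le> B" using supp by (rule eventually_mono) (use Z(2) in auto)
  define E :: "real \<times> real \<Rightarrow> real" where "E = indicator ({s<..} \<times> {p..q})"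
  have E: "E \<in> bounded_borel" "0 \<le> E w" "E w \<le> 1" for w
    unfolding E_def by (auto intro!: bounded_borel_indicator borel_Times simp: indicator_def)
  have E0: "E w = 0 \<or> s < fst w \<and> p \<le> snd w \<and> snd w \<le> q \<and> E w = 1" for w
    by (cases w) (auto simp: E_def indicator_def)
  have E_bd: "\<bar>snd w\<bar> \<le> B" if "E w \<noteq> 0" for w using E0[of w] that pqB by linarith
  define e where "e = (\<integral>w. E w \<partial>N)"
  have e: "0 < e" unfolding e_def
  proof (rule integral_pos_if_nonneg[OF int[OF E(1)]])
    show "\<not> (AE w in N. E w = 0)" using pos(3) by (simp add: E_def indicator_def cong: if_cong)
  qed (use E in auto)
  \<comment> \<open>\<open>m\<close> is the mean ordinate of the mass in \<open>E\<close>. If the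
    mass removed left of \<open>s\<close> has this same mean over almost every abscissa, putting
    ordinates of \<open>E\<close> in its place preserves the conditional mean there.\<close>
  define m where "m = (\<integral>w. E w * \<zeta> (snd w) \<partial>N) / e"
  have E\<zeta>: "(\<lambda>w. E w * \<zeta> (snd w)) \<in> bounded_borel" using E \<zeta> by (intro bounded_borel_intros)
  have E\<zeta>_eq: "E w * \<zeta> (snd w) = E w * snd w" for w
    using \<zeta>_eq[OF E_bd[of w]] by (cases "E w = 0") auto
  have m: "p \<le> m" "m \<le> q" 
  proof -
    have "(\<integral>w. p * E w \<partial>N) \<le> (\<integral>w. E w * \<zeta> (snd w) \<partial>N)"
    proof (rule integral_mono)
      show "p * E w \<le> E w * \<zeta> (snd w)" for w using E0[of w] unfolding E\<zeta>_eq by auto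
    qed (use int[OF E(1)] int[OF E\<zeta>] in auto)
    then have "p * e \<le> (\<integral>w. E w * \<zeta> (snd w) \<partial>N)" by (simp add: e_def)
    then show "p \<le> m" using e by (simp add: m_def le_divide_eq)
    have "(\<integral>w. E w * \<zeta> (snd w) \<partial>N) \<le> (\<integral>w. q * E w \<partial>N)"
    proof (rule integral_mono)
      show "E w * \<zeta> (snd w) \<le> q * E w" for w using E0[of w] unfolding E\<zeta>_eq by auto
    qed (use int[OF E(1)] int[OF E\<zeta>] in auto)
    then have "(\<integral>w. E w * \<zeta> (snd w) \<partial>N) \<le> q * e" by (simp add: e_def)
    then show "m \<le> q" using e by (simp add: m_def divide_le_eq)
  qed
  obtain \<phi>L \<phi>H :: "real \<times> real \<Rightarrow> real" where \<phi>:
    "\<phi>L \<in> bounded_borel" "\<And>w. 0 \<le> \<phi>L w" "\<And>w. \<phi>L w \<le> 1" "\<And>w. w \<notin> {..<s} \<times> {..<p} \<Longrightarrow> \<phi>L w = 0"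
    "\<phi>H \<in> bounded_borel" "\<And>w. 0 \<le> \<phi>H w" "\<And>w. \<phi>H w \<le> 1" "\<And>w. w \<notin> {..<s} \<times> {q<..} \<Longrightarrow> \<phi>H w = 0"
    "0 < (\<integral>w. \<phi>L w \<partial>N)" "0 < (\<integral>w. \<phi>H w \<partial>N)"
    "\<And>h. h \<in> bounded_borel \<Longrightarrow> (\<integral>w. h (fst w) * \<phi>L w * (m - snd w) \<partial>N) = (\<integral>w. h (fst w) * \<phi>H w * (snd w - m) \<partial>N)"
    using balanced_removal[OF N B m pos(1,2) eqv] by blast
  \<comment> \<open>Scaled so that the total removed on the left does not exceed the mass
    \<open>e\<close> available in \<open>E\<close>; this gives \<open>t \<le> 1\<close>
    below.\<close>
  define \<epsilon> where "\<epsilon> = min 1 (e / ((\<integral>w. \<phi>L w \<partial>N) + (\<integral>w. \<phi>H w \<partial>N)))"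
  have \<epsilon>: "0 < \<epsilon>" "\<epsilon> \<le> 1" "\<epsilon> * ((\<integral>w. \<phi>L w \<partial>N) + (\<integral>w. \<phi>H w \<partial>N)) \<le> e"
  proof -
    define G where "G = (\<integral>w. \<phi>L w \<partial>N) + (\<integral>w. \<phi>H w \<partial>N)"
    have "0 < G" using \<phi>(9,10) by (simp add: G_def)
    then show "0 < \<epsilon>" "\<epsilon> \<le> 1" "\<epsilon> * ((\<integral>w. \<phi>L w \<partial>N) + (\<integral>w. \<phi>H w \<partial>N)) \<le> e"
      using e unfolding \<epsilon>_def G_def[symmetric] by (auto simp: min_def field_simps)
  qed
  define fL where "fL w = \<epsilon> * \<phi>L w" for w
  define fH where "fH w = \<epsilon> * \<phi>H w" for w
  have fLb: "fL \<in> bounded_borel" and fHb: "fH \<in> bounded_borel"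
    unfolding fL_def fH_def using \<phi> by (intro bounded_borel_intros; simp)+
  have f0: "0 \<le> fL w" "fL w \<le> 1" "0 \<le> fH w" "fH w \<le> 1" for w
    using \<phi>(2,3,6,7)[of w] \<epsilon> by (auto simp: fL_def fH_def mult_le_one)
  have fL_supp: "fL w = 0 \<or> fst w < s \<and> snd w < p" for w using \<phi>(4)[of w] by (cases w) (auto simp: fL_def)
  have fH_supp: "fH w = 0 \<or> fst w < s \<and> q < snd w" for w using \<phi>(8)[of w] by (cases w) (auto simp: fH_def)
  define \<kappa>L where "\<kappa>L = (\<integral>w. fL w \<partial>N)"
  define \<kappa>H where "\<kappa>H = (\<integral>w. fH w \<partial>N)"
  define lL where "lL = (\<integral>w. fL w * \<zeta> (snd w) \<partial>N)"
  define lH where "lH = (\<integral>w. fH w * \<zeta> (snd w) \<partial>N)"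
  define F where "F = \<kappa>L + \<kappa>H"
  have \<kappa>: "0 < \<kappa>L" "0 < \<kappa>H" "F \<le> e" using \<phi>(9,10) \<epsilon> by (simp_all add: \<kappa>L_def \<kappa>H_def F_def fL_def fH_def distrib_left)
  have F: "0 < F" using \<kappa> by (simp add: F_def)
  have bal: "(\<integral>w. fL w * (h (fst w) * \<zeta> (snd w)) \<partial>N) + (\<integral>w. fH w * (h (fst w) * \<zeta> (snd w)) \<partial>N)
      = m * ((\<integral>w. fL w * h (fst w) \<partial>N) + (\<integral>w. fH w * h (fst w) \<partial>N))" if h: "h \<in> bounded_borel" for h
  proof -
    have i: "integrable N (\<lambda>w. f w * h (fst w))" "integrable N (\<lambda>w. f w * (h (fst w) * \<zeta> (snd w)))" if "f \<in> bounded_borel" for f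
      using that h \<zeta> by (intro int bounded_borel_intros; simp)+
    note [measurable] = bounded_borel_measurable[OF h] bounded_borel_measurable[OF \<phi>(1)]
      bounded_borel_measurable[OF \<phi>(5)] bounded_borel_measurable[OF \<zeta>] bounded_borel_measurable[OF fLb] bounded_borel_measurable[OF fHb]
    have "(\<integral>w. m * (fL w * h (fst w)) - fL w * (h (fst w) * \<zeta> (snd w)) \<partial>N) = (\<integral>w. \<epsilon> * (h (fst w) * \<phi>L w * (m - snd w)) \<partial>N)"
    proof (rule integral_cong_AE)
      show "AE w in N. m * (fL w * h (fst w)) - fL w * (h (fst w) * \<zeta> (snd w)) = \<epsilon> * (h (fst w) * \<phi>L w * (m - snd w))"
        by (rule eventually_mono[OF B]) (simp add: fL_def \<zeta>_eq algebra_simps)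
    qed measurable
    also have "\<dots> = (\<integral>w. \<epsilon> * (h (fst w) * \<phi>H w * (snd w - m)) \<partial>N)"
      using \<phi>(11)[OF h] by simp
    also have "\<dots> = (\<integral>w. fH w * (h (fst w) * \<zeta> (snd w)) - m * (fH w * h (fst w)) \<partial>N)"
    proof (rule integral_cong_AE)
      show "AE w in N. \<epsilon> * (h (fst w) * \<phi>H w * (snd w - m)) = fH w * (h (fst w) * \<zeta> (snd w)) - m * (fH w * h (fst w))"
        by (rule eventually_mono[OF B]) (simp add: fH_def \<zeta>_eq algebra_simps)
    qed measurable
    finally show ?thesis using i[OF fLb] i[OF fHb] by (simp add: algebra_simps)
  qed
  have lm: "lL + lH = m * F"
    using bal[of "\<lambda>_. 1"] by (simp add: lL_def lH_def F_def \<kappa>L_def \<kappa>H_def)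
  have z_lL: "0 \<le> z * \<kappa>L - lL" if "p \<le> z" for z
  proof -
    have "lL \<le> (\<integral>w. z * fL w \<partial>N)"
      unfolding lL_def
    proof (rule integral_mono_AE)
      show "AE w in N. fL w * \<zeta> (snd w) \<le> z * fL w"
        using B
      proof eventually_elim
        case (elim w)
        then show ?case using fL_supp[of w] f0(1)[of w] that
          by (cases "fL w = 0") (auto simp: \<zeta>_eq mult.commute[of z] intro!: mult_left_mono)
      qed
    qed (use fLb \<zeta> in \<open>auto intro!: int bounded_borel_intros\<close>)
    then show ?thesis by (simp add: \<kappa>L_def)
  qed
  have z_lH: "0 \<le> lH - z * \<kappa>H" if "z \<le> q" for z
  proof -
    have "(\<integral>w. z * fH w \<partial>N) \<le> lH"
      unfolding lH_def
    proof (rule integral_mono_AE)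
      show "AE w in N. z * fH w \<le> fH w * \<zeta> (snd w)"
        using B
      proof eventually_elim
        case (elim w)
        then show ?case using fH_supp[of w] f0(3)[of w] that
          by (cases "fH w = 0") (auto simp: \<zeta>_eq mult.commute[of z] intro!: mult_left_mono)
      qed
    qed (use fHb \<zeta> in \<open>auto intro!: int bounded_borel_intros\<close>)
    then show ?thesis by (simp add: \<kappa>H_def)
  qed
  \<comment> \<open>Determinant of the system for \<open>u\<close> and \<open>v\<close>. It is
    positive because the released low ordinates average at most \<open>p\<close>, the high ones at
    least \<open>q\<close>, and \<open>p < q\<close>.\<close>
  define det where "det = \<kappa>L * lH - \<kappa>H * lL"
  have det: "0 < det"
  proof -
    have "0 < \<kappa>L * \<kappa>H * (q - p)" using \<kappa> pq by simp
    also have "\<dots> \<le> \<kappa>L * \<kappa>H * (q - p) + \<kappa>L * (lH - q * \<kappa>H) + \<kappa>H * (p * \<kappa>L - lL)"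
      using z_lH[of q] z_lL[of p] \<kappa> by simp
    also have "\<dots> = det" by (simp add: det_def algebra_simps)
    finally show ?thesis .
  qed
  define t where "t = F / e"
  have t: "0 < t" "t \<le> 1" using F e \<kappa> by (simp_all add: t_def)
  \<comment> \<open>Cramer's rule: over a point of \<open>E\<close>, the amounts \<open>u\<close> of
    the low pool and \<open>v\<close> of the high pool must replace the removed
    \<open>t * E w\<close> with equal mass and equal first moment, which are \<open>uv1\<close> and
    \<open>uvz\<close>. Both are nonnegative since the ordinate lies in
    \<open>[p, q]\<close>.\<close>
  define u where "u w = t * (E w * ((lH - \<zeta> (snd w) * \<kappa>H) / det))" for w
  define v where "v w = t * (E w * ((\<zeta> (snd w) * \<kappa>L - lL) / det))" for w
  have uv_b: "u \<in> bounded_borel" "v \<in> bounded_borel"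
    unfolding u_def v_def divide_inverse using E \<zeta> by (intro bounded_borel_intros; simp)+
  have uv0: "0 \<le> u w" "0 \<le> v w" for w
    using E0[of w] z_lH[of "snd w"] z_lL[of "snd w"] \<zeta>_eq[OF E_bd[of w]] t det
    by (cases "E w = 0"; auto simp: u_def v_def)+
  have uv1: "u w * \<kappa>L + v w * \<kappa>H = t * E w" for w
  proof -
    have "u w * \<kappa>L + v w * \<kappa>H = t * E w * (((lH - \<zeta> (snd w) * \<kappa>H) * \<kappa>L + (\<zeta> (snd w) * \<kappa>L - lL) * \<kappa>H) / det)"
      by (simp add: u_def v_def algebra_simps add_divide_distrib diff_divide_distrib)
    also have "(lH - \<zeta> (snd w) * \<kappa>H) * \<kappa>L + (\<zeta> (snd w) * \<kappa>L - lL) * \<kappa>H = det" by (simp add: det_def algebra_simps)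
    finally show ?thesis using det by simp
  qed
  have uvz: "u w * lL + v w * lH = t * E w * \<zeta> (snd w)" for w
  proof -
    have "u w * lL + v w * lH = t * E w * (((lH - \<zeta> (snd w) * \<kappa>H) * lL + (\<zeta> (snd w) * \<kappa>L - lL) * lH) / det)"
      by (simp add: u_def v_def algebra_simps add_divide_distrib diff_divide_distrib)
    also have "(lH - \<zeta> (snd w) * \<kappa>H) * lL + (\<zeta> (snd w) * \<kappa>L - lL) * lH = \<zeta> (snd w) * det" by (simp add: det_def algebra_simps)
    finally show ?thesis using det by simp
  qed
  \<comment> \<open>Both pools are used up exactly, because together they have the same mean
    \<open>m\<close> as \<open>E\<close>; this is what preserves the second marginal.\<close>
  have uI: "(\<integral>w. u w \<partial>N) = 1" and vI: "(\<integral>w. v w \<partial>N) = 1"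
  proof -
    have Em: "(\<integral>w. E w * \<zeta> (snd w) \<partial>N) = m * e" using e by (simp add: m_def)
    have "(\<integral>w. u w \<partial>N) = (\<integral>w. t / det * (lH * E w - \<kappa>H * (E w * \<zeta> (snd w))) \<partial>N)"
      by (intro Bochner_Integration.integral_cong) (simp_all add: u_def algebra_simps diff_divide_distrib)
    also have "\<dots> = t / det * (lH * e - \<kappa>H * (m * e))"
      using int[OF E(1)] int[OF E\<zeta>] by (simp add: Em e_def)
    also have "\<dots> = ((t * e) * lH - \<kappa>H * (m * (t * e))) / det" by (simp add: diff_divide_distrib algebra_simps)
    also have "t * e = F" using e by (simp add: t_def)
    also have "F * lH - \<kappa>H * (m * F) = det" unfolding lm[symmetric] by (simp add: F_def det_def algebra_simps)
    finally show "(\<integral>w. u w \<partial>N) = 1" using det by simp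
    have "(\<integral>w. v w \<partial>N) = (\<integral>w. t / det * (\<kappa>L * (E w * \<zeta> (snd w)) - lL * E w) \<partial>N)"
      by (intro Bochner_Integration.integral_cong) (simp_all add: v_def algebra_simps diff_divide_distrib)
    also have "\<dots> = t / det * (\<kappa>L * (m * e) - lL * e)"
      using int[OF E(1)] int[OF E\<zeta>] by (simp add: Em e_def)
    also have "\<dots> = (\<kappa>L * (m * (t * e)) - (t * e) * lL) / det" by (simp add: diff_divide_distrib algebra_simps)
    also have "t * e = F" using e by (simp add: t_def)
    also have "\<kappa>L * (m * F) - F * lL = det" unfolding lm[symmetric] by (simp add: F_def det_def algebra_simps)
    finally show "(\<integral>w. v w \<partial>N) = 1" using det by simp
  qed
  define k where "k w = 1 - (fL w + fH w + t * E w)" for w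
  have k_b: "k \<in> bounded_borel" unfolding k_def using fLb fHb E by (intro bounded_borel_intros)
  have k0: "0 \<le> k w" for w
    using fL_supp[of w] fH_supp[of w] E0[of w] f0[of w] t pq(3) by (auto simp: k_def)
  \<comment> \<open>\<open>P0\<close> is what stays, \<open>P1\<close> puts ordinates of
    \<open>E\<close> over the vacated left abscissae, \<open>P2\<close> and \<open>P3\<close> put
    the low and the high pool over the right abscissae.\<close>
  define P0 where "P0 = density N (\<lambda>w. ennreal (k w))"
  define P1 where "P1 = product_of_margins N (\<lambda>w. fL w + fH w) (\<lambda>w. inverse e * E w)"
  define P2 where "P2 = product_of_margins N u fL"
  define P3 where "P3 = product_of_margins N v fH"
  define N' where "N' = add_measure (add_measure P0 P1) (add_measure P2 P3)"
  have fLH: "(\<lambda>w. fL w + fH w) \<in> bounded_borel" "0 \<le> fL w + fH w" for w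
    using fLb fHb f0[of w] by (auto intro!: bounded_borel_intros)
  have eE: "(\<lambda>w. inverse e * E w) \<in> bounded_borel" "0 \<le> inverse e * E w" for w
    using E e by (auto intro!: bounded_borel_intros)
  note p1 = sets_product_of_margins[OF N fLH eE] finite_measure_product_of_margins[OF N fLH eE]
    integral_product_of_margins[OF N fLH eE] AE_product_of_margins[OF N fLH eE]
  note p2 = sets_product_of_margins[OF N uv_b(1) uv0(1) fLb f0(1)] finite_measure_product_of_margins[OF N uv_b(1) uv0(1) fLb f0(1)]
    integral_product_of_margins[OF N uv_b(1) uv0(1) fLb f0(1)] AE_product_of_margins[OF N uv_b(1) uv0(1) fLb f0(1)]
  note p3 = sets_product_of_margins[OF N uv_b(2) uv0(2) fHb f0(3)] finite_measure_product_of_margins[OF N uv_b(2) uv0(2) fHb f0(3)]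
    integral_product_of_margins[OF N uv_b(2) uv0(2) fHb f0(3)] AE_product_of_margins[OF N uv_b(2) uv0(2) fHb f0(3)]
  note [measurable] = bounded_borel_measurable[OF k_b]
  have P0: "finite_measure P0" "sets P0 = sets borel"
    using int[OF k_b] by (auto intro!: finite_measureI simp: P0_def N(2) emeasure_density real_integrable_def spN)
  have P123: "finite_measure P1" "sets P1 = sets borel" "finite_measure P2" "sets P2 = sets borel"
    "finite_measure P3" "sets P3 = sets borel"
    using p1(1,2) p2(1,2) p3(1,2) by (simp_all add: P1_def P2_def P3_def)
  have N'_sets: "sets N' = sets borel" by (simp add: N'_def P0)
  have N'_fin: "finite_measure N'"
    unfolding N'_def using P0 P123 by (intro finite_measure_add_measure) auto
  have int_N': "(\<integral>w. g w \<partial>N') = (\<integral>w. g w \<partial>P0) + (\<integral>w. g w \<partial>P1) + ((\<integral>w. g w \<partial>P2) + (\<integral>w. g w \<partial>P3))"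
    if "g \<in> bounded_borel" for g
  proof -
    have "integrable P0 g" "integrable P1 g" "integrable P2 g" "integrable P3 g"
      using P0 P123 that by (auto intro: integrable_bounded_borel)
    then show ?thesis
      unfolding N'_def using P0 P123
      by (simp add: integral_add_measure integrable_add_measure)
  qed
  have int_P0: "(\<integral>w. g w \<partial>P0) = (\<integral>w. k w * g w \<partial>N)" if "g \<in> bounded_borel" for g
    unfolding P0_def using k0 bounded_borel_measurable[OF that] by (subst integral_density) auto
  \<comment> \<open>Computed once for products of a function of \<open>x\<close> and a function of
    \<open>z\<close>: \<open>r = 1\<close>, \<open>h = 1\<close> and \<open>r = \<zeta>\<close> give
    the first marginal, the second marginal and the conditional mean.\<close>
  have formula: "(\<integral>w. h (fst w) * r (snd w) \<partial>N') = (\<integral>w. h (fst w) * r (snd w) \<partial>N)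
      - ((\<integral>w. fL w * (h (fst w) * r (snd w)) \<partial>N) + (\<integral>w. fH w * (h (fst w) * r (snd w)) \<partial>N)
        + t * (\<integral>w. E w * (h (fst w) * r (snd w)) \<partial>N))
      + ((\<integral>w. fL w * h (fst w) \<partial>N) + (\<integral>w. fH w * h (fst w) \<partial>N)) * (inverse e * (\<integral>w. E w * r (snd w) \<partial>N))
      + ((\<integral>w. u w * h (fst w) \<partial>N) * (\<integral>w. fL w * r (snd w) \<partial>N) + (\<integral>w. v w * h (fst w) \<partial>N) * (\<integral>w. fH w * r (snd w) \<partial>N))"
    if hr: "h \<in> bounded_borel" "r \<in> bounded_borel" for h r
  proof -
    have g: "(\<lambda>w :: real \<times> real. h (fst w) * r (snd w)) \<in> bounded_borel" using hr by (intro bounded_borel_intros)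
    have ig: "integrable N (\<lambda>w. f w * (h (fst w) * r (snd w)))" if "f \<in> bounded_borel" for f
      using that hr by (intro int bounded_borel_intros)
    have ih: "integrable N (\<lambda>w. f w * h (fst w))" if "f \<in> bounded_borel" for f
      using that hr by (intro int bounded_borel_intros)
    have "(\<integral>w. k w * (h (fst w) * r (snd w)) \<partial>N) = (\<integral>w. h (fst w) * r (snd w) -
        (fL w * (h (fst w) * r (snd w)) + fH w * (h (fst w) * r (snd w)) + t * (E w * (h (fst w) * r (snd w)))) \<partial>N)"
      by (intro Bochner_Integration.integral_cong) (simp_all add: k_def algebra_simps)
    also have "\<dots> = (\<integral>w. h (fst w) * r (snd w) \<partial>N) - ((\<integral>w. fL w * (h (fst w) * r (snd w)) \<partial>N) + (\<integral>w. fH w * (h (fst w) * r (snd w)) \<partial>N)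
        + t * (\<integral>w. E w * (h (fst w) * r (snd w)) \<partial>N))"
      using int[OF g] ig[OF fLb] ig[OF fHb] ig[OF E(1)] by simp
    finally have "(\<integral>w. h (fst w) * r (snd w) \<partial>P0) = \<dots>" by (simp add: int_P0[OF g])
    moreover have "(\<integral>w. h (fst w) * r (snd w) \<partial>P1) =
        ((\<integral>w. fL w * h (fst w) \<partial>N) + (\<integral>w. fH w * h (fst w) \<partial>N)) * (inverse e * (\<integral>w. E w * r (snd w) \<partial>N))"
      unfolding P1_def p1(3)[OF hr] using ih[OF fLb] ih[OF fHb] by (simp add: distrib_right mult.assoc)
    ultimately show ?thesis
      unfolding int_N'[OF g] by (simp add: P2_def P3_def p2(3)[OF hr] p3(3)[OF hr])
  qed
  have x_marg: "(\<integral>w. h (fst w) \<partial>N') = (\<integral>w. h (fst w) \<partial>N)" if h: "h \<in> bounded_borel" for h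
  proof -
    have ih: "integrable N (\<lambda>w. f w * h (fst w))" if "f \<in> bounded_borel" for f
      using that h by (intro int bounded_borel_intros)
    have "(\<integral>w. u w * h (fst w) \<partial>N) * \<kappa>L + (\<integral>w. v w * h (fst w) \<partial>N) * \<kappa>H = (\<integral>w. (u w * \<kappa>L + v w * \<kappa>H) * h (fst w) \<partial>N)"
      using ih[OF uv_b(1)] ih[OF uv_b(2)] by (simp add: distrib_right mult.assoc mult.commute[of _ \<kappa>L] mult.commute[of _ \<kappa>H])
    also have "\<dots> = t * (\<integral>w. E w * h (fst w) \<partial>N)" by (simp add: uv1 mult.assoc)
    finally have "(\<integral>w. u w * h (fst w) \<partial>N) * \<kappa>L + (\<integral>w. v w * h (fst w) \<partial>N) * \<kappa>H = t * (\<integral>w. E w * h (fst w) \<partial>N)" .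
    then show ?thesis
      using formula[OF h bounded_borel_const[of 1]] e by (simp add: \<kappa>L_def \<kappa>H_def e_def)
  qed
  have z_marg: "(\<integral>w. h (snd w) \<partial>N') = (\<integral>w. h (snd w) \<partial>N)" if h: "h \<in> bounded_borel" for h
  proof -
    have "F * (inverse e * (\<integral>w. E w * h (snd w) \<partial>N)) = t * (\<integral>w. E w * h (snd w) \<partial>N)"
      by (simp add: t_def divide_inverse)
    then show ?thesis
      using formula[OF bounded_borel_const[of 1] h] uI vI by (simp add: F_def \<kappa>L_def \<kappa>H_def)
  qed
  have xz: "(\<integral>w. h (fst w) * \<zeta> (snd w) \<partial>N') = (\<integral>w. h (fst w) * \<zeta> (snd w) \<partial>N)" if h: "h \<in> bounded_borel" for h
  proof -
    have ih: "integrable N (\<lambda>w. f w * h (fst w))" if "f \<in> bounded_borel" for f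
      using that h by (intro int bounded_borel_intros)
    have "(\<integral>w. u w * h (fst w) \<partial>N) * lL + (\<integral>w. v w * h (fst w) \<partial>N) * lH = (\<integral>w. (u w * lL + v w * lH) * h (fst w) \<partial>N)"
      using ih[OF uv_b(1)] ih[OF uv_b(2)] by (simp add: distrib_right mult.assoc mult.commute[of _ lL] mult.commute[of _ lH])
    also have "\<dots> = t * (\<integral>w. E w * (h (fst w) * \<zeta> (snd w)) \<partial>N)" unfolding uvz by (simp add: ac_simps)
    finally have 1: "(\<integral>w. u w * h (fst w) \<partial>N) * lL + (\<integral>w. v w * h (fst w) \<partial>N) * lH = t * (\<integral>w. E w * (h (fst w) * \<zeta> (snd w)) \<partial>N)" .
    have 2: "inverse e * (\<integral>w. E w * \<zeta> (snd w) \<partial>N) = m" by (simp add: m_def divide_inverse)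
    show ?thesis
      using formula[OF h \<zeta>] bal[OF h] 1 unfolding 2 lL_def[symmetric] lH_def[symmetric] by (simp add: mult.commute)
  qed
  have XZ: "X \<in> sets borel" "Z \<in> sets borel" using X Z by auto
  have IX: "X \<inter> {..<s} \<in> sets borel" "X \<inter> {s<..} \<in> sets borel" "Z \<inter> {p..q} \<in> sets borel" "Z \<inter> - {p..q} \<in> sets borel" 
    using XZ by auto
  have fLH_supp: "fst w < s" if "fL w + fH w \<noteq> 0" for w using fL_supp[of w] fH_supp[of w] that by auto
  have A1: "AE w in P1. fst w \<in> X \<inter> {..<s} \<and> snd w \<in> Z \<inter> {p..q}"
    unfolding P1_def
  proof (rule p1(4)[OF IX(1,3)])
    show "AE w in N. fL w + fH w \<noteq> 0 \<longrightarrow> fst w \<in> X \<inter> {..<s}"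
      using supp by (rule eventually_mono) (use fLH_supp in auto)
    show "AE w in N. inverse e * E w \<noteq> 0 \<longrightarrow> snd w \<in> Z \<inter> {p..q}"
      using supp by (rule eventually_mono) (use E0 in fastforce)
  qed
  have uv_supp: "u w \<noteq> 0 \<Longrightarrow> s < fst w" "v w \<noteq> 0 \<Longrightarrow> s < fst w" for w using E0[of w] by (auto simp: u_def v_def)
  have A2: "AE w in P2. fst w \<in> X \<inter> {s<..} \<and> snd w \<in> Z \<inter> - {p..q}"
    unfolding P2_def
  proof (rule p2(4)[OF IX(2,4)])
    show "AE w in N. u w \<noteq> 0 \<longrightarrow> fst w \<in> X \<inter> {s<..}"
      using supp by (rule eventually_mono) (use uv_supp in auto)
    show "AE w in N. fL w \<noteq> 0 \<longrightarrow> snd w \<in> Z \<inter> - {p..q}"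
      using supp by (rule eventually_mono) (use fL_supp in fastforce)
  qed
  have A3: "AE w in P3. fst w \<in> X \<inter> {s<..} \<and> snd w \<in> Z \<inter> - {p..q}"
    unfolding P3_def
  proof (rule p3(4)[OF IX(2,4)])
    show "AE w in N. v w \<noteq> 0 \<longrightarrow> fst w \<in> X \<inter> {s<..}"
      using supp by (rule eventually_mono) (use uv_supp in auto)
    show "AE w in N. fH w \<noteq> 0 \<longrightarrow> snd w \<in> Z \<inter> - {p..q}"
      using supp by (rule eventually_mono) (use fH_supp in fastforce)
  qed
  have A0: "AE w in P0. fst w \<in> X \<and> snd w \<in> Z"
    unfolding P0_def by (subst AE_density) (simp, rule eventually_mono[OF supp], simp)
  have supp': "AE w in N'. fst w \<in> X \<and> snd w \<in> Z"
  proof -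
    have "AE w in P1. fst w \<in> X \<and> snd w \<in> Z" by (rule eventually_mono[OF A1]) auto
    moreover have "AE w in P2. fst w \<in> X \<and> snd w \<in> Z" by (rule eventually_mono[OF A2]) auto
    moreover have "AE w in P3. fst w \<in> X \<and> snd w \<in> Z" by (rule eventually_mono[OF A3]) auto
    ultimately show ?thesis unfolding N'_def using A0 P0 P123 by (simp add: AE_add_measure_iff)
  qed
  have xz': "(\<integral>w. h (fst w) * snd w \<partial>N') = (\<integral>w. h (fst w) * snd w \<partial>N)" if h: "h \<in> bounded_borel" for h
  proof -
    note [measurable] = bounded_borel_measurable[OF h] bounded_borel_measurable[OF \<zeta>]
    have "(\<integral>w. h (fst w) * snd w \<partial>L) = (\<integral>w. h (fst w) * \<zeta> (snd w) \<partial>L)"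
      if L: "sets L = sets borel" "AE w in L. fst w \<in> X \<and> snd w \<in> Z" for L
    proof (rule integral_cong_AE)
      show "AE w in L. h (fst w) * snd w = h (fst w) * \<zeta> (snd w)"
        using L(2) by (rule eventually_mono) (simp add: \<zeta>_eq Z(2))
    qed (simp_all add: measurable_cong_sets[OF L(1) refl])
    from this[OF N(2) supp] this[OF N'_sets supp'] xz[OF h] show ?thesis by simp
  qed
  define D where "D x z = c (x, z) - c (s, z)" for x z
  define b where "b x = (D x q - D x p) / (q - p)" for x
  define d where "d x = D x p - b x * p" for x
  \<comment> \<open>The subtracted terms are a function of \<open>z\<close>, a function of
    \<open>x\<close>, and a function of \<open>x\<close> times the ordinate: the three kinds of
    integrals that the exchange preserves.\<close>
  define C where "C w = c w - (c (s, snd w) + d (fst w) + b (fst w) * \<zeta> (snd w))" for w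
  have bd: "b \<in> bounded_borel" "d \<in> bounded_borel" "(\<lambda>z. c (s, z)) \<in> bounded_borel"
  proof -
    have *: "(\<lambda>x. D x z) \<in> bounded_borel" for z
      unfolding D_def by (intro bounded_borel_diff bounded_borel_const bounded_borel_pair[OF c]) auto
    then show "b \<in> bounded_borel" unfolding b_def divide_inverse by (intro bounded_borel_mult bounded_borel_diff bounded_borel_const)
    with * show "d \<in> bounded_borel" unfolding d_def by (intro bounded_borel_mult bounded_borel_diff bounded_borel_const)
    show "(\<lambda>z. c (s, z)) \<in> bounded_borel" by (intro bounded_borel_pair[OF c]) auto
  qed
  have C_b: "C \<in> bounded_borel"
    unfolding C_def using c bounded_borel_snd[OF bd(3)] bounded_borel_fst[OF bd(2)] bounded_borel_fst[OF bd(1)] bounded_borel_snd[OF \<zeta>]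
    by (intro bounded_borel_diff bounded_borel_add bounded_borel_mult)
  have C_split: "(\<integral>w. c w \<partial>L) = (\<integral>w. C w \<partial>L) + ((\<integral>w. c (s, snd w) \<partial>L) + (\<integral>w. d (fst w) \<partial>L) + (\<integral>w. b (fst w) * \<zeta> (snd w) \<partial>L))"
    if L: "finite_measure L" "sets L = sets borel" for L
  proof -
    note i = integrable_bounded_borel[OF L]
    have "(\<integral>w. c w \<partial>L) = (\<integral>w. C w + (c (s, snd w) + d (fst w) + b (fst w) * \<zeta> (snd w)) \<partial>L)"
      by (simp add: C_def)
    also have "\<dots> = (\<integral>w. C w \<partial>L) + ((\<integral>w. c (s, snd w) \<partial>L) + (\<integral>w. d (fst w) \<partial>L) + (\<integral>w. b (fst w) * \<zeta> (snd w) \<partial>L))"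
      using i[OF C_b] i[OF bounded_borel_snd[OF bd(3)]] i[OF bounded_borel_fst[OF bd(2)]]
        i[OF bounded_borel_mult[OF bounded_borel_fst[OF bd(1)] bounded_borel_snd[OF \<zeta>]]]
      by simp
    finally show ?thesis .
  qed
  have C_Z: "C (x, z) = D x z - (D x p + (D x q - D x p) / (q - p) * (z - p))" if "z \<in> Z" for x z
    using \<zeta>_eq[OF Z(2)[OF that]] unfolding b_def[symmetric] by (simp add: C_def D_def d_def algebra_simps)
  have C_right: "(z < p \<or> q < z \<longrightarrow> C (x, z) < 0) \<and> (p \<le> z \<and> z \<le> q \<longrightarrow> 0 \<le> C (x, z))"
    if x: "x \<in> X" "s < x" and z: "z \<in> Z" for x z
  proof -
    have "strictly_concave_on Z (D x)"
      using sm s x unfolding martingale_spence_mirrlees_def D_def by simp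
    from strictly_concave_on_chord[OF this pq z] show ?thesis unfolding C_Z[OF z] by auto
  qed
  \<comment> \<open>To the left of \<open>s\<close> the roles in the Spence-Mirrlees condition are
    swapped: the negative of \<open>D x\<close> is strictly concave and all signs flip.\<close>
  have C_left: "(z < p \<or> q < z \<longrightarrow> 0 < C (x, z)) \<and> (p \<le> z \<and> z \<le> q \<longrightarrow> C (x, z) \<le> 0)"
    if x: "x \<in> X" "x < s" and z: "z \<in> Z" for x z
  proof -
    have "strictly_concave_on Z (\<lambda>z. - D x z)"
      using sm s x unfolding martingale_spence_mirrlees_def D_def by simp
    from strictly_concave_on_chord[OF this pq z]
    have "(z < p \<or> q < z \<longrightarrow> - D x z < - D x p + (- D x q - - D x p) / (q - p) * (z - p)) \<and>
      (p \<le> z \<and> z \<le> q \<longrightarrow> - D x p + (- D x q - - D x p) / (q - p) * (z - p) \<le> - D x z)" by blast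
    moreover have "- D x p + (- D x q - - D x p) / (q - p) * (z - p) = - (D x p + (D x q - D x p) / (q - p) * (z - p))"
      by (simp add: minus_divide_left algebra_simps)
    ultimately show ?thesis unfolding C_Z[OF z] by auto
  qed
  have nonpos: "(\<integral>w. C w \<partial>L) \<le> 0" if "AE w in L. C w \<le> 0" for L
    using integral_nonneg_AE[where M=L and f="\<lambda>w. - C w"] that by simp
  have "(\<integral>w. C w \<partial>P1) \<le> 0"
    by (rule nonpos, rule eventually_mono[OF A1]) (use C_left in fastforce)
  moreover have "(\<integral>w. C w \<partial>P2) \<le> 0"
    by (rule nonpos, rule eventually_mono[OF A2]) (use C_right in fastforce)
  moreover have "(\<integral>w. C w \<partial>P3) \<le> 0"
    by (rule nonpos, rule eventually_mono[OF A3]) (use C_right in fastforce)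
  moreover have "(\<integral>w. k w * C w \<partial>N) < (\<integral>w. C w \<partial>N)"
  proof -
    \<comment> \<open>\<open>r\<close> is the removed weight. There \<open>C\<close> is nonnegative,
      and strictly positive where low mass is taken from the left; that mass has a positive total,
      which makes the improvement strict.\<close>
    define r where "r w = fL w + fH w + t * E w" for w
    have r: "r \<in> bounded_borel" unfolding r_def using fLb fHb E by (intro bounded_borel_intros)
    have ir: "integrable N (\<lambda>w. r w * C w)" using r C_b by (intro int bounded_borel_mult)
    have rC: "AE w in N. 0 \<le> r w * C w \<and> (r w * C w = 0 \<longrightarrow> fL w = 0)"
      using supp
    proof eventually_elim
      case (elim w)
      obtain x z where w: "w = (x, z)" by (cases w)
      consider (left) "x < s" "z < p \<or> q < z" "E w = 0"
        | (right) "s < x" "p \<le> z" "z \<le> q" "fL w = 0" "fH w = 0" | (none) "r w = 0" "fL w = 0"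
        using fL_supp[of w] fH_supp[of w] E0[of w] by (fastforce simp: w r_def)
      then show ?case
      proof cases
        case *: left
        then have "0 < C w" using C_left[of x z] elim by (simp add: w)
        then show ?thesis using f0[of w] * by (auto simp: r_def add_nonneg_eq_0_iff)
      next
        case *: right
        then have "0 \<le> C w" using C_right[of x z] elim by (simp add: w)
        then show ?thesis using * t E(2)[of w] by (simp add: r_def)
      qed auto
    qed
    have "0 < (\<integral>w. r w * C w \<partial>N)"
    proof (rule integral_pos_if_nonneg[OF ir])
      show "AE w in N. 0 \<le> r w * C w" using rC by eventually_elim simp
      show "\<not> (AE w in N. r w * C w = 0)"
      proof
        assume "AE w in N. r w * C w = 0"
        with rC have "AE w in N. fL w = 0" by eventually_elim simp
        then have "\<kappa>L = 0" unfolding \<kappa>L_def by (intro integral_eq_zero_AE) 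
        then show False using \<kappa> by simp
      qed
    qed
    moreover have "(\<integral>w. k w * C w \<partial>N) = (\<integral>w. C w - r w * C w \<partial>N)"
      by (intro Bochner_Integration.integral_cong) (simp_all add: k_def r_def algebra_simps)
    moreover have "\<dots> = (\<integral>w. C w \<partial>N) - (\<integral>w. r w * C w \<partial>N)" using ir int[OF C_b] by simp
    ultimately show ?thesis by simp
  qed
  ultimately have "(\<integral>w. C w \<partial>N') < (\<integral>w. C w \<partial>N)"
    unfolding int_N'[OF C_b] int_P0[OF C_b] by linarith
  then have "(\<integral>w. c w \<partial>N') < (\<integral>w. c w \<partial>N)"
    unfolding C_split[OF N] C_split[OF N'_fin N'_sets]
    using x_marg[OF bd(2)] z_marg[OF bd(3)] xz[OF bd(1)] by simp
  with N'_fin N'_sets supp' x_marg z_marg xz' that show ?thesis by blast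
qed

subsection \<open>Optimal pairs of slices\<close>

text \<open>The law of \<open>(x, z)\<close> on the event that the middle coordinate equals \<open>y\<close>; \<open>p x\<close> is the conditional
  probability of that event given \<open>x\<close>.\<close>

definition slice :: "real set \<Rightarrow> real set \<Rightarrow> real measure \<Rightarrow> (real \<Rightarrow> real) \<Rightarrow> real \<Rightarrow> (real \<times> real) measure \<Rightarrow> bool" where
  "slice X Z \<mu> p y N \<longleftrightarrow> finite_measure N \<and> sets N = sets borel \<and> (AE w in N. fst w \<in> X \<and> snd w \<in> Z) \<and>
    (\<forall>h\<in>bounded_borel. (\<integral>w. h (fst w) \<partial>N) = (\<integral>x. h x * p x \<partial>\<mu>)) \<and>
    (\<forall>h\<in>bounded_borel. (\<integral>w. h (fst w) * (snd w - y) \<partial>N) = 0)"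

lemma sliceD:
  assumes "slice X Z \<mu> p y N"
  shows "finite_measure N" "sets N = sets borel" "AE w in N. fst w \<in> X \<and> snd w \<in> Z"
    "\<And>h. h \<in> bounded_borel \<Longrightarrow> (\<integral>w. h (fst w) \<partial>N) = (\<integral>x. h x * p x \<partial>\<mu>)"
    "\<And>h. h \<in> bounded_borel \<Longrightarrow> (\<integral>w. h (fst w) * (snd w - y) \<partial>N) = 0"
  using assms by (auto simp: slice_def)

lemma slice_integrable:
  assumes N: "slice X Z \<mu> p y N" and Z: "\<And>z. z \<in> Z \<Longrightarrow> \<bar>z\<bar> \<le> B" and h: "h \<in> bounded_borel"
  shows "integrable N (\<lambda>w. h (fst w) * (snd w - r))"
proof -
  note N = sliceD[OF N]
  note [measurable] = bounded_borel_measurable[OF h]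
  obtain C where C: "0 \<le> C" "\<And>x. \<bar>h x\<bar> \<le> C" using bounded_borel_bound[OF h] by blast
  show ?thesis
  proof (rule finite_measure.integrable_const_bound[OF N(1), where B="C * (B + \<bar>r\<bar>)"])
    show "AE w in N. norm (h (fst w) * (snd w - r)) \<le> C * (B + \<bar>r\<bar>)"
      using N(3)
    proof (rule eventually_mono)
      fix w assume "fst w \<in> X \<and> snd w \<in> Z"
      then have "\<bar>snd w - r\<bar> \<le> B + \<bar>r\<bar>" using Z[of "snd w"] by linarith
      then show "norm (h (fst w) * (snd w - r)) \<le> C * (B + \<bar>r\<bar>)"
        using C by (auto simp: abs_mult intro!: mult_mono)
    qed
  qed (simp add: measurable_cong_sets[OF N(2) refl])
qed

lemma slice_first_moment:
  assumes N: "slice X Z \<mu> p y N" and Z: "\<And>z. z \<in> Z \<Longrightarrow> \<bar>z\<bar> \<le> B" and h: "h \<in> bounded_borel"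
  shows "(\<integral>w. h (fst w) * snd w \<partial>N) = y * (\<integral>w. h (fst w) \<partial>N)"
proof -
  have "(\<integral>w. h (fst w) * (snd w - 0) \<partial>N) - (\<integral>w. y * h (fst w) \<partial>N) = (\<integral>w. h (fst w) * (snd w - 0) - y * h (fst w) \<partial>N)"
    using slice_integrable[OF N Z h, of 0] integrable_bounded_borel[OF sliceD(1,2)[OF N] bounded_borel_fst[OF h]]
    by (intro Bochner_Integration.integral_diff[symmetric]) auto
  also have "\<dots> = (\<integral>w. h (fst w) * (snd w - y) \<partial>N)" by (simp add: algebra_simps)
  also have "\<dots> = 0" by (rule sliceD(5)[OF N h])
  finally show ?thesis by simp
qed

text \<open>If over \<open>A\<close> all mass lay at or below \<open>q < y\<close>, the integral of
  \<open>z - y\<close> over \<open>A\<close> would be negative unless \<open>A\<close> is null,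
  against the mean condition. Such one-sided charging supplies the hypothesis \<open>eqv\<close> of
  the exchange.\<close>

lemma slice_charges_above:
  assumes N: "slice X Z \<mu> p y N" and Z: "\<And>z. z \<in> Z \<Longrightarrow> \<bar>z\<bar> \<le> B" and q: "q < y"
    and A: "A \<in> sets borel" and null: "AE w in N. w \<notin> A \<times> {q<..}"
  shows "AE w in N. fst w \<notin> A"
proof -
  define g where "g w = indicator A (fst w) * (snd w - y)" for w
  have i: "integrable N g" unfolding g_def by (rule slice_integrable[OF N Z bounded_borel_indicator[OF A]])
  have neg: "AE w in N. g w \<le> 0 \<and> (g w = 0 \<longrightarrow> fst w \<notin> A)"
    using null by (rule eventually_mono) (use q in \<open>auto simp: g_def indicator_def mem_Times_iff\<close>)
  have "(\<integral>w. g w \<partial>N) = 0" unfolding g_def by (rule sliceD(5)[OF N bounded_borel_indicator[OF A]])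
  then have "(\<integral>w. - g w \<partial>N) = 0" by simp
  moreover have "AE w in N. 0 \<le> - g w" using neg by (rule eventually_mono) simp
  ultimately have "AE w in N. - g w = 0" using integral_nonneg_eq_0_iff_AE[of N "\<lambda>w. - g w"] i by simp
  with neg show ?thesis by eventually_elim simp
qed

lemma slice_charges_below:
  assumes N: "slice X Z \<mu> p y N" and Z: "\<And>z. z \<in> Z \<Longrightarrow> \<bar>z\<bar> \<le> B" and q: "y < q"
    and A: "A \<in> sets borel" and null: "AE w in N. w \<notin> A \<times> {..<q}"
  shows "AE w in N. fst w \<notin> A"
proof -
  define g where "g w = indicator A (fst w) * (snd w - y)" for w
  have i: "integrable N g" unfolding g_def by (rule slice_integrable[OF N Z bounded_borel_indicator[OF A]])
  have pos: "AE w in N. 0 \<le> g w \<and> (g w = 0 \<longrightarrow> fst w \<notin> A)"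
    using null by (rule eventually_mono) (use q in \<open>auto simp: g_def indicator_def mem_Times_iff\<close>)
  have "(\<integral>w. g w \<partial>N) = 0" unfolding g_def by (rule sliceD(5)[OF N bounded_borel_indicator[OF A]])
  moreover have "AE w in N. 0 \<le> g w" using pos by (rule eventually_mono) simp
  ultimately have "AE w in N. g w = 0" using integral_nonneg_eq_0_iff_AE[of N g] i by simp
  with pos show ?thesis by eventually_elim simp
qed

text \<open>Competitors share the second marginal as well, so that one of them can replace a slice
  of an optimal pair while the other slice is kept.\<close>

definition minimal_slice :: "real set \<Rightarrow> real set \<Rightarrow> real measure \<Rightarrow> (real \<Rightarrow> real) \<Rightarrow> real \<Rightarrow> (real \<times> real \<Rightarrow> real) \<Rightarrow> (real \<times> real) measure \<Rightarrow> bool" where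
  "minimal_slice X Z \<mu> p y c N \<longleftrightarrow> slice X Z \<mu> p y N \<and>
    (\<forall>N'. slice X Z \<mu> p y N' \<longrightarrow> (\<forall>h\<in>bounded_borel. (\<integral>w. h (snd w) \<partial>N') = (\<integral>w. h (snd w) \<partial>N)) \<longrightarrow>
      (\<integral>w. c w \<partial>N) \<le> (\<integral>w. c w \<partial>N'))"

text \<open>The three alternatives are the ways in which the exchange can fail to apply; otherwise
  it would lower the cost at fixed marginals and conditional means. The side of
  \<open>[a, b]\<close> on which \<open>y\<close> lies is charged over every set of abscissae of
  positive mass.\<close>

lemma minimal_slice_dichotomy:
  assumes N: "minimal_slice X Z \<mu> p y c N" and X: "closed X" and Z: "closed Z" "\<And>z. z \<in> Z \<Longrightarrow> \<bar>z\<bar> \<le> B"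
    and c: "c \<in> bounded_borel" and sm: "martingale_spence_mirrlees X Z (\<lambda>x z. c (x, z))"
    and atomless: "\<And>s. AE w in N. fst w \<noteq> s"
    and ab: "a \<in> Z" "b \<in> Z" "a < b" and y: "b < y \<or> y < a"
  shows "(AE w in N. \<not> (fst w < s \<and> snd w < a)) \<or> (AE w in N. \<not> (fst w < s \<and> b < snd w)) \<or>
    (AE w in N. \<not> (s < fst w \<and> a \<le> snd w \<and> snd w \<le> b))"
proof (cases "X \<inter> {..s} = {}")
  case True
  have sl: "slice X Z \<mu> p y N" using N by (simp add: minimal_slice_def)
  have "AE w in N. \<not> (fst w < s \<and> snd w < a)"
    using sliceD(3)[OF sl] by (rule eventually_mono) (use True in force)
  then show ?thesis by blast
next
  case False
  have sl: "slice X Z \<mu> p y N" using N by (simp add: minimal_slice_def)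
  \<comment> \<open>The Spence-Mirrlees condition compares points of \<open>X\<close>, so an
    arbitrary threshold \<open>s\<close> is replaced by the last point \<open>r\<close> of
    \<open>X\<close> up to \<open>s\<close>. The vertical line at \<open>r\<close> carries no
    mass.\<close>
  define r where "r = Sup (X \<inter> {..s})"
  have "closed (X \<inter> {..s})" using X by auto
  moreover have bdd: "bdd_above (X \<inter> {..s})" by auto
  ultimately have r: "r \<in> X" "r \<le> s" using closed_contains_Sup[of "X \<inter> {..s}"] False by (auto simp: r_def)
  have r_max: "x \<le> r" if "x \<in> X" "x < s" for x using that bdd unfolding r_def by (intro cSup_upper) auto
  have left: "AE w in N. \<not> (fst w < s \<and> snd w \<in> I)" if null: "AE w in N. w \<notin> {..<r} \<times> I" for I
    using sliceD(3)[OF sl] null atomless[of r]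
  proof eventually_elim
    case (elim w)
    show ?case
    proof
      assume *: "fst w < s \<and> snd w \<in> I"
      then have "fst w < r" using r_max[of "fst w"] elim by auto
      then show False using elim(2) * by (auto simp: mem_Times_iff)
    qed
  qed
  show ?thesis
  proof (rule ccontr)
    assume neg: "\<not> ?thesis"
    have "\<not> (AE w in N. w \<notin> {..<r} \<times> {..<a})" using left[of "{..<a}"] neg by auto
    moreover have "\<not> (AE w in N. w \<notin> {..<r} \<times> {b<..})" using left[of "{b<..}"] neg by auto
    moreover have "\<not> (AE w in N. w \<notin> {r<..} \<times> {a..b})"
    proof
      assume "AE w in N. w \<notin> {r<..} \<times> {a..b}"
      then have "AE w in N. \<not> (s < fst w \<and> a \<le> snd w \<and> snd w \<le> b)"
        by (rule eventually_mono) (use r in \<open>auto simp: mem_Times_iff\<close>)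
      then show False using neg by blast
    qed
    \<comment> \<open>For \<open>b < y\<close> it is the upper side that is always charged, for
      \<open>y < a\<close> the lower one.\<close>
    moreover have "(\<forall>A\<in>sets borel. (AE w in N. w \<notin> A \<times> {..<a}) \<longrightarrow> (AE w in N. fst w \<notin> A)) \<or>
      (\<forall>A\<in>sets borel. (AE w in N. w \<notin> A \<times> {b<..}) \<longrightarrow> (AE w in N. fst w \<notin> A))"
      using y slice_charges_above[OF sl Z(2)] slice_charges_below[OF sl Z(2)] by blast
    ultimately obtain N' where N': "finite_measure N'" "sets N' = sets borel" "AE w in N'. fst w \<in> X \<and> snd w \<in> Z"
      "\<And>h. h \<in> bounded_borel \<Longrightarrow> (\<integral>w. h (fst w) \<partial>N') = (\<integral>w. h (fst w) \<partial>N)"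
      "\<And>h. h \<in> bounded_borel \<Longrightarrow> (\<integral>w. h (snd w) \<partial>N') = (\<integral>w. h (snd w) \<partial>N)"
      "\<And>h. h \<in> bounded_borel \<Longrightarrow> (\<integral>w. h (fst w) * snd w \<partial>N') = (\<integral>w. h (fst w) * snd w \<partial>N)"
      "(\<integral>w. c w \<partial>N') < (\<integral>w. c w \<partial>N)"
      using spence_mirrlees_improvement[OF sliceD(1,2)[OF sl] X Z sliceD(3)[OF sl] c sm r(1) ab] by blast
    have "slice X Z \<mu> p y N'"
      unfolding slice_def
    proof (intro conjI ballI N'(1-3))
      fix h :: "real \<Rightarrow> real" assume h: "h \<in> bounded_borel"
      show "(\<integral>w. h (fst w) \<partial>N') = (\<integral>x. h x * p x \<partial>\<mu>)" using N'(4)[OF h] sliceD(4)[OF sl h] by simp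
      note [measurable] = bounded_borel_measurable[OF h]
      obtain C where C: "0 \<le> C" "\<And>x. \<bar>h x\<bar> \<le> C" using bounded_borel_bound[OF h] by blast
      have i: "integrable N' (\<lambda>w. h (fst w) * snd w)"
      proof (rule finite_measure.integrable_const_bound[OF N'(1), where B="C * B"])
        show "AE w in N'. norm (h (fst w) * snd w) \<le> C * B"
          using N'(3) by (rule eventually_mono) (use C Z(2) in \<open>auto simp: abs_mult intro!: mult_mono\<close>)
      qed (simp add: measurable_cong_sets[OF N'(2) refl])
      have i': "integrable N' (\<lambda>w. h (fst w))" using integrable_bounded_borel[OF N'(1,2) bounded_borel_fst[OF h]] .
      have "(\<integral>w. h (fst w) * (snd w - y) \<partial>N') = (\<integral>w. h (fst w) * snd w - y * h (fst w) \<partial>N')"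
        by (simp add: algebra_simps)
      also have "\<dots> = (\<integral>w. h (fst w) * snd w \<partial>N') - y * (\<integral>w. h (fst w) \<partial>N')" using i i' by simp
      also have "\<dots> = 0" using slice_first_moment[OF sl Z(2) h] N'(4,6)[OF h] by simp
      finally show "(\<integral>w. h (fst w) * (snd w - y) \<partial>N') = 0" .
    qed
    then show False using N N'(5,7) by (force simp: minimal_slice_def)
  qed
qed

text \<open>On the lower component the dichotomy is applied to intervals ending at
  \<open>zu_minus\<close>, on the upper one to intervals starting at \<open>zl_plus\<close>. Since
  \<open>y\<close> lies beyond that end, one alternative is absorbed by another and monotonicity is
  left. Reflecting \<open>z\<close> on the upper component turns increasing into decreasing, so one
  graph lemma serves both.\<close>

lemma minimal_slice_graphs:
  assumes N: "minimal_slice X Z \<mu> p y c N" and X: "closed X"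
    and Z: "Z = {zl_minus..zu_minus} \<union> {zl_plus..zu_plus}"
    and c: "c \<in> bounded_borel" and sm: "martingale_spence_mirrlees X Z (\<lambda>x z. c (x, z))"
    and atomless: "\<And>s. AE w in N. fst w \<noteq> s"
    and y: "zu_minus < y" "y < zl_plus"
  obtains T U where "T \<in> borel_measurable borel" "U \<in> borel_measurable borel"
    "\<And>x. zl_minus \<le> T x \<or> T x = zu_minus" "\<And>x. T x \<le> zu_minus" "\<And>x. zl_plus \<le> U x" "\<And>x. U x \<le> zu_plus \<or> U x = zl_plus"
    "AE w in N. snd w = T (fst w) \<or> snd w = U (fst w)"
proof -
  have sl: "slice X Z \<mu> p y N" using N by (simp add: minimal_slice_def)
  note sl' = sliceD[OF sl]
  define B where "B = \<bar>zl_minus\<bar> + \<bar>zu_minus\<bar> + \<bar>zl_plus\<bar> + \<bar>zu_plus\<bar>"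
  have B: "\<bar>z\<bar> \<le> B" if "z \<in> Z" for z
    using that unfolding Z B_def by (auto simp: abs_if)
  have Z_closed: "closed Z" unfolding Z by (intro closed_Un closed_atLeastAtMost)
  have dich: "(AE w in N. \<not> (fst w < s \<and> snd w < a)) \<or> (AE w in N. \<not> (fst w < s \<and> b < snd w)) \<or>
      (AE w in N. \<not> (s < fst w \<and> a \<le> snd w \<and> snd w \<le> b))"
    if "a \<in> Z" "b \<in> Z" "a < b" "b < y \<or> y < a" for a b s
    using minimal_slice_dichotomy[OF N X Z_closed B c sm atomless that] by blast
  note [measurable_cong] = sl'(2)
  define NL where "NL = density N (indicator (UNIV \<times> {..zu_minus}))"
  define NU where "NU = distr (density N (indicator (UNIV \<times> {zl_plus..}))) borel (\<lambda>w. (fst w, - snd w))"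
  have [measurable]: "UNIV \<times> {..zu_minus} \<in> sets borel" "UNIV \<times> {zl_plus..} \<in> sets borel"
    by (auto intro!: borel_Times)
  have flip [measurable]: "(\<lambda>w :: real \<times> real. (fst w, - snd w)) \<in> borel \<rightarrow>\<^sub>M borel"
    by (intro borel_measurable_continuous_onI continuous_intros)
  have AE_L: "(AE w in NL. P w) \<longleftrightarrow> (AE w in N. snd w \<le> zu_minus \<longrightarrow> P w)" for P
    unfolding NL_def by (subst AE_density) (auto simp: indicator_def mem_Times_iff)
  have AE_U: "(AE w in NU. P w) \<longleftrightarrow> (AE w in N. zl_plus \<le> snd w \<longrightarrow> P (fst w, - snd w))"
    if "{w. P w} \<in> sets borel" for P
    unfolding NU_def using that by (subst AE_distr_iff) (auto simp: AE_density indicator_def mem_Times_iff)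
  obtain T where T: "T \<in> borel_measurable borel" "AE w in NL. snd w = T (fst w)"
  proof (rule antitone_measure_graph[of NL zl_minus zu_minus])
    show "sets NL = sets borel" by (simp add: NL_def sl')
    show "AE w in NL. fst w \<noteq> s" for s unfolding AE_L using atomless[of s] by (rule eventually_mono) simp
    show "AE w in NL. zl_minus \<le> snd w \<and> snd w \<le> zu_minus"
      unfolding AE_L using sl'(3) by (rule eventually_mono) (use y in \<open>auto simp: Z\<close>)
    show "(AE w in NL. \<not> (fst w < s \<and> snd w < a)) \<or> (AE w in NL. \<not> (s < fst w \<and> a < snd w))" for s a
    \<comment> \<open>Only a level strictly inside the component gives an interval with both ends in
      \<open>Z\<close>; for any other level one of the two regions is null anyway.\<close>
    proof (cases "zl_minus < a \<and> a < zu_minus")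
      case True
      then have aZ: "a \<in> Z" "zu_minus \<in> Z" "a < zu_minus" by (auto simp: Z)
      have "(AE w in N. \<not> (fst w < s \<and> snd w < a)) \<or> (AE w in N. \<not> (fst w < s \<and> zu_minus < snd w)) \<or>
        (AE w in N. \<not> (s < fst w \<and> a \<le> snd w \<and> snd w \<le> zu_minus))"
        using dich[OF aZ] y(1) by blast
      \<comment> \<open>Since \<open>y\<close> lies above \<open>zu_minus\<close>, absence of mass
        above \<open>zu_minus\<close> left of \<open>s\<close> means absence of any mass left of
        \<open>s\<close>; the second alternative falls into the first.\<close>
      moreover have "AE w in N. \<not> (fst w < s \<and> snd w < a)" if "AE w in N. \<not> (fst w < s \<and> zu_minus < snd w)"
      proof -
        have "AE w in N. fst w \<notin> {..<s}"
          using slice_charges_above[OF sl B y(1), of "{..<s}"] that by (simp add: mem_Times_iff)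
        then show ?thesis by (rule eventually_mono) simp
      qed
      ultimately have "(AE w in N. \<not> (fst w < s \<and> snd w < a)) \<or>
        (AE w in N. \<not> (s < fst w \<and> a \<le> snd w \<and> snd w \<le> zu_minus))" by blast
      then show ?thesis
      proof
        assume "AE w in N. \<not> (fst w < s \<and> snd w < a)"
        then have "AE w in NL. \<not> (fst w < s \<and> snd w < a)" unfolding AE_L by (rule eventually_mono) auto
        then show ?thesis by blast
      next
        assume "AE w in N. \<not> (s < fst w \<and> a \<le> snd w \<and> snd w \<le> zu_minus)"
        then have "AE w in NL. \<not> (s < fst w \<and> a < snd w)" unfolding AE_L by (rule eventually_mono) auto
        then show ?thesis by blast
      qed
    next
      case False
      then consider "a \<le> zl_minus" | "zu_minus \<le> a" by linarith
      then show ?thesis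
      proof cases
        case 1
        have "AE w in NL. \<not> (fst w < s \<and> snd w < a)"
          unfolding AE_L using sl'(3) by (rule eventually_mono) (use y 1 in \<open>auto simp: Z\<close>)
        then show ?thesis by blast
      next
        case 2
        have "AE w in NL. \<not> (s < fst w \<and> a < snd w)"
          unfolding AE_L by (rule AE_I2) (use 2 in auto)
        then show ?thesis by blast
      qed
    qed
  qed
  obtain V where V: "V \<in> borel_measurable borel" "AE w in NU. snd w = V (fst w)"
  proof (rule antitone_measure_graph[of NU "- zu_plus" "- zl_plus"])
    show "sets NU = sets borel" by (simp add: NU_def)
    show "AE w in NU. fst w \<noteq> s" for s
    proof -
      have "{w :: real \<times> real. fst w \<noteq> s} = (- {s}) \<times> UNIV" by auto
      then have "{w :: real \<times> real. fst w \<noteq> s} \<in> sets borel" by (simp add: borel_Times)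
      note e = AE_U[OF this]
      show ?thesis unfolding e using atomless[of s] by (rule eventually_mono) simp
    qed
    have "{w. - zu_plus \<le> snd w \<and> snd w \<le> - zl_plus} \<in> sets (borel :: (real \<times> real) measure)" by measurable
    note e = AE_U[OF this]
    show "AE w in NU. - zu_plus \<le> snd w \<and> snd w \<le> - zl_plus"
      unfolding e using sl'(3) by (rule eventually_mono) (use y in \<open>auto simp: Z\<close>)
    show "(AE w in NU. \<not> (fst w < s \<and> snd w < a)) \<or> (AE w in NU. \<not> (s < fst w \<and> a < snd w))" for s a
    proof -
      have "{w :: real \<times> real. \<not> (fst w < s \<and> snd w < a)} \<in> sets borel" by measurable
      note e1 = AE_U[OF this]
      have "{w :: real \<times> real. \<not> (s < fst w \<and> a < snd w)} \<in> sets borel" by measurable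
      note e2 = AE_U[OF this]
      show ?thesis
      proof (cases "zl_plus < - a \<and> - a < zu_plus")
        case True
        then have aZ: "zl_plus \<in> Z" "- a \<in> Z" "zl_plus < - a" by (auto simp: Z)
        have "(AE w in N. \<not> (fst w < s \<and> snd w < zl_plus)) \<or> (AE w in N. \<not> (fst w < s \<and> - a < snd w)) \<or>
          (AE w in N. \<not> (s < fst w \<and> zl_plus \<le> snd w \<and> snd w \<le> - a))"
          using dich[OF aZ] y(2) by blast
        moreover have "AE w in N. \<not> (fst w < s \<and> - a < snd w)" if "AE w in N. \<not> (fst w < s \<and> snd w < zl_plus)"
        proof -
          have "AE w in N. fst w \<notin> {..<s}"
            using slice_charges_below[OF sl B y(2), of "{..<s}"] that by (simp add: mem_Times_iff)
          then show ?thesis by (rule eventually_mono) simp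
        qed
        ultimately have "(AE w in N. \<not> (fst w < s \<and> - a < snd w)) \<or>
          (AE w in N. \<not> (s < fst w \<and> zl_plus \<le> snd w \<and> snd w \<le> - a))" by blast
        then show ?thesis
        proof
          assume "AE w in N. \<not> (fst w < s \<and> - a < snd w)"
          then have "AE w in NU. \<not> (fst w < s \<and> snd w < a)" unfolding e1 by (rule eventually_mono) auto
          then show ?thesis by blast
        next
          assume "AE w in N. \<not> (s < fst w \<and> zl_plus \<le> snd w \<and> snd w \<le> - a)"
          then have "AE w in NU. \<not> (s < fst w \<and> a < snd w)" unfolding e2 by (rule eventually_mono) auto
          then show ?thesis by blast
        qed
      next
        case False
        then consider "a \<le> - zu_plus" | "- zl_plus \<le> a" by linarith
        then show ?thesis
        proof cases
          case 1
          have "AE w in NU. \<not> (fst w < s \<and> snd w < a)"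
            unfolding e1 using sl'(3) by (rule eventually_mono) (use y 1 in \<open>auto simp: Z\<close>)
          then show ?thesis by blast
        next
          case 2
          have "AE w in NU. \<not> (s < fst w \<and> a < snd w)"
            unfolding e2 by (rule AE_I2) (use 2 in auto)
          then show ?thesis by blast
        qed
      qed
    qed
  qed
  \<comment> \<open>The inner end is imposed last, so the graphs stay on their sides of the gap even
    if a component is an empty interval; hence the alternatives in the outer bounds of the
    conclusion.\<close>
  define T' where "T' x = min zu_minus (max zl_minus (T x))" for x
  define U' where "U' x = max zl_plus (min zu_plus (- V x))" for x
  have [measurable]: "T' \<in> borel_measurable borel" "U' \<in> borel_measurable borel"
    unfolding T'_def U'_def using T(1) V(1) by measurable
  have "{w. snd w = V (fst w)} \<in> sets (borel :: (real \<times> real) measure)"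
    using V(1) by measurable
  then have V': "AE w in N. zl_plus \<le> snd w \<longrightarrow> - snd w = V (fst w)" using V(2) by (simp add: AE_U)
  have "AE w in N. snd w = T' (fst w) \<or> snd w = U' (fst w)"
    using sl'(3) T(2)[unfolded AE_L] V'
  proof eventually_elim
    case (elim w)
    show ?case
    proof (cases "snd w \<le> zu_minus")
      case True
      then have "zl_minus \<le> snd w" "snd w = T (fst w)" using elim y by (auto simp: Z)
      then show ?thesis using True by (simp add: T'_def)
    next
      case False
      then have "zl_plus \<le> snd w" "snd w \<le> zu_plus" "- snd w = V (fst w)" using elim y by (auto simp: Z)
      moreover from this have "- V (fst w) = snd w" by simp
      ultimately show ?thesis by (simp add: U'_def)
    qed
  qed
  then show ?thesis
    by (intro that[of T' U']) (auto simp: T'_def U'_def)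
qed

section \<open>Stability of slices under weak limits and averages\<close>

lemma bounded_borel_continuous:
  fixes h :: "'a::topological_space \<Rightarrow> real"
  assumes "continuous_on UNIV h" "\<And>x. 0 \<le> h x \<and> h x \<le> 1"
  shows "h \<in> bounded_borel" "bounded (range h)"
proof -
  show "h \<in> bounded_borel"
    using assms by (intro bounded_borelI[of _ 1]) (auto intro: borel_measurable_continuous_onI)
  then show "bounded (range h)" by (simp add: bounded_borel_def)
qed

lemma slice_mass:
  assumes "slice X Z \<mu> p y N" shows "measure N UNIV = (\<integral>x. p x \<partial>\<mu>)"
proof -
  have "space N = UNIV" using sets_eq_imp_space_eq[OF sliceD(2)[OF assms]] by simp
  then show ?thesis using sliceD(4)[OF assms bounded_borel_const[of 1]] by simp
qed

text \<open>Weak convergence reaches only continuous test functions. The first marginal is therefore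
  compared as a measure, and the mean condition is lifted to Borel functions of \<open>x\<close> by
  \<open>weighted_integral_zero_bounded_borel\<close>.\<close>

lemma slice_limit:
  assumes XZ: "compact X" "compact Z" and N: "\<And>n. slice X Z \<mu> p y (N n)" and a: "0 < (\<integral>x. p x \<partial>\<mu>)"
  obtains r L where "strict_mono (r :: nat \<Rightarrow> nat)" "slice X Z \<mu> p y L"
    "weak_limit (\<lambda>n. N (r n)) L"
proof -
  obtain r L where r: "strict_mono (r :: nat \<Rightarrow> nat)" and L: "finite_measure L" "sets L = sets borel" "AE w in L. w \<in> X \<times> Z"
    and lim: "weak_limit (\<lambda>n. N (r n)) L"
  proof (rule weak_limit_plane[of "X \<times> Z" N "\<integral>x. p x \<partial>\<mu>"])
    show "AE w in N n. w \<in> X \<times> Z" for n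
      using sliceD(3)[OF N[of n]] by (rule eventually_mono) (auto simp: mem_Times_iff)
  qed (use XZ N a sliceD(1,2)[OF N] slice_mass[OF N] in \<open>auto intro: compact_Times\<close>)
  note [measurable_cong] = L(2)
  obtain B where B: "0 < B" "\<And>z. z \<in> Z \<Longrightarrow> \<bar>z\<bar> \<le> B"
    using compact_imp_bounded[OF XZ(2)] by (auto simp: bounded_pos)
  have L': "AE w in L. fst w \<in> X \<and> snd w \<in> Z"
    using L(3) by (rule eventually_mono) (auto simp: mem_Times_iff)
  \<comment> \<open>All \<open>N n\<close> have the same first marginal, so \<open>N 0\<close>
    serves as reference; the weight \<open>p\<close> may be negative somewhere and is not itself
    used as a density.\<close>
  have marg: "distr L borel fst = distr (N 0) borel fst"
  proof (rule measure_eqI_bounded_continuous)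
    show "finite_measure (distr L borel fst)" by (intro finite_measure.finite_measure_distr L) simp
    show "finite_measure (distr (N 0) borel fst)"
      by (intro finite_measure.finite_measure_distr sliceD(1)[OF N]) (simp add: measurable_cong_sets[OF sliceD(2)[OF N] refl])
    fix h :: "real \<Rightarrow> real" assume h: "continuous_on UNIV h" "\<And>x. 0 \<le> h x \<and> h x \<le> 1"
    note hb = bounded_borel_continuous[OF h]
    note [measurable] = bounded_borel_measurable[OF hb(1)]
    have "(\<lambda>n. \<integral>w. h (fst w) \<partial>N (r n)) \<longlonglongrightarrow> (\<integral>w. h (fst w) \<partial>L)"
    proof (rule weak_limitD[OF lim])
      show "continuous_on UNIV (\<lambda>w :: real \<times> real. h (fst w))"
        by (rule continuous_on_compose2[OF h(1)]) (auto intro: continuous_intros)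
      show "bounded (range (\<lambda>w :: real \<times> real. h (fst w)))" using hb(2) by (auto simp: bounded_iff)
    qed
    then have "(\<integral>w. h (fst w) \<partial>L) = (\<integral>w. h (fst w) \<partial>N 0)"
      by (simp add: sliceD(4)[OF N hb(1)] LIMSEQ_const_iff)
    then show "(\<integral>x. h x \<partial>distr L borel fst) = (\<integral>x. h x \<partial>distr (N 0) borel fst)"
      by (simp add: integral_distr measurable_cong_sets[OF sliceD(2)[OF N] refl])
  qed simp_all
  have "slice X Z \<mu> p y L"
    unfolding slice_def
  proof (intro conjI ballI L(1,2) L')
    fix h :: "real \<Rightarrow> real" assume h: "h \<in> bounded_borel"
    note [measurable] = bounded_borel_measurable[OF h]
    have "(\<integral>w. h (fst w) \<partial>L) = (\<integral>x. h x \<partial>distr L borel fst)" by (simp add: integral_distr)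
    also have "\<dots> = (\<integral>w. h (fst w) \<partial>N 0)"
      unfolding marg by (simp add: integral_distr measurable_cong_sets[OF sliceD(2)[OF N] refl])
    finally show "(\<integral>w. h (fst w) \<partial>L) = (\<integral>x. h x * p x \<partial>\<mu>)" by (simp add: sliceD(4)[OF N h])
    show "(\<integral>w. h (fst w) * (snd w - y) \<partial>L) = 0"
    proof (rule weighted_integral_zero_bounded_borel[OF L(1) _ _ _ _ h, where B="B + \<bar>y\<bar>"])
      show "AE w in L. \<bar>snd w - y\<bar> \<le> B + \<bar>y\<bar>"
        using L'
      proof (rule eventually_mono)
        show "\<bar>snd w - y\<bar> \<le> B + \<bar>y\<bar>" if "fst w \<in> X \<and> snd w \<in> Z" for w
          using B(2)[of "snd w"] that by linarith
      qed
      fix h :: "real \<Rightarrow> real" assume h: "continuous_on UNIV h" "\<And>x. 0 \<le> h x \<and> h x \<le> 1"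
      note hb = bounded_borel_continuous[OF h]
      note [measurable] = bounded_borel_measurable[OF hb(1)]
      \<comment> \<open>Clipping the ordinate makes the integrand bounded and continuous without
        changing it on the support.\<close>
      define g where "g w = h (fst w) * (max (- B) (min B (snd w)) - y)" for w :: "real \<times> real"
      have g_cont: "continuous_on UNIV g"
        unfolding g_def by (intro continuous_intros continuous_on_compose2[OF h(1)]) auto
      have g_bd: "\<bar>g w\<bar> \<le> 1 * (B + \<bar>y\<bar>)" for w
        unfolding g_def abs_mult using h(2)[of "fst w"] B(1) by (intro mult_mono) auto
      then have "bounded (range g)" by (auto simp: bounded_iff)
      from weak_limitD[OF lim g_cont this] have "(\<lambda>n. \<integral>w. g w \<partial>N (r n)) \<longlonglongrightarrow> (\<integral>w. g w \<partial>L)" .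
      moreover have g_eq: "(\<integral>w. g w \<partial>M) = (\<integral>w. h (fst w) * (snd w - y) \<partial>M)"
        if M: "sets M = sets borel" "AE w in M. fst w \<in> X \<and> snd w \<in> Z" for M
      proof (rule integral_cong_AE)
        show "AE w in M. g w = h (fst w) * (snd w - y)"
          using M(2)
        proof (rule eventually_mono)
          fix w assume "fst w \<in> X \<and> snd w \<in> Z"
          then have "max (- B) (min B (snd w)) = snd w" using B(2)[of "snd w"] by linarith
          then show "g w = h (fst w) * (snd w - y)" by (simp add: g_def)
        qed
      qed (simp_all add: g_def measurable_cong_sets[OF M(1) refl])
      ultimately show "(\<integral>w. h (fst w) * (snd w - y) \<partial>L) = 0"
        by (simp add: g_eq[OF sliceD(2,3)[OF N]] g_eq[OF L(2) L'] sliceD(5)[OF N hb(1)] LIMSEQ_const_iff)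
    qed simp_all
  qed
  with r lim that show ?thesis by blast
qed

definition average_measure :: "'a measure \<Rightarrow> 'a measure \<Rightarrow> 'a measure" where
  "average_measure M N = density (add_measure M N) (\<lambda>_. ennreal (1/2))"

lemma
  assumes M: "finite_measure M" and N: "finite_measure N" "sets N = sets M"
  shows sets_average_measure: "sets (average_measure M N) = sets M"
    and finite_measure_average_measure: "finite_measure (average_measure M N)"
    and AE_average_measure_iff: "(AE x in average_measure M N. P x) \<longleftrightarrow> (AE x in M. P x) \<and> (AE x in N. P x)"
    and integral_average_measure: "integrable M f \<Longrightarrow> integrable N f \<Longrightarrow>
      (\<integral>x. f x \<partial>average_measure M N) = ((\<integral>x. f x \<partial>M) + (\<integral>x. f x \<partial>N)) / (2::real)"
proof -
  define a :: real where "a = 1 / 2"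
  have a: "0 < a" "average_measure M N = density (add_measure M N) (\<lambda>_. ennreal a)"
    by (simp_all add: a_def average_measure_def)
  show "sets (average_measure M N) = sets M" by (simp add: a)
  interpret S: finite_measure "add_measure M N" by (rule finite_measure_add_measure[OF N(2) M N(1)])
  show "finite_measure (average_measure M N)"
    using a(1) by (intro finite_measureI)
      (simp add: a(2) emeasure_density_const S.emeasure_eq_measure ennreal_mult[symmetric])
  show "(AE x in average_measure M N. P x) \<longleftrightarrow> (AE x in M. P x) \<and> (AE x in N. P x)"
    unfolding a(2) using a(1) by (subst AE_density) (simp_all add: AE_add_measure_iff[OF N(2)])
  assume f: "integrable M f" "integrable N f"
  have "f \<in> borel_measurable (add_measure M N)" using integrable_add_measure[OF N(2) f] by auto
  then show "(\<integral>x. f x \<partial>average_measure M N) = ((\<integral>x. f x \<partial>M) + (\<integral>x. f x \<partial>N)) / 2"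
    unfolding a(2) using a(1)
    by (subst integral_density) (simp_all add: integral_add_measure[OF N(2) f] a_def)
qed

lemma slice_average:
  assumes M: "slice X Z \<mu> p y M" and N: "slice X Z \<mu> p y N" and Z: "\<And>z. z \<in> Z \<Longrightarrow> \<bar>z\<bar> \<le> B"
  shows "slice X Z \<mu> p y (average_measure M N)"
proof -
  have NM: "sets N = sets M" using sliceD(2)[OF M] sliceD(2)[OF N] by simp
  note MN = sliceD(1)[OF M] sliceD(1)[OF N] NM
  note int = integral_average_measure[OF MN]
  show ?thesis
    unfolding slice_def
  proof (intro conjI ballI)
    show "AE w in average_measure M N. fst w \<in> X \<and> snd w \<in> Z"
      unfolding AE_average_measure_iff[OF MN] using sliceD(3)[OF M] sliceD(3)[OF N] by blast
    fix h :: "real \<Rightarrow> real" assume h: "h \<in> bounded_borel"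
    show "(\<integral>w. h (fst w) \<partial>average_measure M N) = (\<integral>x. h x * p x \<partial>\<mu>)"
      using int[OF integrable_bounded_borel integrable_bounded_borel, OF sliceD(1,2)[OF M] _ sliceD(1,2)[OF N], of "\<lambda>w. h (fst w)"]
        bounded_borel_fst[OF h] sliceD(4)[OF M h] sliceD(4)[OF N h] by simp
    show "(\<integral>w. h (fst w) * (snd w - y) \<partial>average_measure M N) = 0"
      using int[OF slice_integrable[OF M Z h, where r=y] slice_integrable[OF N Z h, where r=y]] sliceD(5)[OF M h] sliceD(5)[OF N h] by simp
  qed (simp_all add: finite_measure_average_measure[OF MN] sets_average_measure[OF MN] sliceD(2)[OF M])
qed

text \<open>Only the sum of the two second marginals is prescribed; how \<open>\<nu>\<close> is
  divided between the slices is part of the optimisation.\<close>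

definition slice_pair where
  "slice_pair X Z \<mu> \<nu> p\<^sub>1 p\<^sub>2 y\<^sub>1 y\<^sub>2 N\<^sub>1 N\<^sub>2 \<longleftrightarrow> slice X Z \<mu> p\<^sub>1 y\<^sub>1 N\<^sub>1 \<and> slice X Z \<mu> p\<^sub>2 y\<^sub>2 N\<^sub>2 \<and>
    (\<forall>h\<in>bounded_borel. (\<integral>w. h (snd w) \<partial>N\<^sub>1) + (\<integral>w. h (snd w) \<partial>N\<^sub>2) = (\<integral>z. h z \<partial>\<nu>))"

lemma slice_atomless:
  assumes N: "slice X Z \<mu> p y N" and \<mu>: "AE x in \<mu>. x \<noteq> s"
  shows "AE w in N. fst w \<noteq> s"
proof -
  have 1: "(\<integral>w. indicator {s} (fst w) \<partial>N) = (\<integral>x. indicator {s} x * p x \<partial>\<mu>)"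
    by (rule sliceD(4)[OF N]) auto
  also have "\<dots> = 0"
    using \<mu> by (intro integral_eq_zero_AE) (auto elim!: eventually_mono)
  finally have 0: "(\<integral>w. indicator {s} (fst w) \<partial>N) = (0::real)" .
  have "(\<lambda>w :: real \<times> real. indicator {s} (fst w)) \<in> (bounded_borel :: (real \<times> real \<Rightarrow> real) set)"
    by (rule bounded_borel_fst) auto
  from integrable_bounded_borel[OF sliceD(1,2)[OF N] this] 0
  have "AE w in N. indicator {s} (fst w) = (0::real)"
    by (subst (asm) integral_nonneg_eq_0_iff_AE) auto
  then show ?thesis by (rule eventually_mono) (auto simp: indicator_def split: if_splits)
qed

lemma slice_pair_average:
  assumes M: "slice_pair X Z \<mu> \<nu> p\<^sub>1 p\<^sub>2 y\<^sub>1 y\<^sub>2 M\<^sub>1 M\<^sub>2" and N: "slice_pair X Z \<mu> \<nu> p\<^sub>1 p\<^sub>2 y\<^sub>1 y\<^sub>2 N\<^sub>1 N\<^sub>2"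
    and Z: "\<And>z. z \<in> Z \<Longrightarrow> \<bar>z\<bar> \<le> B"
  shows "slice_pair X Z \<mu> \<nu> p\<^sub>1 p\<^sub>2 y\<^sub>1 y\<^sub>2 (average_measure M\<^sub>1 N\<^sub>1) (average_measure M\<^sub>2 N\<^sub>2)"
proof -
  have s: "slice X Z \<mu> p\<^sub>1 y\<^sub>1 M\<^sub>1" "slice X Z \<mu> p\<^sub>1 y\<^sub>1 N\<^sub>1" "slice X Z \<mu> p\<^sub>2 y\<^sub>2 M\<^sub>2" "slice X Z \<mu> p\<^sub>2 y\<^sub>2 N\<^sub>2"
    using M N by (auto simp: slice_pair_def)
  have int: "(\<integral>w. h (snd w) \<partial>average_measure L L') = ((\<integral>w. h (snd w) \<partial>L) + (\<integral>w. h (snd w) \<partial>L')) / 2"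
    if h: "h \<in> bounded_borel" and L: "slice X Z \<mu> p y L" "slice X Z \<mu> p y L'" for h :: "real \<Rightarrow> real" and p y L L'
    using integrable_bounded_borel[OF sliceD(1,2)[OF L(1)] bounded_borel_snd[OF h]]
      integrable_bounded_borel[OF sliceD(1,2)[OF L(2)] bounded_borel_snd[OF h]]
    by (intro integral_average_measure) (simp_all add: sliceD(1,2)[OF L(1)] sliceD(1,2)[OF L(2)])
  show ?thesis
    unfolding slice_pair_def
  proof (intro conjI ballI)
    fix h :: "real \<Rightarrow> real" assume h: "h \<in> bounded_borel"
    have eq: "(\<integral>w. h (snd w) \<partial>M\<^sub>1) + (\<integral>w. h (snd w) \<partial>M\<^sub>2) = (\<integral>z. h z \<partial>\<nu>)"
      "(\<integral>w. h (snd w) \<partial>N\<^sub>1) + (\<integral>w. h (snd w) \<partial>N\<^sub>2) = (\<integral>z. h z \<partial>\<nu>)"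
      using M N h by (auto simp: slice_pair_def)
    have half: "(a + b) / 2 + (c + d) / 2 = e" if "a + c = e" "b + d = e" for a b c d e :: real
      using that by (simp add: field_simps)
    show "(\<integral>w. h (snd w) \<partial>average_measure M\<^sub>1 N\<^sub>1) + (\<integral>w. h (snd w) \<partial>average_measure M\<^sub>2 N\<^sub>2) = (\<integral>z. h z \<partial>\<nu>)"
      unfolding int[OF h s(1,2)] int[OF h s(3,4)] by (rule half[OF eq])
  qed (use slice_average[OF s(1,2) Z] slice_average[OF s(3,4) Z] in auto)
qed

text \<open>Subsequences are extracted one after the other. The constraint that links the slices
  concerns a sum of marginals; it is packed into one measure \<open>S\<close>, for which agreement
  on continuous functions suffices.\<close>

lemma slice_pair_limit:
  assumes XZ: "compact X" "compact Z" and N: "\<And>n. slice_pair X Z \<mu> \<nu> p\<^sub>1 p\<^sub>2 y\<^sub>1 y\<^sub>2 (N\<^sub>1 n) (N\<^sub>2 n)"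
    and a: "0 < (\<integral>x. p\<^sub>1 x \<partial>\<mu>)" "0 < (\<integral>x. p\<^sub>2 x \<partial>\<mu>)"
  obtains r L\<^sub>1 L\<^sub>2 where "strict_mono (r :: nat \<Rightarrow> nat)" "slice_pair X Z \<mu> \<nu> p\<^sub>1 p\<^sub>2 y\<^sub>1 y\<^sub>2 L\<^sub>1 L\<^sub>2"
    "weak_limit (\<lambda>n. N\<^sub>1 (r n)) L\<^sub>1"
    "weak_limit (\<lambda>n. N\<^sub>2 (r n)) L\<^sub>2"
proof -
  have N1: "slice X Z \<mu> p\<^sub>1 y\<^sub>1 (N\<^sub>1 n)" and N2: "slice X Z \<mu> p\<^sub>2 y\<^sub>2 (N\<^sub>2 n)" for n using N by (auto simp: slice_pair_def)
  obtain r L\<^sub>1 where r: "strict_mono (r :: nat \<Rightarrow> nat)" and L1: "slice X Z \<mu> p\<^sub>1 y\<^sub>1 L\<^sub>1" and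
    lim1: "weak_limit (\<lambda>n. N\<^sub>1 (r n)) L\<^sub>1"
    using slice_limit[where N=N\<^sub>1, OF XZ N1 a(1)] by blast
  obtain q L\<^sub>2 where q: "strict_mono (q :: nat \<Rightarrow> nat)" and L2: "slice X Z \<mu> p\<^sub>2 y\<^sub>2 L\<^sub>2" and
    lim2: "weak_limit (\<lambda>n. N\<^sub>2 (r (q n))) L\<^sub>2"
    using slice_limit[where N="\<lambda>n. N\<^sub>2 (r n)", OF XZ N2 a(2)] by blast
  have lim1': "weak_limit (\<lambda>n. N\<^sub>1 (r (q n))) L\<^sub>1"
    unfolding weak_limit_def
  proof (intro allI impI)
    fix g :: "real \<times> real \<Rightarrow> real" assume "continuous_on UNIV g" "bounded (range g)"
    from LIMSEQ_subseq_LIMSEQ[OF weak_limitD[OF lim1 this] q]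
    show "(\<lambda>n. \<integral>w. g w \<partial>N\<^sub>1 (r (q n))) \<longlonglongrightarrow> (\<integral>w. g w \<partial>L\<^sub>1)" by (simp add: o_def)
  qed
  define S where "S M M' = add_measure (distr M borel snd) (distr M' borel snd)" for M M' :: "(real \<times> real) measure"
  have S: "finite_measure (S M M')" "sets (S M M') = sets borel"
    "\<And>h. h \<in> bounded_borel \<Longrightarrow> (\<integral>z. h z \<partial>S M M') = (\<integral>w. h (snd w) \<partial>M) + (\<integral>w. h (snd w) \<partial>M')"
    if M: "slice X Z \<mu> p y M" "slice X Z \<mu> p' y' M'" for M M' p p' y y'
  proof -
    have m: "snd \<in> borel_measurable M" "snd \<in> borel_measurable M'"
      by (simp_all add: measurable_cong_sets[OF sliceD(2)[OF M(1)] refl] measurable_cong_sets[OF sliceD(2)[OF M(2)] refl])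
    have f: "finite_measure (distr M borel snd)" "finite_measure (distr M' borel snd)"
      by (intro finite_measure.finite_measure_distr sliceD(1)[OF M(1)] sliceD(1)[OF M(2)] m)+
    then show "finite_measure (S M M')" unfolding S_def by (intro finite_measure_add_measure) simp_all
    show "sets (S M M') = sets borel" by (simp add: S_def)
    show "(\<integral>z. h z \<partial>S M M') = (\<integral>w. h (snd w) \<partial>M) + (\<integral>w. h (snd w) \<partial>M')" if h: "h \<in> bounded_borel" for h
      unfolding S_def using f h bounded_borel_measurable[OF h]
      by (subst integral_add_measure) (auto intro!: integrable_bounded_borel simp: integral_distr m)
  qed
  have "S L\<^sub>1 L\<^sub>2 = S (N\<^sub>1 0) (N\<^sub>2 0)"
  proof (rule measure_eqI_bounded_continuous)
    fix h :: "real \<Rightarrow> real" assume h: "continuous_on UNIV h" "\<And>x. 0 \<le> h x \<and> h x \<le> 1"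
    note hb = bounded_borel_continuous[OF h]
    have c: "continuous_on UNIV (\<lambda>w :: real \<times> real. h (snd w))"
      by (rule continuous_on_compose2[OF h(1)]) (auto intro: continuous_intros)
    have b: "bounded (range (\<lambda>w :: real \<times> real. h (snd w)))" using hb(2) by (auto simp: bounded_iff)
    have eq: "(\<integral>w. h (snd w) \<partial>N\<^sub>1 n) + (\<integral>w. h (snd w) \<partial>N\<^sub>2 n) = (\<integral>z. h z \<partial>\<nu>)" for n
      using N[of n] hb(1) by (simp add: slice_pair_def)
    have "(\<lambda>n. \<integral>z. h z \<partial>\<nu>) \<longlonglongrightarrow> (\<integral>w. h (snd w) \<partial>L\<^sub>1) + (\<integral>w. h (snd w) \<partial>L\<^sub>2)"
      using tendsto_add[OF weak_limitD[OF lim1' c b] weak_limitD[OF lim2 c b]] unfolding eq .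
    then have "(\<integral>w. h (snd w) \<partial>L\<^sub>1) + (\<integral>w. h (snd w) \<partial>L\<^sub>2) = (\<integral>z. h z \<partial>\<nu>)" by (simp add: LIMSEQ_const_iff)
    then show "(\<integral>z. h z \<partial>S L\<^sub>1 L\<^sub>2) = (\<integral>z. h z \<partial>S (N\<^sub>1 0) (N\<^sub>2 0))"
      unfolding S(3)[OF L1 L2 hb(1)] S(3)[OF N1 N2 hb(1)] eq .
  qed (use S(1,2)[OF L1 L2] S(1,2)[OF N1 N2] in simp_all)
  then have "(\<integral>w. h (snd w) \<partial>L\<^sub>1) + (\<integral>w. h (snd w) \<partial>L\<^sub>2) = (\<integral>z. h z \<partial>\<nu>)" if h: "h \<in> bounded_borel" for h
    using S(3)[OF L1 L2 h] S(3)[OF N1 N2 h] N[of 0] h by (simp add: slice_pair_def)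
  then have "slice_pair X Z \<mu> \<nu> p\<^sub>1 p\<^sub>2 y\<^sub>1 y\<^sub>2 L\<^sub>1 L\<^sub>2" using L1 L2 by (simp add: slice_pair_def)
  with strict_mono_o[OF r q] show ?thesis
    by (rule that) (simp_all add: lim1' lim2)
qed

text \<open>If two optimal pairs exist, their average is optimal too, and each slice of the average is
  carried by two graphs; hence so are the slices of both pairs, which forces them to agree.\<close>

lemma unique_optimal_slice_pair:
  fixes c k\<^sub>1 k\<^sub>2 :: "real \<times> real \<Rightarrow> real"
  assumes X: "compact X" and Z: "Z = {zl_minus..zu_minus} \<union> {zl_plus..zu_plus}"
    and y: "zu_minus < y\<^sub>1" "y\<^sub>1 < zl_plus" "zu_minus < y\<^sub>2" "y\<^sub>2 < zl_plus"
    and atomless: "\<And>s. AE x in \<mu>. x \<noteq> s" and mass: "0 < (\<integral>x. p\<^sub>1 x \<partial>\<mu>)" "0 < (\<integral>x. p\<^sub>2 x \<partial>\<mu>)"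
    and k: "continuous_on UNIV k\<^sub>1" "k\<^sub>1 \<in> bounded_borel" "continuous_on UNIV k\<^sub>2" "k\<^sub>2 \<in> bounded_borel"
    and split: "\<And>w. k\<^sub>1 w = a\<^sub>1 (fst w) + b\<^sub>1 (snd w) + c w" "\<And>w. k\<^sub>2 w = a\<^sub>2 (fst w) + b\<^sub>2 (snd w) + c w"
    and abc: "a\<^sub>1 \<in> bounded_borel" "b\<^sub>1 \<in> bounded_borel" "a\<^sub>2 \<in> bounded_borel" "b\<^sub>2 \<in> bounded_borel" "c \<in> bounded_borel"
    and sm: "martingale_spence_mirrlees X Z (\<lambda>x z. c (x, z))"
    and ex: "\<exists>N\<^sub>1 N\<^sub>2. slice_pair X Z \<mu> \<nu> p\<^sub>1 p\<^sub>2 y\<^sub>1 y\<^sub>2 N\<^sub>1 N\<^sub>2"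
  shows "\<exists>N\<^sub>1 N\<^sub>2. slice_pair X Z \<mu> \<nu> p\<^sub>1 p\<^sub>2 y\<^sub>1 y\<^sub>2 N\<^sub>1 N\<^sub>2 \<and>
    (\<forall>M\<^sub>1 M\<^sub>2. slice_pair X Z \<mu> \<nu> p\<^sub>1 p\<^sub>2 y\<^sub>1 y\<^sub>2 M\<^sub>1 M\<^sub>2 \<longrightarrow>
      (\<integral>w. k\<^sub>1 w \<partial>N\<^sub>1) + (\<integral>w. k\<^sub>2 w \<partial>N\<^sub>2) \<le> (\<integral>w. k\<^sub>1 w \<partial>M\<^sub>1) + (\<integral>w. k\<^sub>2 w \<partial>M\<^sub>2) \<and>
      ((\<integral>w. k\<^sub>1 w \<partial>M\<^sub>1) + (\<integral>w. k\<^sub>2 w \<partial>M\<^sub>2) \<le> (\<integral>w. k\<^sub>1 w \<partial>N\<^sub>1) + (\<integral>w. k\<^sub>2 w \<partial>N\<^sub>2) \<longrightarrow> M\<^sub>1 = N\<^sub>1 \<and> M\<^sub>2 = N\<^sub>2))"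
proof -
  let ?P = "slice_pair X Z \<mu> \<nu> p\<^sub>1 p\<^sub>2 y\<^sub>1 y\<^sub>2"
  define J where "J M\<^sub>1 M\<^sub>2 = (\<integral>w. k\<^sub>1 w \<partial>M\<^sub>1) + (\<integral>w. k\<^sub>2 w \<partial>M\<^sub>2)" for M\<^sub>1 M\<^sub>2
  have Zc: "compact Z" unfolding Z by (intro compact_Un compact_Icc)
  obtain B where B: "\<And>z. z \<in> Z \<Longrightarrow> \<bar>z\<bar> \<le> B"
    using compact_imp_bounded[OF Zc] by (auto simp: bounded_iff)
  have sl: "slice X Z \<mu> p\<^sub>1 y\<^sub>1 M\<^sub>1" "slice X Z \<mu> p\<^sub>2 y\<^sub>2 M\<^sub>2" if "?P M\<^sub>1 M\<^sub>2" for M\<^sub>1 M\<^sub>2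
    using that by (auto simp: slice_pair_def)
  have lower: "- C * (\<integral>x. p x \<partial>\<mu>) \<le> (\<integral>w. f w \<partial>M)" if M: "slice X Z \<mu> p y M" and f: "f \<in> bounded_borel" "\<And>w. \<bar>f w\<bar> \<le> C" for p y M f C
  proof -
    interpret M: finite_measure M by (rule sliceD(1)[OF M])
    have "(\<integral>w. - C \<partial>M) \<le> (\<integral>w. f w \<partial>M)"
    proof (rule integral_mono)
      show "- C \<le> f w" for w using f(2)[of w] by linarith
    qed (use integrable_bounded_borel[OF sliceD(1,2)[OF M] f(1)] in simp_all)
    moreover have "space M = UNIV" using sets_eq_imp_space_eq[OF sliceD(2)[OF M]] by simp
    ultimately show ?thesis using slice_mass[OF M] by (simp add: mult.commute)
  qed
  define V where "V = {J M\<^sub>1 M\<^sub>2 | M\<^sub>1 M\<^sub>2. ?P M\<^sub>1 M\<^sub>2}"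
  obtain C\<^sub>1 where C1: "\<And>w. \<bar>k\<^sub>1 w\<bar> \<le> C\<^sub>1" using bounded_borel_bound[OF k(2)] by blast
  obtain C\<^sub>2 where C2: "\<And>w. \<bar>k\<^sub>2 w\<bar> \<le> C\<^sub>2" using bounded_borel_bound[OF k(4)] by blast
  have V: "V \<noteq> {}" "bdd_below V"
  proof -
    show "V \<noteq> {}" using ex by (auto simp: V_def)
    show "bdd_below V"
    proof (rule bdd_belowI)
      fix v assume "v \<in> V"
      then obtain M\<^sub>1 M\<^sub>2 where M: "?P M\<^sub>1 M\<^sub>2" and v: "v = J M\<^sub>1 M\<^sub>2" by (auto simp: V_def)
      show "- C\<^sub>1 * (\<integral>x. p\<^sub>1 x \<partial>\<mu>) + - C\<^sub>2 * (\<integral>x. p\<^sub>2 x \<partial>\<mu>) \<le> v"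
        unfolding v J_def by (intro add_mono lower[OF sl(1)[OF M] k(2) C1] lower[OF sl(2)[OF M] k(4) C2])
    qed
  qed
  have "\<exists>M\<^sub>1 M\<^sub>2. ?P M\<^sub>1 M\<^sub>2 \<and> J M\<^sub>1 M\<^sub>2 < Inf V + 1 / real (Suc n)" for n
  proof -
    obtain v where "v \<in> V" "v < Inf V + 1 / real (Suc n)"
      using cInf_lessD[OF V(1), of "Inf V + 1 / real (Suc n)"] by auto
    then show ?thesis by (auto simp: V_def)
  qed
  then obtain A\<^sub>1 A\<^sub>2 where A: "\<And>n. ?P (A\<^sub>1 n) (A\<^sub>2 n)" "\<And>n. J (A\<^sub>1 n) (A\<^sub>2 n) < Inf V + 1 / real (Suc n)" by metis
  obtain r N\<^sub>1 N\<^sub>2 where r: "strict_mono (r :: nat \<Rightarrow> nat)" and N: "?P N\<^sub>1 N\<^sub>2" and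
    lim: "weak_limit (\<lambda>n. A\<^sub>1 (r n)) N\<^sub>1"
    "weak_limit (\<lambda>n. A\<^sub>2 (r n)) N\<^sub>2"
    using slice_pair_limit[where N\<^sub>1=A\<^sub>1 and N\<^sub>2=A\<^sub>2, OF X Zc A(1) mass] by blast
  have "(\<lambda>n. J (A\<^sub>1 (r n)) (A\<^sub>2 (r n))) \<longlonglongrightarrow> J N\<^sub>1 N\<^sub>2"
    unfolding J_def using k by (intro tendsto_add weak_limitD[OF lim(1)] weak_limitD[OF lim(2)]) (auto simp: bounded_borel_def)
  moreover have "(\<lambda>n. Inf V + 1 / real (Suc (r n))) \<longlonglongrightarrow> Inf V + 0"
    using LIMSEQ_subseq_LIMSEQ[OF LIMSEQ_inverse_real_of_nat r]
    by (intro tendsto_add tendsto_const) (simp add: o_def inverse_eq_divide)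
  ultimately have "J N\<^sub>1 N\<^sub>2 \<le> Inf V"
    using A(2) by (intro LIMSEQ_le[where X="\<lambda>n. J (A\<^sub>1 (r n)) (A\<^sub>2 (r n))"]) (auto intro: less_imp_le)
  then have opt: "J N\<^sub>1 N\<^sub>2 \<le> J M\<^sub>1 M\<^sub>2" if "?P M\<^sub>1 M\<^sub>2" for M\<^sub>1 M\<^sub>2
    using cInf_lower[of "J M\<^sub>1 M\<^sub>2" V] V(2) that by (force simp: V_def)
  have k_split: "(\<integral>w. f w \<partial>M) = (\<integral>w. a (fst w) \<partial>M) + (\<integral>w. b (snd w) \<partial>M) + (\<integral>w. c w \<partial>M)"
    if M: "slice X Z \<mu> p y M" and f: "\<And>w. f w = a (fst w) + b (snd w) + c w" and ab: "a \<in> bounded_borel" "b \<in> bounded_borel"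
    for p y M f a b
  proof -
    note i = integrable_bounded_borel[OF sliceD(1,2)[OF M]]
    show ?thesis unfolding f using i[OF bounded_borel_fst[OF ab(1)]] i[OF bounded_borel_snd[OF ab(2)]] i[OF abc(5)] by simp
  qed
  have "M\<^sub>1 = N\<^sub>1 \<and> M\<^sub>2 = N\<^sub>2" if M: "?P M\<^sub>1 M\<^sub>2" and le: "J M\<^sub>1 M\<^sub>2 \<le> J N\<^sub>1 N\<^sub>2" for M\<^sub>1 M\<^sub>2
  proof -
    define R\<^sub>1 where "R\<^sub>1 = average_measure M\<^sub>1 N\<^sub>1"
    define R\<^sub>2 where "R\<^sub>2 = average_measure M\<^sub>2 N\<^sub>2"
    have R: "?P R\<^sub>1 R\<^sub>2" unfolding R\<^sub>1_def R\<^sub>2_def by (rule slice_pair_average[OF M N B])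
    have av: "(\<integral>w. f w \<partial>average_measure L L') = ((\<integral>w. f w \<partial>L) + (\<integral>w. f w \<partial>L')) / 2"
      if f: "f \<in> bounded_borel" and L: "slice X Z \<mu> p y L" "slice X Z \<mu> p y L'" for f p y L L'
      using integrable_bounded_borel[OF sliceD(1,2)[OF L(1)] f] integrable_bounded_borel[OF sliceD(1,2)[OF L(2)] f]
      by (intro integral_average_measure) (simp_all add: sliceD(1,2)[OF L(1)] sliceD(1,2)[OF L(2)])
    have JR: "J R\<^sub>1 R\<^sub>2 \<le> J N\<^sub>1 N\<^sub>2"
      using le unfolding J_def R\<^sub>1_def R\<^sub>2_def av[OF k(2) sl(1)[OF M] sl(1)[OF N]] av[OF k(4) sl(2)[OF M] sl(2)[OF N]]
      by (simp add: field_simps)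
    have optR: "J R\<^sub>1 R\<^sub>2 \<le> J L\<^sub>1 L\<^sub>2" if "?P L\<^sub>1 L\<^sub>2" for L\<^sub>1 L\<^sub>2 using JR opt[OF that] by simp
    \<comment> \<open>One slice is varied while the other is kept. The terms
      \<open>a\<^sub>1\<close> and \<open>b\<^sub>1\<close> see only marginals shared with the
      competitor, so optimality for the full cost becomes minimality for \<open>c\<close>.\<close>
    have m1: "minimal_slice X Z \<mu> p\<^sub>1 y\<^sub>1 c R\<^sub>1"
      unfolding minimal_slice_def
    proof (intro conjI allI impI sl(1)[OF R])
      fix L assume L: "slice X Z \<mu> p\<^sub>1 y\<^sub>1 L" and z: "\<forall>h\<in>bounded_borel. (\<integral>w. h (snd w) \<partial>L) = (\<integral>w. h (snd w) \<partial>R\<^sub>1)"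
      have "?P L R\<^sub>2" using R L z by (simp add: slice_pair_def)
      from optR[OF this] show "(\<integral>w. c w \<partial>R\<^sub>1) \<le> (\<integral>w. c w \<partial>L)"
        unfolding J_def k_split[OF L split(1) abc(1,2)] k_split[OF sl(1)[OF R] split(1) abc(1,2)]
        using sliceD(4)[OF L abc(1)] sliceD(4)[OF sl(1)[OF R] abc(1)] z abc(2) by simp
    qed
    have m2: "minimal_slice X Z \<mu> p\<^sub>2 y\<^sub>2 c R\<^sub>2"
      unfolding minimal_slice_def
    proof (intro conjI allI impI sl(2)[OF R])
      fix L assume L: "slice X Z \<mu> p\<^sub>2 y\<^sub>2 L" and z: "\<forall>h\<in>bounded_borel. (\<integral>w. h (snd w) \<partial>L) = (\<integral>w. h (snd w) \<partial>R\<^sub>2)"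
      have "?P R\<^sub>1 L" using R L z by (simp add: slice_pair_def)
      from optR[OF this] show "(\<integral>w. c w \<partial>R\<^sub>2) \<le> (\<integral>w. c w \<partial>L)"
        unfolding J_def k_split[OF L split(2) abc(3,4)] k_split[OF sl(2)[OF R] split(2) abc(3,4)]
        using sliceD(4)[OF L abc(3)] sliceD(4)[OF sl(2)[OF R] abc(3)] z abc(4) by simp
    qed
    have eq: "L = L'" if mR: "minimal_slice X Z \<mu> p y c (average_measure L L')" and yy: "zu_minus < y" "y < zl_plus"
      and L: "slice X Z \<mu> p y L" "slice X Z \<mu> p y L'" for p y L L'
    proof -
      have at: "AE w in average_measure L L'. fst w \<noteq> s" for s
        using mR slice_atomless[OF _ atomless] unfolding minimal_slice_def by blast
      obtain T U where TU: "T \<in> borel_measurable borel" "U \<in> borel_measurable borel"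
        "\<And>x. zl_minus \<le> T x \<or> T x = zu_minus" "\<And>x. T x \<le> zu_minus" "\<And>x. zl_plus \<le> U x" "\<And>x. U x \<le> zu_plus \<or> U x = zl_plus"
        "AE w in average_measure L L'. snd w = T (fst w) \<or> snd w = U (fst w)"
        using minimal_slice_graphs[OF mR compact_imp_closed[OF X] Z abc(5) sm at yy] by blast
      define D where "D = \<bar>zl_minus\<bar> + \<bar>zu_minus\<bar> + \<bar>zl_plus\<bar> + \<bar>zu_plus\<bar>"
      have D: "\<bar>T x\<bar> \<le> D" "\<bar>U x\<bar> \<le> D" for x
        using TU(3)[of x] TU(4)[of x] TU(5)[of x] TU(6)[of x] by (auto simp: D_def abs_if)
      have LL': "sets L' = sets L" using sliceD(2)[OF L(1)] sliceD(2)[OF L(2)] by simp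
      have g: "AE w in L. snd w = T (fst w) \<or> snd w = U (fst w)" "AE w in L'. snd w = T (fst w) \<or> snd w = U (fst w)"
        using TU(7) unfolding AE_average_measure_iff[OF sliceD(1)[OF L(1)] sliceD(1)[OF L(2)] LL'] by auto
      have "zu_minus < zl_plus" using yy by simp
      show ?thesis
        by (rule measure_on_two_graphs_unique[OF sliceD(1,2)[OF L(1)] sliceD(1,2)[OF L(2)] TU(1,2,4,5) \<open>zu_minus < zl_plus\<close> D g,
              of y]) (simp_all add: sliceD(4,5)[OF L(1)] sliceD(4,5)[OF L(2)])
    qed
    show ?thesis
      using eq[OF m1[unfolded R\<^sub>1_def] y(1,2) sl(1)[OF M] sl(1)[OF N]] eq[OF m2[unfolded R\<^sub>2_def] y(3,4) sl(2)[OF M] sl(2)[OF N]] by simp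
  qed
  with opt show ?thesis unfolding J_def by (intro exI[of _ N\<^sub>1] exI[of _ N\<^sub>2]) (simp add: N)
qed

subsection \<open>Martingale couplings and their slices\<close>

lemma bounded_borel_restrict:
  assumes "h \<in> bounded_borel" shows "h \<in> borel_measurable (restrict_space borel S)"
  by (rule measurable_restrict_space1[OF bounded_borel_measurable[OF assms]])

lemma measure_eqI_restrict_bounded_borel:
  assumes M: "finite_measure M" "sets M = sets (restrict_space borel S)"
    and N: "finite_measure N" "sets N = sets (restrict_space borel S)"
    and eq: "\<And>h :: 'a::topological_space \<Rightarrow> real. h \<in> bounded_borel \<Longrightarrow> (\<integral>x. h x \<partial>M) = (\<integral>x. h x \<partial>N)"
  shows "M = N"
proof (rule measure_eqI)
  fix A assume A: "A \<in> sets M"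
  have sp: "space M = S" "space N = S"
    using sets_eq_imp_space_eq[OF M(2)] sets_eq_imp_space_eq[OF N(2)] by (simp_all add: space_restrict_space)
  obtain A' where A': "A' \<in> sets borel" "A = S \<inter> A'" using A by (auto simp: M(2) sets_restrict_space)
  have "measure L A = (\<integral>x. indicator A' x \<partial>L)" if "sets L = sets (restrict_space borel S)" "space L = S" "finite_measure L" for L
  proof -
    have "(\<integral>x. indicator A' x \<partial>L) = (\<integral>x. indicator A x \<partial>L :: real)"
      using that(2) by (intro Bochner_Integration.integral_cong) (auto simp: A' indicator_def)
    then show ?thesis using A that(1,2) by (simp add: A'(2) inf.absorb1)
  qed
  from this[OF M(2) sp(1) M(1)] this[OF N(2) sp(2) N(1)] eq[OF bounded_borel_indicator[OF A'(1)]]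
  have "measure M A = measure N A" by simp
  then show "emeasure M A = emeasure N A"
    by (simp add: finite_measure.emeasure_eq_measure[OF M(1)] finite_measure.emeasure_eq_measure[OF N(1)])
qed (use M N in simp)

lemma distr_restrict_eq_iff:
  fixes \<mu> :: "'b::topological_space measure"
  assumes M: "finite_measure M" and f: "f \<in> measurable M (restrict_space borel S)"
    and \<mu>: "finite_measure \<mu>" "sets \<mu> = sets (restrict_space borel S)"
  shows "distr M (restrict_space borel S) f = \<mu> \<longleftrightarrow> (\<forall>h\<in>bounded_borel. (\<integral>w. h (f w) \<partial>M) = (\<integral>x. h x \<partial>\<mu>))"
proof -
  have int: "(\<integral>x. h x \<partial>distr M (restrict_space borel S) f) = (\<integral>w. h (f w) \<partial>M)" if "h \<in> bounded_borel" for h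
    by (rule integral_distr[OF f bounded_borel_restrict[OF that]])
  show ?thesis
  proof
    assume "distr M (restrict_space borel S) f = \<mu>"
    then show "\<forall>h\<in>bounded_borel. (\<integral>w. h (f w) \<partial>M) = (\<integral>x. h x \<partial>\<mu>)" using int by auto
  next
    assume "\<forall>h\<in>bounded_borel. (\<integral>w. h (f w) \<partial>M) = (\<integral>x. h x \<partial>\<mu>)"
    then show "distr M (restrict_space borel S) f = \<mu>"
      using int by (intro measure_eqI_restrict_bounded_borel[OF finite_measure.finite_measure_distr[OF M f] _ \<mu>]) auto
  qed
qed

text \<open>The generated sigma-algebra consists of preimages of Borel sets under \<open>T\<close>,
  so indicators of its members are bounded Borel functions of \<open>T\<close>, and all such
  functions are measurable for it. The bounds make every product integrable.\<close>

lemma cond_mean_eq_iff: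
  fixes T :: "'a \<Rightarrow> 'b::topological_space"
  assumes M: "finite_measure M" and T: "T \<in> borel_measurable M"
    and f: "f \<in> borel_measurable M" "AE w in M. \<bar>f w\<bar> \<le> B"
    and G: "G \<in> borel_measurable borel" "AE w in M. \<bar>G (T w)\<bar> \<le> C"
  shows "(AE w in M. cond_mean M f T w = G (T w)) \<longleftrightarrow>
    (\<forall>h\<in>bounded_borel. (\<integral>w. h (T w) * (f w - G (T w)) \<partial>M) = 0)"
proof -
  interpret M: finite_measure M by fact
  define F where "F = vimage_algebra (space M) T borel"
  have F_sets: "sets F = {T -` A \<inter> space M | A. A \<in> sets borel}"
    unfolding F_def by (rule sets_vimage_algebra2) simp
  have T_F: "T \<in> borel_measurable F" unfolding F_def by (rule measurable_vimage_algebra1) simp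
  interpret S: finite_measure_subalgebra M F
  proof
    show "subalgebra M F"
    proof (rule subalgebra_def[THEN iffD2], intro conjI subsetI)
      fix E assume "E \<in> sets F"
      then show "E \<in> sets M" using measurable_sets[OF T] by (auto simp: F_sets)
    qed (simp add: F_def)
  qed
  have cm: "cond_mean M f T = real_cond_exp M F f" by (simp add: cond_mean_def F_def)
  have GT_F: "(\<lambda>w. G (T w)) \<in> borel_measurable F" by (rule measurable_compose[OF T_F G(1)])
  have GT: "(\<lambda>w. G (T w)) \<in> borel_measurable M" by (rule measurable_compose[OF T G(1)])
  have hT_F: "(\<lambda>w. h (T w)) \<in> borel_measurable F" if "h \<in> bounded_borel" for h
    by (rule measurable_compose[OF T_F bounded_borel_measurable[OF that]])
  have hT: "(\<lambda>w. h (T w)) \<in> borel_measurable M" if "h \<in> bounded_borel" for h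
    by (rule measurable_compose[OF T bounded_borel_measurable[OF that]])
  have int: "integrable M (\<lambda>w. h (T w) * g w)" if h: "h \<in> bounded_borel" and g: "g \<in> borel_measurable M" "AE w in M. \<bar>g w\<bar> \<le> D" for h g D
  proof -
    obtain H where H: "0 \<le> H" "\<And>x. \<bar>h x\<bar> \<le> H" using bounded_borel_bound[OF h] by blast
    show ?thesis
    proof (rule M.integrable_const_bound)
      show "AE w in M. norm (h (T w) * g w) \<le> H * D"
        using g(2) by (rule eventually_mono) (use H in \<open>auto simp: abs_mult intro!: mult_mono\<close>)
      show "(\<lambda>w. h (T w) * g w) \<in> borel_measurable M" using hT[OF h] g(1) by (rule borel_measurable_times)
    qed
  qed
  have split: "(\<integral>w. h (T w) * (f w - G (T w)) \<partial>M) = (\<integral>w. h (T w) * f w \<partial>M) - (\<integral>w. h (T w) * G (T w) \<partial>M)" if h: "h \<in> bounded_borel" for h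
    using int[OF h f] int[OF h GT G(2)] by (simp add: right_diff_distrib)
  show ?thesis
  proof
    assume ae: "AE w in M. cond_mean M f T w = G (T w)"
    show "\<forall>h\<in>bounded_borel. (\<integral>w. h (T w) * (f w - G (T w)) \<partial>M) = 0"
    proof
      fix h :: "'b \<Rightarrow> real" assume h: "h \<in> bounded_borel"
      have "(\<integral>w. h (T w) * G (T w) \<partial>M) = (\<integral>w. h (T w) * real_cond_exp M F f w \<partial>M)"
      proof (rule integral_cong_AE)
        show "AE w in M. h (T w) * G (T w) = h (T w) * real_cond_exp M F f w"
          using ae by (rule eventually_mono) (simp add: cm)
      qed (use hT[OF h] GT in simp_all)
      also have "\<dots> = (\<integral>w. h (T w) * f w \<partial>M)" by (rule S.real_cond_exp_intg(2)[OF int[OF h f] hT_F[OF h] f(1)])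
      finally show "(\<integral>w. h (T w) * (f w - G (T w)) \<partial>M) = 0" using split[OF h] by simp
    qed
  next
    assume *: "\<forall>h\<in>bounded_borel. (\<integral>w. h (T w) * (f w - G (T w)) \<partial>M) = 0"
    show "AE w in M. cond_mean M f T w = G (T w)"
      unfolding cm
    proof (rule S.real_cond_exp_charact)
      fix E assume "E \<in> sets F"
      then obtain A where A: "A \<in> sets borel" "E = T -` A \<inter> space M" by (auto simp: F_sets)
      have ind: "(\<integral>w\<in>E. g w \<partial>M) = (\<integral>w. indicator A (T w) * g w \<partial>M)" for g :: "'a \<Rightarrow> real"
        unfolding set_lebesgue_integral_def A(2)
        by (intro Bochner_Integration.integral_cong) (auto simp: indicator_def)
      show "(\<integral>w\<in>E. f w \<partial>M) = (\<integral>w\<in>E. G (T w) \<partial>M)"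
        unfolding ind using * split[OF bounded_borel_indicator[OF A(1)]] bounded_borel_indicator[OF A(1)] by simp
    next
      show "integrable M f" using f by (intro M.integrable_const_bound[where B=B]) simp_all
      show "integrable M (\<lambda>w. G (T w))" using G GT by (intro M.integrable_const_bound[where B=C]) simp_all
    qed (fact GT_F)
  qed
qed

lemma borel_measurable_triple [measurable]:
  "(\<lambda>w. fst w) \<in> borel_measurable (borel :: (real \<times> real \<times> real) measure)"
  "(\<lambda>w. fst (snd w)) \<in> borel_measurable (borel :: (real \<times> real \<times> real) measure)"
  "(\<lambda>w. snd (snd w)) \<in> borel_measurable (borel :: (real \<times> real \<times> real) measure)"
  "(\<lambda>w. (fst w, fst (snd w))) \<in> borel_measurable (borel :: (real \<times> real \<times> real) measure)"
  "(\<lambda>w. (fst w, snd (snd w))) \<in> borel_measurable (borel :: (real \<times> real \<times> real) measure)"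
  "snd \<in> borel_measurable (borel :: (real \<times> real \<times> real) measure)"
  by (auto intro!: borel_measurable_continuous_onI continuous_intros)

text \<open>The only description of couplings used from here on: linear identities against bounded
  Borel functions. Compactness provides the bounds on the coordinates that
  \<open>cond_mean_eq_iff\<close> asks for.\<close>

lemma martingale_couplings_iff:
  assumes XYZ: "compact X" "compact Y" "compact Z"
    and \<mu>: "\<mu>X \<in> borel_probs X" "\<mu>Y \<in> borel_probs Y" "\<mu>Z \<in> borel_probs Z"
  shows "\<pi> \<in> martingale_couplings X Y Z \<mu>X \<mu>Y \<mu>Z \<longleftrightarrow>
    prob_space \<pi> \<and> sets \<pi> = sets (restrict_space borel (X \<times> Y \<times> Z)) \<and>
    (\<forall>h\<in>bounded_borel. (\<integral>w. h (fst w) \<partial>\<pi>) = (\<integral>x. h x \<partial>\<mu>X)) \<and>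
    (\<forall>h\<in>bounded_borel. (\<integral>w. h (fst (snd w)) \<partial>\<pi>) = (\<integral>y. h y \<partial>\<mu>Y)) \<and>
    (\<forall>h\<in>bounded_borel. (\<integral>w. h (snd (snd w)) \<partial>\<pi>) = (\<integral>z. h z \<partial>\<mu>Z)) \<and>
    (\<forall>h\<in>bounded_borel. (\<integral>w. h (fst w) * (fst (snd w) - fst w) \<partial>\<pi>) = 0) \<and>
    (\<forall>h\<in>bounded_borel. (\<integral>w. h (fst w, fst (snd w)) * (snd (snd w) - fst (snd w)) \<partial>\<pi>) = 0)"
proof -
  have proj: "(\<lambda>(x, y, z). x) = (\<lambda>w :: real \<times> real \<times> real. fst w)" "(\<lambda>(x, y, z). y) = (\<lambda>w :: real \<times> real \<times> real. fst (snd w))"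
    "(\<lambda>(x, y, z). z) = (\<lambda>w :: real \<times> real \<times> real. snd (snd w))" "(\<lambda>(x, y, z). (x, y)) = (\<lambda>w :: real \<times> real \<times> real. (fst w, fst (snd w)))"
    by (auto simp: fun_eq_iff)
  have probs: "\<mu> \<in> borel_probs S \<longleftrightarrow> prob_space \<mu> \<and> sets \<mu> = sets (restrict_space borel S)" for \<mu> :: "'a::topological_space measure" and S
    by (auto simp: borel_probs_def space_prob_algebra)
  have \<mu>': "finite_measure \<mu>X" "finite_measure \<mu>Y" "finite_measure \<mu>Z" "sets \<mu>X = sets (restrict_space borel X)"
    "sets \<mu>Y = sets (restrict_space borel Y)" "sets \<mu>Z = sets (restrict_space borel Z)"
    using \<mu> by (auto simp: probs prob_space.finite_measure)
  obtain B where B: "\<And>x. x \<in> X \<Longrightarrow> \<bar>x\<bar> \<le> B" using compact_imp_bounded[OF XYZ(1)] by (auto simp: bounded_iff)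
  obtain C where C: "\<And>x. x \<in> Y \<Longrightarrow> \<bar>x\<bar> \<le> C" using compact_imp_bounded[OF XYZ(2)] by (auto simp: bounded_iff)
  obtain D where D: "\<And>x. x \<in> Z \<Longrightarrow> \<bar>x\<bar> \<le> D" using compact_imp_bounded[OF XYZ(3)] by (auto simp: bounded_iff)
  have main: "(distr \<pi> (restrict_space borel X) (\<lambda>w. fst w) = \<mu>X \<and>
     distr \<pi> (restrict_space borel Y) (\<lambda>w. fst (snd w)) = \<mu>Y \<and>
     distr \<pi> (restrict_space borel Z) (\<lambda>w. snd (snd w)) = \<mu>Z \<and>
     (AE \<omega> in \<pi>. cond_mean \<pi> (\<lambda>w. fst (snd w)) (\<lambda>w. fst w) \<omega> = fst \<omega>) \<and>
     (AE \<omega> in \<pi>. cond_mean \<pi> (\<lambda>w. snd (snd w)) (\<lambda>w. (fst w, fst (snd w))) \<omega> = fst (snd \<omega>))) \<longleftrightarrow>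
    (\<forall>h\<in>bounded_borel. (\<integral>w. h (fst w) \<partial>\<pi>) = (\<integral>x. h x \<partial>\<mu>X)) \<and>
    (\<forall>h\<in>bounded_borel. (\<integral>w. h (fst (snd w)) \<partial>\<pi>) = (\<integral>y. h y \<partial>\<mu>Y)) \<and>
    (\<forall>h\<in>bounded_borel. (\<integral>w. h (snd (snd w)) \<partial>\<pi>) = (\<integral>z. h z \<partial>\<mu>Z)) \<and>
    (\<forall>h\<in>bounded_borel. (\<integral>w. h (fst w) * (fst (snd w) - fst w) \<partial>\<pi>) = 0) \<and>
    (\<forall>h\<in>bounded_borel. (\<integral>w. h (fst w, fst (snd w)) * (snd (snd w) - fst (snd w)) \<partial>\<pi>) = 0)"
    if \<pi>: "prob_space \<pi>" and sets: "sets \<pi> = sets (restrict_space borel (X \<times> Y \<times> Z))"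
  proof -
    have fin: "finite_measure \<pi>" using \<pi> by (rule prob_space.finite_measure)
    have sp: "space \<pi> = X \<times> Y \<times> Z" using sets_eq_imp_space_eq[OF sets] by (simp add: space_restrict_space)
    have m: "f \<in> borel_measurable \<pi>" if "f \<in> borel_measurable borel" for f :: "real \<times> real \<times> real \<Rightarrow> 'c::topological_space"
      using measurable_restrict_space1[OF that] by (simp add: measurable_cong_sets[OF sets refl])
    have m': "f \<in> measurable \<pi> (restrict_space borel S)" if "f \<in> borel_measurable borel" "f \<in> X \<times> Y \<times> Z \<rightarrow> S"
      for f :: "real \<times> real \<times> real \<Rightarrow> real" and S
      using that by (intro measurable_restrict_space2 m) (auto simp: sp)
    have bd: "AE w in \<pi>. \<bar>fst w\<bar> \<le> B" "AE w in \<pi>. \<bar>fst (snd w)\<bar> \<le> C" "AE w in \<pi>. \<bar>snd (snd w)\<bar> \<le> D"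
      using B C D by (auto intro!: AE_I2 simp: sp)
    have "distr \<pi> (restrict_space borel X) (\<lambda>w. fst w) = \<mu>X \<longleftrightarrow> (\<forall>h\<in>bounded_borel. (\<integral>w. h (fst w) \<partial>\<pi>) = (\<integral>x. h x \<partial>\<mu>X))"
      by (rule distr_restrict_eq_iff[OF fin m' \<mu>'(1,4)]) auto
    moreover have "distr \<pi> (restrict_space borel Y) (\<lambda>w. fst (snd w)) = \<mu>Y \<longleftrightarrow> (\<forall>h\<in>bounded_borel. (\<integral>w. h (fst (snd w)) \<partial>\<pi>) = (\<integral>x. h x \<partial>\<mu>Y))"
      by (rule distr_restrict_eq_iff[OF fin m' \<mu>'(2,5)]) auto
    moreover have "distr \<pi> (restrict_space borel Z) (\<lambda>w. snd (snd w)) = \<mu>Z \<longleftrightarrow> (\<forall>h\<in>bounded_borel. (\<integral>w. h (snd (snd w)) \<partial>\<pi>) = (\<integral>x. h x \<partial>\<mu>Z))"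
      by (rule distr_restrict_eq_iff[OF fin m' \<mu>'(3,6)]) auto
    \<comment> \<open>Each target is written as a function \<open>G\<close> of the conditioning
      element: the identity here, \<open>snd\<close> of the pair \<open>(x, y)\<close> in the next
      claim.\<close>
    moreover have "(AE w in \<pi>. cond_mean \<pi> (\<lambda>w. fst (snd w)) (\<lambda>w. fst w) w = (\<lambda>x. x) (fst w)) \<longleftrightarrow>
        (\<forall>h\<in>bounded_borel. (\<integral>w. h (fst w) * (fst (snd w) - (\<lambda>x. x) (fst w)) \<partial>\<pi>) = 0)"
      by (rule cond_mean_eq_iff[OF fin, where B=C and C=B]) (auto intro!: m bd)
    moreover have "(AE w in \<pi>. cond_mean \<pi> (\<lambda>w. snd (snd w)) (\<lambda>w. (fst w, fst (snd w))) w = snd (fst w, fst (snd w))) \<longleftrightarrow>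
        (\<forall>h\<in>bounded_borel. (\<integral>w. h (fst w, fst (snd w)) * (snd (snd w) - snd (fst w, fst (snd w))) \<partial>\<pi>) = 0)"
      by (rule cond_mean_eq_iff[OF fin, where B=D and C=C]) (use bd in \<open>auto intro!: m\<close>)
    ultimately show ?thesis by (simp only: snd_conv)
  qed
  show ?thesis
    unfolding martingale_couplings_def proj mem_Collect_eq probs using main by blast
qed

section \<open>Passage between couplings and pairs of slices\<close>

definition slice_of :: "(real \<times> real \<times> real) measure \<Rightarrow> real \<Rightarrow> (real \<times> real) measure" where
  "slice_of \<pi> y = distr (density \<pi> (\<lambda>w. indicator {y} (fst (snd w)))) borel (\<lambda>w. (fst w, snd (snd w)))"

lemma
  assumes \<pi>: "prob_space \<pi>" "sets \<pi> = sets (restrict_space borel (X \<times> Y \<times> Z))"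
  shows finite_measure_slice_of: "finite_measure (slice_of \<pi> y)"
    and sets_slice_of: "sets (slice_of \<pi> y) = sets borel"
    and integral_slice_of: "\<And>f :: real \<times> real \<Rightarrow> real. f \<in> borel_measurable borel \<Longrightarrow>
      (\<integral>w. f w \<partial>slice_of \<pi> y) = (\<integral>w. indicator {y} (fst (snd w)) * f (fst w, snd (snd w)) \<partial>\<pi>)"
    and AE_slice_of: "closed X \<Longrightarrow> closed Z \<Longrightarrow> AE w in slice_of \<pi> y. fst w \<in> X \<and> snd w \<in> Z"
proof -
  interpret prob_space \<pi> by fact
  have sp: "space \<pi> = X \<times> Y \<times> Z" using sets_eq_imp_space_eq[OF \<pi>(2)] by (simp add: space_restrict_space)
  have m: "f \<in> borel_measurable \<pi>" if "f \<in> borel_measurable borel" for f :: "real \<times> real \<times> real \<Rightarrow> 'c::topological_space"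
    using measurable_restrict_space1[OF that] by (simp add: measurable_cong_sets[OF \<pi>(2) refl])
  note [measurable] = borel_measurable_triple[THEN m]
  have dens: "(\<lambda>w. indicator {y} (fst (snd w)) :: ennreal) \<in> borel_measurable \<pi>" by measurable
  have dens': "(\<lambda>w. indicator {y} (fst (snd w)) :: ennreal) = (\<lambda>w. ennreal (indicator {y} (fst (snd w))))"
    by (auto simp: indicator_def fun_eq_iff)
  have xz: "(\<lambda>w. (fst w, snd (snd w))) \<in> density \<pi> (\<lambda>w. indicator {y} (fst (snd w))) \<rightarrow>\<^sub>M (borel :: (real \<times> real) measure)"
    by measurable
  show "sets (slice_of \<pi> y) = sets borel" by (simp add: slice_of_def)
  have "emeasure (density \<pi> (\<lambda>w. indicator {y} (fst (snd w)))) (space \<pi>) =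
      (\<integral>\<^sup>+w. indicator {y} (fst (snd w)) * indicator (space \<pi>) w \<partial>\<pi>)"
    by (rule emeasure_density[OF dens]) simp
  also have "\<dots> \<le> (\<integral>\<^sup>+w. 1 \<partial>\<pi>)" by (rule nn_integral_mono) (simp add: indicator_def)
  also have "\<dots> < \<infinity>" by (simp add: emeasure_space_1)
  finally have "finite_measure (density \<pi> (\<lambda>w. indicator {y} (fst (snd w))))"
    by (intro finite_measureI) simp
  then show "finite_measure (slice_of \<pi> y)" unfolding slice_of_def by (rule finite_measure.finite_measure_distr[OF _ xz])
  show "(\<integral>w. f w \<partial>slice_of \<pi> y) = (\<integral>w. indicator {y} (fst (snd w)) * f (fst w, snd (snd w)) \<partial>\<pi>)"
    if f: "f \<in> borel_measurable borel" for f :: "real \<times> real \<Rightarrow> real"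
  proof -
    have fm: "(\<lambda>w. f (fst w, snd (snd w))) \<in> borel_measurable \<pi>"
      using measurable_compose[OF _ f, of "\<lambda>w. (fst w, snd (snd w))" \<pi>] by measurable
    have "(\<integral>w. f w \<partial>slice_of \<pi> y) = (\<integral>w. f (fst w, snd (snd w)) \<partial>density \<pi> (\<lambda>w. indicator {y} (fst (snd w))))"
      unfolding slice_of_def by (rule integral_distr[OF xz f])
    also have "\<dots> = (\<integral>w. indicator {y} (fst (snd w)) * f (fst w, snd (snd w)) \<partial>\<pi>)"
      unfolding dens' using fm by (subst integral_density) auto
    finally show ?thesis .
  qed
  show "AE w in slice_of \<pi> y. fst w \<in> X \<and> snd w \<in> Z" if XZ: "closed X" "closed Z"
  proof -
    have "X \<times> Z \<in> sets borel" using XZ by (intro borel_closed closed_Times)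
    moreover have "{w. fst w \<in> X \<and> snd w \<in> Z} = X \<times> Z" by auto
    ultimately have "{w \<in> space borel. fst w \<in> X \<and> snd w \<in> Z} \<in> sets borel" by simp
    then show ?thesis
      unfolding slice_of_def using dens
      by (subst AE_distr_iff[OF xz]) (auto simp: AE_density sp intro!: AE_I2)
  qed
qed

text \<open>Barycentric coordinate of \<open>x\<close> at \<open>y\<close> relative to the points
  \<open>y\<close> and \<open>y'\<close>: the probability of \<open>y\<close> under the law on these
  points with mean \<open>x\<close>. As an affine function it leaves \<open>[0, 1]\<close> outside
  the segment.\<close>

definition two_point_weight :: "real \<Rightarrow> real \<Rightarrow> real \<Rightarrow> real" where
  "two_point_weight y y' x = (x - y') / (y - y')"

lemma two_point_weight_add:
  "y\<^sub>1 \<noteq> y\<^sub>2 \<Longrightarrow> two_point_weight y\<^sub>1 y\<^sub>2 x + two_point_weight y\<^sub>2 y\<^sub>1 x = 1"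
  "y\<^sub>1 \<noteq> y\<^sub>2 \<Longrightarrow> y\<^sub>1 * two_point_weight y\<^sub>1 y\<^sub>2 x + y\<^sub>2 * two_point_weight y\<^sub>2 y\<^sub>1 x = x"
proof -
  assume "y\<^sub>1 \<noteq> y\<^sub>2"
  then have *: "two_point_weight y\<^sub>1 y\<^sub>2 x = (x - y\<^sub>2) / (y\<^sub>1 - y\<^sub>2)" "two_point_weight y\<^sub>2 y\<^sub>1 x = (y\<^sub>1 - x) / (y\<^sub>1 - y\<^sub>2)"
    by (simp_all add: two_point_weight_def divide_simps) (simp add: algebra_simps)
  show "two_point_weight y\<^sub>1 y\<^sub>2 x + two_point_weight y\<^sub>2 y\<^sub>1 x = 1"
    unfolding * using \<open>y\<^sub>1 \<noteq> y\<^sub>2\<close> by (simp add: add_divide_distrib[symmetric])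
  have "y\<^sub>1 * ((x - y\<^sub>2) / (y\<^sub>1 - y\<^sub>2)) + y\<^sub>2 * ((y\<^sub>1 - x) / (y\<^sub>1 - y\<^sub>2)) = (x * (y\<^sub>1 - y\<^sub>2)) / (y\<^sub>1 - y\<^sub>2)"
    by (simp add: add_divide_distrib[symmetric] algebra_simps)
  then show "y\<^sub>1 * two_point_weight y\<^sub>1 y\<^sub>2 x + y\<^sub>2 * two_point_weight y\<^sub>2 y\<^sub>1 x = x"
    unfolding * using \<open>y\<^sub>1 \<noteq> y\<^sub>2\<close> by simp
qed

lemma integral_two_points:
  fixes F :: "real \<Rightarrow> real"
  assumes \<mu>: "sets \<mu> = sets (restrict_space borel Y)" and y: "y\<^sub>1 \<in> Y" "y\<^sub>2 \<in> Y" and a: "0 < a\<^sub>1" "0 < a\<^sub>2"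
    and eq: "\<And>A. A \<in> sets \<mu> \<Longrightarrow> emeasure \<mu> A =
          ennreal a\<^sub>1 * emeasure (return \<mu> y\<^sub>1) A + ennreal a\<^sub>2 * emeasure (return \<mu> y\<^sub>2) A"
    and F: "F \<in> borel_measurable borel"
  shows "(\<integral>y. F y \<partial>\<mu>) = a\<^sub>1 * F y\<^sub>1 + a\<^sub>2 * F y\<^sub>2"
proof -
  have sp: "space \<mu> = Y" using sets_eq_imp_space_eq[OF \<mu>] by (simp add: space_restrict_space)
  have Fm: "F \<in> borel_measurable \<mu>" using measurable_restrict_space1[OF F] by (simp add: measurable_cong_sets[OF \<mu> refl])
  define M where "M a y = density (return \<mu> y) (\<lambda>_. ennreal a)" for a y
  have M: "sets (M a y) = sets \<mu>" "emeasure (M a y) A = ennreal a * emeasure (return \<mu> y) A" if "A \<in> sets \<mu>" for a y A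
    using that by (auto simp: M_def emeasure_density_const)
  have sM: "sets (M a y) = sets \<mu>" for a y by (simp add: M_def)
  have "\<mu> = add_measure (M a\<^sub>1 y\<^sub>1) (M a\<^sub>2 y\<^sub>2)"
    by (rule measure_eqI) (simp_all add: sM emeasure_add_measure M eq)
  then have "(\<integral>y. F y \<partial>\<mu>) = (\<integral>y. F y \<partial>add_measure (M a\<^sub>1 y\<^sub>1) (M a\<^sub>2 y\<^sub>2))"
    by (rule arg_cong[where f="\<lambda>\<nu>. integral\<^sup>L \<nu> F"])
  moreover have int: "integrable (M a y) F \<and> (\<integral>x. F x \<partial>M a y) = a * F y" if "0 < a" "y \<in> Y" for a y
  proof -
    interpret prob_space "return \<mu> y" using that sp by (intro prob_space_return) simp
    have "AE x in return \<mu> y. norm (F x) \<le> \<bar>F y\<bar>"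
      using that Fm sp by (subst AE_return) auto
    then have "integrable (return \<mu> y) F" using Fm by (intro integrable_const_bound) auto
    moreover have "(\<integral>x. F x \<partial>return \<mu> y) = F y" using that sp Fm by (intro integral_return) auto
    ultimately show ?thesis using that(1) Fm by (simp add: M_def integral_density integrable_density)
  qed
  moreover have "(\<integral>y. F y \<partial>add_measure (M a\<^sub>1 y\<^sub>1) (M a\<^sub>2 y\<^sub>2)) = (\<integral>y. F y \<partial>M a\<^sub>1 y\<^sub>1) + (\<integral>y. F y \<partial>M a\<^sub>2 y\<^sub>2)"
    using int y a by (intro integral_add_measure) (simp_all add: sM)
  ultimately show ?thesis using y a by simp
qed

text \<open>Of the convex order only the mean of \<open>\<mu>X\<close> is recorded here; the mean of
  \<open>\<mu>Z\<close> and the position of \<open>\<mu>X\<close> between the two atoms enter later,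
  when a feasible pair is built.\<close>

locale two_point_coupling =
  fixes X Y Z :: "real set" and \<mu>X \<mu>Y \<mu>Z :: "real measure" and y\<^sub>1 y\<^sub>2 a\<^sub>1 a\<^sub>2 :: real
  assumes XYZ: "compact X" "compact Y" "compact Z"
    and \<mu>: "\<mu>X \<in> borel_probs X" "\<mu>Y \<in> borel_probs Y" "\<mu>Z \<in> borel_probs Z"
    and y: "y\<^sub>1 \<in> Y" "y\<^sub>2 \<in> Y" "y\<^sub>1 < y\<^sub>2" and a: "0 < a\<^sub>1" "0 < a\<^sub>2"
    and muY: "\<And>A. A \<in> sets \<mu>Y \<Longrightarrow> emeasure \<mu>Y A =
          ennreal a\<^sub>1 * emeasure (return \<mu>Y y\<^sub>1) A + ennreal a\<^sub>2 * emeasure (return \<mu>Y y\<^sub>2) A"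
    and mean_X: "(\<integral>x. x \<partial>\<mu>X) = a\<^sub>1 * y\<^sub>1 + a\<^sub>2 * y\<^sub>2"
begin

abbreviation "couplings \<equiv> martingale_couplings X Y Z \<mu>X \<mu>Y \<mu>Z"
abbreviation "p\<^sub>1 \<equiv> two_point_weight y\<^sub>1 y\<^sub>2"
abbreviation "p\<^sub>2 \<equiv> two_point_weight y\<^sub>2 y\<^sub>1"
abbreviation "slices \<equiv> slice_pair X Z \<mu>X \<mu>Z p\<^sub>1 p\<^sub>2 y\<^sub>1 y\<^sub>2"

lemma marginal:
  "prob_space \<mu>X" "prob_space \<mu>Y" "prob_space \<mu>Z" "sets \<mu>X = sets (restrict_space borel X)"
  "sets \<mu>Y = sets (restrict_space borel Y)" "sets \<mu>Z = sets (restrict_space borel Z)"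
  "space \<mu>X = X" "space \<mu>Y = Y" "space \<mu>Z = Z"
proof -
  show "prob_space \<mu>X" "prob_space \<mu>Y" "prob_space \<mu>Z" and s: "sets \<mu>X = sets (restrict_space borel X)"
    "sets \<mu>Y = sets (restrict_space borel Y)" "sets \<mu>Z = sets (restrict_space borel Z)"
    using \<mu> by (auto simp: borel_probs_def space_prob_algebra)
  show "space \<mu>X = X" "space \<mu>Y = Y" "space \<mu>Z = Z"
    using s[THEN sets_eq_imp_space_eq] by (simp_all add: space_restrict_space)
qed

lemmas couplings_iff = martingale_couplings_iff[OF XYZ \<mu>]

lemma integral_\<mu>Y:
  fixes F :: "real \<Rightarrow> real" assumes "F \<in> borel_measurable borel"
  shows "(\<integral>y. F y \<partial>\<mu>Y) = a\<^sub>1 * F y\<^sub>1 + a\<^sub>2 * F y\<^sub>2"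
  by (rule integral_two_points[OF marginal(5) y(1,2) a muY assms])

lemma weights_sum: "a\<^sub>1 + a\<^sub>2 = 1"
proof -
  interpret prob_space \<mu>Y by (rule marginal)
  show ?thesis using integral_\<mu>Y[of "\<lambda>_. 1"] prob_space by simp
qed

lemma measurable_\<mu>X: "h \<in> borel_measurable borel \<Longrightarrow> h \<in> borel_measurable \<mu>X" for h :: "real \<Rightarrow> real"
  using measurable_restrict_space1 by (simp add: measurable_cong_sets[OF marginal(4) refl])

lemma bounds:
  obtains B where "0 < B" "\<forall>x\<in>X \<union> Y \<union> Z. \<bar>x\<bar> \<le> B"
proof -
  have "bounded (X \<union> Y \<union> Z)" using XYZ compact_imp_bounded by auto
  then obtain B where "0 < B" "\<forall>x\<in>X \<union> Y \<union> Z. norm x \<le> B" unfolding bounded_pos by blast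
  then show ?thesis by (intro that) auto
qed

lemma integrable_\<mu>X:
  assumes "h \<in> bounded_borel" shows "integrable \<mu>X (\<lambda>x. h x * (r * x + s))"
proof -
  interpret prob_space \<mu>X by (rule marginal)
  obtain B where "0 < B" "\<forall>x\<in>X \<union> Y \<union> Z. \<bar>x\<bar> \<le> B" by (rule bounds)
  then have B: "\<And>x. x \<in> X \<Longrightarrow> \<bar>x\<bar> \<le> B" by auto
  obtain C where C: "0 \<le> C" "\<And>x. \<bar>h x\<bar> \<le> C" using bounded_borel_bound[OF assms] by blast
  show ?thesis
  proof (rule integrable_const_bound)
    show "AE x in \<mu>X. norm (h x * (r * x + s)) \<le> C * (\<bar>r\<bar> * B + \<bar>s\<bar>)"
    proof (rule AE_I2)
      fix x assume "x \<in> space \<mu>X"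
      then have "\<bar>x\<bar> \<le> B" using B marginal by simp
      then have "\<bar>r\<bar> * \<bar>x\<bar> \<le> \<bar>r\<bar> * B" by (intro mult_left_mono) auto
      then have "\<bar>r * x + s\<bar> \<le> \<bar>r\<bar> * B + \<bar>s\<bar>"
        using abs_triangle_ineq[of "r * x" s] by (simp add: abs_mult)
      then show "norm (h x * (r * x + s)) \<le> C * (\<bar>r\<bar> * B + \<bar>s\<bar>)"
        using C by (auto simp: abs_mult intro!: mult_mono)
    qed
    show "(\<lambda>x. h x * (r * x + s)) \<in> borel_measurable \<mu>X"
      using bounded_borel_measurable[OF assms] by (intro measurable_\<mu>X) simp
  qed
qed

lemma integrable_weight:
  assumes "h \<in> bounded_borel" shows "integrable \<mu>X (\<lambda>x. h x * two_point_weight u v x)"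
proof -
  have "two_point_weight u v x = (1 / (u - v)) * x + (- v / (u - v))" for x
    by (simp add: two_point_weight_def diff_divide_distrib)
  then show ?thesis using integrable_\<mu>X[OF assms] by presburger
qed

text \<open>The weight is affine, so its integral is its value at the mean of \<open>\<mu>X\<close>.
  This mean is the barycentre of the atoms, with their masses as coordinates.\<close>

lemma integral_weights: "(\<integral>x. p\<^sub>1 x \<partial>\<mu>X) = a\<^sub>1" "(\<integral>x. p\<^sub>2 x \<partial>\<mu>X) = a\<^sub>2"
proof -
  interpret prob_space \<mu>X by (rule marginal)
  have i: "integrable \<mu>X (\<lambda>x. x)" using integrable_\<mu>X[OF bounded_borel_const[of 1], of 1 0] by simp
  have "(\<integral>x. two_point_weight u v x \<partial>\<mu>X) = (a\<^sub>1 * y\<^sub>1 + a\<^sub>2 * y\<^sub>2 - v) / (u - v)" for u v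
    unfolding two_point_weight_def using i by (simp add: mean_X prob_space)
  moreover have "a\<^sub>1 * y\<^sub>1 + a\<^sub>2 * y\<^sub>2 - y\<^sub>2 = a\<^sub>1 * (y\<^sub>1 - y\<^sub>2)" "a\<^sub>1 * y\<^sub>1 + a\<^sub>2 * y\<^sub>2 - y\<^sub>1 = a\<^sub>2 * (y\<^sub>2 - y\<^sub>1)"
  proof -
    have a1: "a\<^sub>1 = 1 - a\<^sub>2" using weights_sum by simp
    show "a\<^sub>1 * y\<^sub>1 + a\<^sub>2 * y\<^sub>2 - y\<^sub>2 = a\<^sub>1 * (y\<^sub>1 - y\<^sub>2)" "a\<^sub>1 * y\<^sub>1 + a\<^sub>2 * y\<^sub>2 - y\<^sub>1 = a\<^sub>2 * (y\<^sub>2 - y\<^sub>1)"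
      unfolding a1 by (simp_all add: algebra_simps)
  qed
  ultimately show "(\<integral>x. p\<^sub>1 x \<partial>\<mu>X) = a\<^sub>1" "(\<integral>x. p\<^sub>2 x \<partial>\<mu>X) = a\<^sub>2" using y(3) by simp_all
qed

context
  fixes \<pi> assumes \<pi>: "\<pi> \<in> couplings"
begin

lemma coupling_facts:
  "prob_space \<pi>" "sets \<pi> = sets (restrict_space borel (X \<times> Y \<times> Z))"
  "\<And>h. h \<in> bounded_borel \<Longrightarrow> (\<integral>w. h (fst w) \<partial>\<pi>) = (\<integral>x. h x \<partial>\<mu>X)"
  "\<And>h. h \<in> bounded_borel \<Longrightarrow> (\<integral>w. h (fst (snd w)) \<partial>\<pi>) = (\<integral>y. h y \<partial>\<mu>Y)"
  "\<And>h. h \<in> bounded_borel \<Longrightarrow> (\<integral>w. h (snd (snd w)) \<partial>\<pi>) = (\<integral>z. h z \<partial>\<mu>Z)"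
  "\<And>h. h \<in> bounded_borel \<Longrightarrow> (\<integral>w. h (fst w) * (fst (snd w) - fst w) \<partial>\<pi>) = 0"
  "\<And>h. h \<in> bounded_borel \<Longrightarrow> (\<integral>w. h (fst w, fst (snd w)) * (snd (snd w) - fst (snd w)) \<partial>\<pi>) = 0"
  using \<pi> unfolding couplings_iff by auto

lemma coupling_measurable: "f \<in> borel_measurable borel \<Longrightarrow> f \<in> borel_measurable \<pi>" for f :: "real \<times> real \<times> real \<Rightarrow> real"
  using measurable_restrict_space1 by (simp add: measurable_cong_sets[OF coupling_facts(2) refl])

lemma coupling_space: "space \<pi> = X \<times> Y \<times> Z"
  using sets_eq_imp_space_eq[OF coupling_facts(2)] by (simp add: space_restrict_space)

lemma coupling_integrable:
  fixes f :: "real \<times> real \<times> real \<Rightarrow> real"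
  assumes "f \<in> borel_measurable borel" "\<And>x y z. x \<in> X \<Longrightarrow> y \<in> Y \<Longrightarrow> z \<in> Z \<Longrightarrow> \<bar>f (x, y, z)\<bar> \<le> C"
  shows "integrable \<pi> f"
proof (rule finite_measure.integrable_const_bound[OF prob_space.finite_measure[OF coupling_facts(1)]])
  show "AE w in \<pi>. norm (f w) \<le> C"
  proof (rule AE_I2)
    fix w assume "w \<in> space \<pi>"
    then obtain x y z where "w = (x, y, z)" "x \<in> X" "y \<in> Y" "z \<in> Z" by (auto simp: coupling_space)
    then show "norm (f w) \<le> C" by (simp add: assms(2))
  qed
qed (rule coupling_measurable[OF assms(1)])

lemma coupling_two_points: "AE w in \<pi>. fst (snd w) = y\<^sub>1 \<or> fst (snd w) = y\<^sub>2"
proof -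
  define f :: "real \<times> real \<times> real \<Rightarrow> real" where "f w = indicator (- {y\<^sub>1, y\<^sub>2}) (fst (snd w))" for w
  have A: "- {y\<^sub>1, y\<^sub>2} \<in> sets borel" by simp
  have "f \<in> borel_measurable borel" unfolding f_def by measurable
  then have i: "integrable \<pi> f" by (rule coupling_integrable[where C=1]) (simp add: f_def indicator_def)
  have "(\<integral>w. f w \<partial>\<pi>) = (\<integral>y. indicator (- {y\<^sub>1, y\<^sub>2}) y \<partial>\<mu>Y)"
    unfolding f_def by (rule coupling_facts(4)[OF bounded_borel_indicator[OF A]])
  also have "\<dots> = 0" using A by (subst integral_\<mu>Y) auto
  finally have "AE w in \<pi>. f w = 0"
    using i by (subst (asm) integral_nonneg_eq_0_iff_AE) (auto simp: f_def)
  then show ?thesis by (rule eventually_mono) (auto simp: f_def indicator_def split: if_splits)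
qed

text \<open>The middle coordinate almost surely takes only the two atoms as values, so the slices
  determine the coupling; this serves uniqueness as well as the rewriting of the cost.\<close>

lemma coupling_integral:
  fixes F :: "real \<times> real \<times> real \<Rightarrow> real"
  assumes F: "F \<in> bounded_borel"
  shows "(\<integral>w. F w \<partial>\<pi>) = (\<integral>w. F (fst w, y\<^sub>1, snd w) \<partial>slice_of \<pi> y\<^sub>1) + (\<integral>w. F (fst w, y\<^sub>2, snd w) \<partial>slice_of \<pi> y\<^sub>2)"
proof -
  obtain C where C: "0 \<le> C" "\<And>w. \<bar>F w\<bar> \<le> C" using bounded_borel_bound[OF F] by blast
  have sl: "(\<integral>w. F (fst w, y, snd w) \<partial>slice_of \<pi> y) = (\<integral>w. indicator {y} (fst (snd w)) * F w \<partial>\<pi>)" for y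
  proof -
    have "(\<lambda>w :: real \<times> real. (fst w, y, snd w)) \<in> borel_measurable borel"
      by (intro borel_measurable_continuous_onI continuous_intros)
    from measurable_compose[OF this bounded_borel_measurable[OF F]]
    have "(\<integral>w. F (fst w, y, snd w) \<partial>slice_of \<pi> y) = (\<integral>w. indicator {y} (fst (snd w)) * F (fst w, y, snd (snd w)) \<partial>\<pi>)"
      by (subst integral_slice_of[OF coupling_facts(1,2)]) simp_all
    also have "\<dots> = (\<integral>w. indicator {y} (fst (snd w)) * F w \<partial>\<pi>)"
      by (intro Bochner_Integration.integral_cong) (auto simp: indicator_def)
    finally show ?thesis .
  qed
  have m: "(\<lambda>w. indicator {y} (fst (snd w)) * F w) \<in> borel_measurable borel" for y
    using bounded_borel_measurable[OF F] by measurable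
  have i: "integrable \<pi> (\<lambda>w. indicator {y} (fst (snd w)) * F w)" for y
    by (rule coupling_integrable[OF m, where C=C]) (use C in \<open>simp add: indicator_def\<close>)
  have "(\<integral>w. F w \<partial>\<pi>) = (\<integral>w. indicator {y\<^sub>1} (fst (snd w)) * F w + indicator {y\<^sub>2} (fst (snd w)) * F w \<partial>\<pi>)"
  proof (rule integral_cong_AE)
    show "AE w in \<pi>. F w = indicator {y\<^sub>1} (fst (snd w)) * F w + indicator {y\<^sub>2} (fst (snd w)) * F w"
      using coupling_two_points by (rule eventually_mono) (use y in \<open>auto simp: indicator_def\<close>)
    show "(\<lambda>w. indicator {y\<^sub>1} (fst (snd w)) * F w + indicator {y\<^sub>2} (fst (snd w)) * F w) \<in> borel_measurable \<pi>"
      using m by (intro coupling_measurable borel_measurable_add)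
  qed (rule coupling_measurable[OF bounded_borel_measurable[OF F]])
  also have "\<dots> = (\<integral>w. indicator {y\<^sub>1} (fst (snd w)) * F w \<partial>\<pi>) + (\<integral>w. indicator {y\<^sub>2} (fst (snd w)) * F w \<partial>\<pi>)"
    by (rule Bochner_Integration.integral_add[OF i i])
  finally show ?thesis by (simp add: sl)
qed

text \<open>Where \<open>y\<close> is \<open>u\<close> or \<open>v\<close>, the indicator of
  \<open>y = u\<close> equals \<open>(y - v) / (u - v)\<close>. Splitting this at \<open>x\<close>
  leaves the weight and \<open>(y - x) / (u - v)\<close>, which integrates to \<open>0\<close>
  against functions of \<open>x\<close> by the first martingale condition.\<close>

lemma slice_of_slice:
  assumes uv: "{u, v} = {y\<^sub>1, y\<^sub>2}"
  shows "slice X Z \<mu>X (two_point_weight u v) u (slice_of \<pi> u)"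
  unfolding slice_def
proof (intro conjI ballI)
  show "finite_measure (slice_of \<pi> u)" "sets (slice_of \<pi> u) = sets borel"
    by (rule finite_measure_slice_of[OF coupling_facts(1,2)] sets_slice_of[OF coupling_facts(1,2)])+
  show "AE w in slice_of \<pi> u. fst w \<in> X \<and> snd w \<in> Z"
    by (rule AE_slice_of[OF coupling_facts(1,2)]) (use XYZ in \<open>auto intro: compact_imp_closed\<close>)
  have uv': "u \<noteq> v" "u = y\<^sub>1 \<and> v = y\<^sub>2 \<or> u = y\<^sub>2 \<and> v = y\<^sub>1" using uv y by (auto simp: doubleton_eq_iff)
  obtain B where "0 < B" "\<forall>x\<in>X \<union> Y \<union> Z. \<bar>x\<bar> \<le> B" by (rule bounds)
  then have B: "0 < B" "\<And>x. x \<in> X \<Longrightarrow> \<bar>x\<bar> \<le> B" "\<And>y. y \<in> Y \<Longrightarrow> \<bar>y\<bar> \<le> B" by auto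
  fix h :: "real \<Rightarrow> real" assume h: "h \<in> bounded_borel"
  note [measurable] = bounded_borel_measurable[OF h]
  obtain C where C: "0 \<le> C" "\<And>x. \<bar>h x\<bar> \<le> C" using bounded_borel_bound[OF h] by blast
  define h' where "h' x = h x / (u - v)" for x
  have h': "h' \<in> bounded_borel" unfolding h'_def divide_inverse using h by (intro bounded_borel_intros)
  note [measurable] = bounded_borel_measurable[OF h']
  have "(\<lambda>w. h (fst w)) \<in> borel_measurable (borel :: (real \<times> real) measure)" by measurable
  then have "(\<integral>w. h (fst w) \<partial>slice_of \<pi> u) = (\<integral>w. indicator {u} (fst (snd w)) * h (fst w) \<partial>\<pi>)"
    by (simp add: integral_slice_of[OF coupling_facts(1,2)])
  also have "\<dots> = (\<integral>w. h' (fst w) * (fst (snd w) - fst w) + h (fst w) * two_point_weight u v (fst w) \<partial>\<pi>)"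
  proof (rule integral_cong_AE)
    show "AE w in \<pi>. indicator {u} (fst (snd w)) * h (fst w) = h' (fst w) * (fst (snd w) - fst w) + h (fst w) * two_point_weight u v (fst w)"
      using coupling_two_points
    proof (rule eventually_mono)
      fix w :: "real \<times> real \<times> real" assume "fst (snd w) = y\<^sub>1 \<or> fst (snd w) = y\<^sub>2"
      then have *: "fst (snd w) = u \<or> fst (snd w) = v" using uv'(2) by auto
      have "h' (fst w) * (fst (snd w) - fst w) + h (fst w) * two_point_weight u v (fst w) = h (fst w) * ((fst (snd w) - v) / (u - v))"
        unfolding h'_def two_point_weight_def times_divide_eq_left times_divide_eq_right add_divide_distrib[symmetric]
        by (simp add: algebra_simps)
      then show "indicator {u} (fst (snd w)) * h (fst w) = h' (fst w) * (fst (snd w) - fst w) + h (fst w) * two_point_weight u v (fst w)"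
        using * uv'(1) by (auto simp: indicator_def)
    qed
  qed (unfold two_point_weight_def, auto intro!: coupling_measurable)
  also have "\<dots> = (\<integral>w. h' (fst w) * (fst (snd w) - fst w) \<partial>\<pi>) + (\<integral>w. h (fst w) * two_point_weight u v (fst w) \<partial>\<pi>)"
  proof (rule Bochner_Integration.integral_add)
    obtain C' where C': "0 \<le> C'" "\<And>x. \<bar>h' x\<bar> \<le> C'" using bounded_borel_bound[OF h'] by blast
    show "integrable \<pi> (\<lambda>w. h' (fst w) * (fst (snd w) - fst w))"
    proof (rule coupling_integrable[where C="C' * (2 * B)"])
      fix x y z assume "x \<in> X" "y \<in> Y"
      then have "\<bar>y - x\<bar> \<le> 2 * B" using B(2)[of x] B(3)[of y] by linarith
      then show "\<bar>h' (fst (x, y, z)) * (fst (snd (x, y, z)) - fst (x, y, z))\<bar> \<le> C' * (2 * B)"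
        using C' by (auto simp: abs_mult intro!: mult_mono)
    qed measurable
    show "integrable \<pi> (\<lambda>w. h (fst w) * two_point_weight u v (fst w))"
    proof (rule coupling_integrable[where C="C * ((B + \<bar>v\<bar>) / \<bar>u - v\<bar>)"])
      fix x y z assume "x \<in> X"
      then have "\<bar>x - v\<bar> \<le> B + \<bar>v\<bar>" using B(2)[of x] by linarith
      then have "\<bar>two_point_weight u v x\<bar> \<le> (B + \<bar>v\<bar>) / \<bar>u - v\<bar>"
        unfolding two_point_weight_def abs_divide by (intro divide_right_mono) auto
      then show "\<bar>h (fst (x, y, z)) * two_point_weight u v (fst (x, y, z))\<bar> \<le> C * ((B + \<bar>v\<bar>) / \<bar>u - v\<bar>)"
        unfolding abs_mult fst_conv by (intro mult_mono C) simp_all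
    qed (unfold two_point_weight_def, measurable)
  qed
  also have "(\<integral>w. h' (fst w) * (fst (snd w) - fst w) \<partial>\<pi>) = 0" by (rule coupling_facts(6)[OF h'])
  also have "(\<integral>w. h (fst w) * two_point_weight u v (fst w) \<partial>\<pi>) = (\<integral>x. h x * two_point_weight u v x \<partial>\<mu>X)"
  proof -
    \<comment> \<open>The weight is unbounded on the line and is clipped in order to enter the
      marginal identity, which is tested on bounded functions.\<close>
    define g where "g x = h x * two_point_weight u v (max (- B) (min B x))" for x
    have "(\<lambda>x. max (- B) (min B x)) \<in> bounded_borel" using B(1) by (intro bounded_borelI[where B=B]) auto
    then have g: "g \<in> bounded_borel"
      unfolding g_def two_point_weight_def divide_inverse using h by (intro bounded_borel_intros)
    have clip: "max (- B) (min B x) = x" if "x \<in> X" for x using B(2)[OF that] by linarith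
    have "(\<integral>w. h (fst w) * two_point_weight u v (fst w) \<partial>\<pi>) = (\<integral>w. g (fst w) \<partial>\<pi>)"
      by (intro Bochner_Integration.integral_cong) (auto simp: g_def clip coupling_space)
    also have "\<dots> = (\<integral>x. g x \<partial>\<mu>X)" by (rule coupling_facts(3)[OF g])
    also have "\<dots> = (\<integral>x. h x * two_point_weight u v x \<partial>\<mu>X)"
      by (intro Bochner_Integration.integral_cong) (auto simp: g_def clip marginal)
    finally show ?thesis .
  qed
  finally show "(\<integral>w. h (fst w) \<partial>slice_of \<pi> u) = (\<integral>x. h x * two_point_weight u v x \<partial>\<mu>X)" by simp
  \<comment> \<open>The indicator of \<open>y = u\<close> is a function of \<open>(x, y)\<close>, so
    it can be absorbed into the test function of the second martingale condition.\<close>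
  define k where "k w = h (fst w) * indicator {u} (snd w)" for w :: "real \<times> real"
  have k: "k \<in> bounded_borel"
    unfolding k_def using h by (intro bounded_borel_mult bounded_borel_fst bounded_borel_snd[of "indicator {u}"]) auto
  have "(\<lambda>w. h (fst w) * (snd w - u)) \<in> borel_measurable (borel :: (real \<times> real) measure)" by measurable
  then have "(\<integral>w. h (fst w) * (snd w - u) \<partial>slice_of \<pi> u) = (\<integral>w. indicator {u} (fst (snd w)) * (h (fst w) * (snd (snd w) - u)) \<partial>\<pi>)"
    by (simp add: integral_slice_of[OF coupling_facts(1,2)])
  also have "\<dots> = (\<integral>w. k (fst w, fst (snd w)) * (snd (snd w) - fst (snd w)) \<partial>\<pi>)"
    by (intro Bochner_Integration.integral_cong) (auto simp: k_def indicator_def)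
  also have "\<dots> = 0" by (rule coupling_facts(7)[OF k])
  finally show "(\<integral>w. h (fst w) * (snd w - u) \<partial>slice_of \<pi> u) = 0" .
qed

lemma slices_of_coupling: "slices (slice_of \<pi> y\<^sub>1) (slice_of \<pi> y\<^sub>2)"
  unfolding slice_pair_def
proof (intro conjI ballI)
  show "slice X Z \<mu>X p\<^sub>1 y\<^sub>1 (slice_of \<pi> y\<^sub>1)" "slice X Z \<mu>X p\<^sub>2 y\<^sub>2 (slice_of \<pi> y\<^sub>2)"
    by (intro slice_of_slice; auto)+
  fix h :: "real \<Rightarrow> real" assume h: "h \<in> bounded_borel"
  have "(\<lambda>w :: real \<times> real \<times> real. h (snd (snd w))) \<in> bounded_borel"
    by (rule bounded_borel_compose[OF h]) measurable
  from coupling_integral[OF this]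
  show "(\<integral>w. h (snd w) \<partial>slice_of \<pi> y\<^sub>1) + (\<integral>w. h (snd w) \<partial>slice_of \<pi> y\<^sub>2) = (\<integral>z. h z \<partial>\<mu>Z)"
    by (simp add: coupling_facts(5)[OF h])
qed

end

lemma coupling_eqI:
  assumes \<pi>: "\<pi> \<in> couplings" "\<pi>' \<in> couplings"
    and eq: "slice_of \<pi> y\<^sub>1 = slice_of \<pi>' y\<^sub>1" "slice_of \<pi> y\<^sub>2 = slice_of \<pi>' y\<^sub>2"
  shows "\<pi> = \<pi>'"
proof (rule measure_eqI_restrict_bounded_borel)
  fix h :: "real \<times> real \<times> real \<Rightarrow> real" assume h: "h \<in> bounded_borel"
  show "(\<integral>w. h w \<partial>\<pi>) = (\<integral>w. h w \<partial>\<pi>')"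
    using coupling_integral[OF \<pi>(1) h] coupling_integral[OF \<pi>(2) h] eq by simp
qed (use coupling_facts(1,2)[OF \<pi>(1)] coupling_facts(1,2)[OF \<pi>(2)] in \<open>auto simp: prob_space.finite_measure\<close>)

lemma coupling_of_slices:
  assumes N: "slices N\<^sub>1 N\<^sub>2"
  shows "\<exists>\<pi>\<in>couplings. \<forall>F\<in>bounded_borel.
      (\<integral>w. F w \<partial>\<pi>) = (\<integral>w. F (fst w, y\<^sub>1, snd w) \<partial>N\<^sub>1) + (\<integral>w. F (fst w, y\<^sub>2, snd w) \<partial>N\<^sub>2)"
proof -
  let ?K = "X \<times> Y \<times> Z"
  let ?S = "restrict_space borel ?K"
  have sl: "slice X Z \<mu>X p\<^sub>1 y\<^sub>1 N\<^sub>1" "slice X Z \<mu>X p\<^sub>2 y\<^sub>2 N\<^sub>2" using N by (auto simp: slice_pair_def)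
  obtain B where "0 < B" "\<forall>x\<in>X \<union> Y \<union> Z. \<bar>x\<bar> \<le> B" by (rule bounds)
  then have B: "0 < B" "\<And>x. x \<in> X \<Longrightarrow> \<bar>x\<bar> \<le> B" "\<And>y. y \<in> Y \<Longrightarrow> \<bar>y\<bar> \<le> B" "\<And>z. z \<in> Z \<Longrightarrow> \<bar>z\<bar> \<le> B" by auto
  obtain x\<^sub>0 z\<^sub>0 where "x\<^sub>0 \<in> X" "z\<^sub>0 \<in> Z"
    using prob_space.not_empty[OF marginal(1)] prob_space.not_empty[OF marginal(3)] marginal by auto
  \<comment> \<open>The map must take values in \<open>X \<times> Y \<times> Z\<close> everywhere,
    so points outside \<open>X \<times> Z\<close>, a null set for the slices, are sent to a dummy
    point.\<close>
  define \<phi> where "\<phi> y w = (if w \<in> X \<times> Z then (fst w, y, snd w) else (x\<^sub>0, y, z\<^sub>0))" for y :: real and w :: "real \<times> real"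
  have \<phi>b: "\<phi> y \<in> borel \<rightarrow>\<^sub>M borel" for y
  proof -
    have "X \<times> Z \<in> sets borel" using XYZ by (intro borel_closed closed_Times compact_imp_closed)
    moreover have "(\<lambda>w :: real \<times> real. (fst w, y, snd w)) \<in> borel_measurable borel"
      by (intro borel_measurable_continuous_onI continuous_intros)
    ultimately show ?thesis unfolding \<phi>_def by (intro measurable_If) auto
  qed
  have \<phi>m: "\<phi> y \<in> measurable L ?S" if "y \<in> Y" "sets L = sets borel" for y L
    using that \<open>x\<^sub>0 \<in> X\<close> \<open>z\<^sub>0 \<in> Z\<close> \<phi>b[of y]
    by (intro measurable_restrict_space2) (auto simp: \<phi>_def measurable_cong_sets[OF that(2) refl])
  define P where "P L y = distr L ?S (\<phi> y)" for L y
  have P: "finite_measure (P L y)" "sets (P L y) = sets ?S" if "slice X Z \<mu>X p u L" "y \<in> Y" for L p u y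
    using finite_measure.finite_measure_distr[OF sliceD(1)[OF that(1)] \<phi>m[OF that(2) sliceD(2)[OF that(1)]]]
    by (simp_all add: P_def)
  have P_int: "integrable (P L y) F \<and> (\<integral>w. F w \<partial>P L y) = (\<integral>w. F (fst w, y, snd w) \<partial>L)"
    if L: "slice X Z \<mu>X p u L" and y: "y \<in> Y" and F: "F \<in> borel_measurable borel"
      and bd: "\<And>x y z. x \<in> X \<Longrightarrow> y \<in> Y \<Longrightarrow> z \<in> Z \<Longrightarrow> \<bar>F (x, y, z)\<bar> \<le> C"
    for L p u y C and F :: "real \<times> real \<times> real \<Rightarrow> real"
  proof
    have FS: "F \<in> borel_measurable ?S" by (rule measurable_restrict_space1[OF F])
    have sp: "space (P L y) = ?K" by (simp add: P_def space_restrict_space)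
    show "integrable (P L y) F"
    proof (rule finite_measure.integrable_const_bound[OF P(1)[OF L y]])
      show "AE w in P L y. norm (F w) \<le> C"
      proof (rule AE_I2)
        fix w assume "w \<in> space (P L y)"
        then obtain x y z where "w = (x, y, z)" "x \<in> X" "y \<in> Y" "z \<in> Z" by (auto simp: sp)
        then show "norm (F w) \<le> C" by (simp add: bd)
      qed
    qed (use FS in \<open>simp add: measurable_cong_sets[OF P(2)[OF L y] refl]\<close>)
    have "(\<integral>w. F w \<partial>P L y) = (\<integral>w. F (\<phi> y w) \<partial>L)"
      unfolding P_def by (rule integral_distr[OF \<phi>m[OF y sliceD(2)[OF L]] FS])
    also have "\<dots> = (\<integral>w. F (fst w, y, snd w) \<partial>L)"
    proof (rule integral_cong_AE)
      show "AE w in L. F (\<phi> y w) = F (fst w, y, snd w)"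
        using sliceD(3)[OF L] by (rule eventually_mono) (simp add: \<phi>_def mem_Times_iff)
      have "(\<lambda>w :: real \<times> real. (fst w, y, snd w)) \<in> borel_measurable borel"
        by (intro borel_measurable_continuous_onI continuous_intros)
      from measurable_compose[OF this F] show "(\<lambda>w. F (fst w, y, snd w)) \<in> borel_measurable L"
        by (simp add: measurable_cong_sets[OF sliceD(2)[OF L] refl])
      from measurable_compose[OF \<phi>b F] show "(\<lambda>w. F (\<phi> y w)) \<in> borel_measurable L"
        by (simp add: measurable_cong_sets[OF sliceD(2)[OF L] refl])
    qed
    finally show "(\<integral>w. F w \<partial>P L y) = (\<integral>w. F (fst w, y, snd w) \<partial>L)" .
  qed
  define \<pi> where "\<pi> = add_measure (P N\<^sub>1 y\<^sub>1) (P N\<^sub>2 y\<^sub>2)"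
  have int: "(\<integral>w. F w \<partial>\<pi>) = (\<integral>w. F (fst w, y\<^sub>1, snd w) \<partial>N\<^sub>1) + (\<integral>w. F (fst w, y\<^sub>2, snd w) \<partial>N\<^sub>2)"
    if F: "F \<in> borel_measurable borel" "\<And>x y z. x \<in> X \<Longrightarrow> y \<in> Y \<Longrightarrow> z \<in> Z \<Longrightarrow> \<bar>F (x, y, z)\<bar> \<le> C"
    for F :: "real \<times> real \<times> real \<Rightarrow> real" and C
    unfolding \<pi>_def using P_int[OF sl(1) y(1) F] P_int[OF sl(2) y(2) F]
    by (subst integral_add_measure) (auto simp: P_def)
  have intb: "(\<integral>w. F w \<partial>\<pi>) = (\<integral>w. F (fst w, y\<^sub>1, snd w) \<partial>N\<^sub>1) + (\<integral>w. F (fst w, y\<^sub>2, snd w) \<partial>N\<^sub>2)"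
    if F: "F \<in> bounded_borel" for F :: "real \<times> real \<times> real \<Rightarrow> real"
  proof -
    obtain C where "\<And>w. \<bar>F w\<bar> \<le> C" using bounded_borel_bound[OF F] by blast
    then show ?thesis using int[OF bounded_borel_measurable[OF F], of C] by blast
  qed
  have sets: "sets \<pi> = sets ?S" by (simp add: \<pi>_def P_def)
  have fin: "finite_measure \<pi>"
    unfolding \<pi>_def using P(1)[OF sl(1) y(1)] P(1)[OF sl(2) y(2)] by (intro finite_measure_add_measure) (simp_all add: P_def)
  have zN: "(\<integral>w. h (snd w) \<partial>N\<^sub>1) + (\<integral>w. h (snd w) \<partial>N\<^sub>2) = (\<integral>z. h z \<partial>\<mu>Z)" if "h \<in> bounded_borel" for h
    using N that by (simp add: slice_pair_def)
  have xN: "(\<integral>w. h (fst w) \<partial>N\<^sub>1) = (\<integral>x. h x * p\<^sub>1 x \<partial>\<mu>X)" "(\<integral>w. h (fst w) \<partial>N\<^sub>2) = (\<integral>x. h x * p\<^sub>2 x \<partial>\<mu>X)"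
    if "h \<in> bounded_borel" for h using sliceD(4)[OF sl(1) that] sliceD(4)[OF sl(2) that] .
  have prob: "prob_space \<pi>"
  proof
    interpret Z: prob_space \<mu>Z by (rule marginal)
    have "(\<integral>w. 1 \<partial>\<pi>) = (1::real)"
      using intb[OF bounded_borel_const[of 1]] zN[OF bounded_borel_const[of 1]] Z.prob_space by simp
    then have "measure \<pi> (space \<pi>) = 1" by simp
    then show "emeasure \<pi> (space \<pi>) = 1" by (simp add: finite_measure.emeasure_eq_measure[OF fin])
  qed
  have "\<pi> \<in> couplings"
    unfolding couplings_iff
  proof (intro conjI ballI prob sets)
    fix h :: "real \<Rightarrow> real" assume h: "h \<in> bounded_borel"
    note [measurable] = bounded_borel_measurable[OF h]
    obtain C where C: "0 \<le> C" "\<And>x. \<bar>h x\<bar> \<le> C" using bounded_borel_bound[OF h] by blast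
    have b: "(\<lambda>w :: real \<times> real \<times> real. h (fst w)) \<in> bounded_borel" "(\<lambda>w :: real \<times> real \<times> real. h (fst (snd w))) \<in> bounded_borel"
      "(\<lambda>w :: real \<times> real \<times> real. h (snd (snd w))) \<in> bounded_borel"
      by (rule bounded_borel_compose[OF h], measurable)+
    note ip = integrable_weight[OF h]
    have "(\<integral>w. h (fst w) \<partial>\<pi>) = (\<integral>x. h x * p\<^sub>1 x \<partial>\<mu>X) + (\<integral>x. h x * p\<^sub>2 x \<partial>\<mu>X)"
      using intb[OF b(1)] by (simp add: xN[OF h])
    also have "\<dots> = (\<integral>x. h x * p\<^sub>1 x + h x * p\<^sub>2 x \<partial>\<mu>X)" by (rule Bochner_Integration.integral_add[symmetric, OF ip ip])
    also have "\<dots> = (\<integral>x. h x \<partial>\<mu>X)" using two_point_weight_add(1)[of y\<^sub>1 y\<^sub>2] y(3) by (simp add: distrib_left[symmetric])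
    finally show "(\<integral>w. h (fst w) \<partial>\<pi>) = (\<integral>x. h x \<partial>\<mu>X)" .
    have mass: "measure N\<^sub>1 UNIV = a\<^sub>1" "measure N\<^sub>2 UNIV = a\<^sub>2" "space N\<^sub>1 = UNIV" "space N\<^sub>2 = UNIV"
      using slice_mass[OF sl(1)] slice_mass[OF sl(2)] integral_weights
        sets_eq_imp_space_eq[OF sliceD(2)[OF sl(1)]] sets_eq_imp_space_eq[OF sliceD(2)[OF sl(2)]] by simp_all
    show "(\<integral>w. h (fst (snd w)) \<partial>\<pi>) = (\<integral>y. h y \<partial>\<mu>Y)"
      using intb[OF b(2)] integral_\<mu>Y[of h] by (simp add: mass)
    show "(\<integral>w. h (snd (snd w)) \<partial>\<pi>) = (\<integral>z. h z \<partial>\<mu>Z)"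
      using intb[OF b(3)] zN[OF h] by simp
    define \<zeta> where "\<zeta> x = max (- B) (min B x)" for x
    have \<zeta>: "\<zeta> \<in> bounded_borel" unfolding \<zeta>_def using B(1) by (intro bounded_borelI[where B=B]) auto
    note [measurable] = bounded_borel_measurable[OF \<zeta>]
    have \<zeta>_eq: "\<zeta> x = x" if "x \<in> X" for x using B(2)[OF that] by (simp add: \<zeta>_def)
    have g: "(\<lambda>x. h x * (u - \<zeta> x)) \<in> bounded_borel" for u using h \<zeta> by (intro bounded_borel_intros)
    have "(\<integral>w. h (fst w) * (fst (snd w) - fst w) \<partial>\<pi>) = (\<integral>w. h (fst w) * (fst (snd w) - \<zeta> (fst w)) \<partial>\<pi>)"
      using sets_eq_imp_space_eq[OF sets] by (intro Bochner_Integration.integral_cong) (auto simp: \<zeta>_eq space_restrict_space)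
    also have "\<dots> = (\<integral>w. h (fst w) * (y\<^sub>1 - \<zeta> (fst w)) \<partial>N\<^sub>1) + (\<integral>w. h (fst w) * (y\<^sub>2 - \<zeta> (fst w)) \<partial>N\<^sub>2)"
    proof (subst int[where C="C * (2 * B)"])
      fix x y z assume *: "x \<in> X" "y \<in> Y"
      then have "\<bar>y - x\<bar> \<le> 2 * B" using B(2)[of x] B(3)[of y] by linarith
      then show "\<bar>h (fst (x, y, z)) * (fst (snd (x, y, z)) - \<zeta> (fst (x, y, z)))\<bar> \<le> C * (2 * B)"
        using C * by (auto simp: abs_mult \<zeta>_eq intro!: mult_mono)
    qed simp_all
    also have "\<dots> = (\<integral>x. (h x * (y\<^sub>1 - \<zeta> x)) * p\<^sub>1 x \<partial>\<mu>X) + (\<integral>x. (h x * (y\<^sub>2 - \<zeta> x)) * p\<^sub>2 x \<partial>\<mu>X)"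
      using xN[OF g] by simp
    also have "\<dots> = (\<integral>x. (h x * (y\<^sub>1 - \<zeta> x)) * p\<^sub>1 x + (h x * (y\<^sub>2 - \<zeta> x)) * p\<^sub>2 x \<partial>\<mu>X)"
      by (rule Bochner_Integration.integral_add[symmetric, OF integrable_weight[OF g] integrable_weight[OF g]])
    \<comment> \<open>The integrand vanishes pointwise on \<open>X\<close>: the two weights sum to
      \<open>1\<close> and have mean \<open>x\<close>.\<close>
    also have "\<dots> = (\<integral>x. 0 \<partial>\<mu>X)"
    proof (rule Bochner_Integration.integral_cong)
      fix x assume "x \<in> space \<mu>X"
      then have x: "\<zeta> x = x" by (simp add: \<zeta>_eq marginal)
      have "(h x * (y\<^sub>1 - x)) * p\<^sub>1 x + (h x * (y\<^sub>2 - x)) * p\<^sub>2 x = h x * ((y\<^sub>1 * p\<^sub>1 x + y\<^sub>2 * p\<^sub>2 x) - x * (p\<^sub>1 x + p\<^sub>2 x))"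
        by (simp add: algebra_simps)
      also have "\<dots> = 0" using two_point_weight_add[of y\<^sub>1 y\<^sub>2] y(3) by simp
      finally show "(h x * (y\<^sub>1 - \<zeta> x)) * p\<^sub>1 x + (h x * (y\<^sub>2 - \<zeta> x)) * p\<^sub>2 x = 0" unfolding x .
    qed simp
    finally show "(\<integral>w. h (fst w) * (fst (snd w) - fst w) \<partial>\<pi>) = 0" by simp
  next
    fix h :: "real \<times> real \<Rightarrow> real" assume h: "h \<in> bounded_borel"
    obtain C where C: "0 \<le> C" "\<And>x. \<bar>h x\<bar> \<le> C" using bounded_borel_bound[OF h] by blast
    have hm: "(\<lambda>w :: real \<times> real \<times> real. h (fst w, fst (snd w))) \<in> borel_measurable borel"
      by (rule measurable_compose[OF borel_measurable_triple(4) bounded_borel_measurable[OF h]])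
    have hy: "(\<lambda>x. h (x, u)) \<in> bounded_borel" for u by (rule bounded_borel_pair[OF h]) auto
    have "(\<integral>w. h (fst w, fst (snd w)) * (snd (snd w) - fst (snd w)) \<partial>\<pi>)
        = (\<integral>w. h (fst w, y\<^sub>1) * (snd w - y\<^sub>1) \<partial>N\<^sub>1) + (\<integral>w. h (fst w, y\<^sub>2) * (snd w - y\<^sub>2) \<partial>N\<^sub>2)"
    proof (subst int[where C="C * (2 * B)"])
      fix x y z assume "y \<in> Y" "z \<in> Z"
      then have "\<bar>z - y\<bar> \<le> 2 * B" using B(3)[of y] B(4)[of z] by linarith
      then show "\<bar>h (fst (x, y, z), fst (snd (x, y, z))) * (snd (snd (x, y, z)) - fst (snd (x, y, z)))\<bar> \<le> C * (2 * B)"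
        using C by (auto simp: abs_mult intro!: mult_mono)
    qed (use hm in simp_all)
    also have "\<dots> = 0" using sliceD(5)[OF sl(1) hy] sliceD(5)[OF sl(2) hy] by simp
    finally show "(\<integral>w. h (fst w, fst (snd w)) * (snd (snd w) - fst (snd w)) \<partial>\<pi>) = 0" .
  qed
  then show ?thesis using intb by blast
qed

end

section \<open>An explicit feasible pair of slices\<close>

context two_point_coupling
begin

text \<open>Given the middle value \<open>u\<close>, let \<open>x\<close> and \<open>z\<close> be
  independent, with a density of \<open>z\<close> relative to \<open>\<mu>Z\<close> that is constant
  on each component of \<open>Z\<close>. Two constants match the two conditions mass
  \<open>1\<close> and mean \<open>u\<close>, and they are nonnegative because \<open>u\<close> lies
  in the gap. This explicit coupling replaces an appeal to Strassen's theorem.\<close>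

lemma weight_slices_exist:
  assumes Z: "Z = {zl_minus..zu_minus} \<union> {zl_plus..zu_plus}" and gap: "zu_minus < y\<^sub>1" "y\<^sub>2 < zl_plus"
    and mean_Z: "(\<integral>z. z \<partial>\<mu>Z) = a\<^sub>1 * y\<^sub>1 + a\<^sub>2 * y\<^sub>2"
    and between: "AE x in \<mu>X. y\<^sub>1 \<le> x \<and> x \<le> y\<^sub>2"
  shows "\<exists>N\<^sub>1 N\<^sub>2. slices N\<^sub>1 N\<^sub>2"
proof -
  interpret \<mu>X: prob_space \<mu>X by (rule marginal)
  interpret \<mu>Z: prob_space \<mu>Z by (rule marginal)
  define A where "A = distr \<mu>X borel (\<lambda>x. x)"
  define D where "D = distr \<mu>Z borel (\<lambda>z. z)"
  have idX: "(\<lambda>x. x) \<in> borel_measurable \<mu>X" and idZ: "(\<lambda>x. x) \<in> borel_measurable \<mu>Z"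
    using measurable_restrict_space1[of "\<lambda>x. x" borel borel]
    by (simp_all add: measurable_cong_sets[OF marginal(4) refl] measurable_cong_sets[OF marginal(6) refl])
  interpret A: prob_space A unfolding A_def by (rule \<mu>X.prob_space_distr[OF idX])
  interpret D: prob_space D unfolding D_def by (rule \<mu>Z.prob_space_distr[OF idZ])
  interpret P: pair_prob_space A D ..
  define Q where "Q = A \<Otimes>\<^sub>M D"
  have "sets Q = sets (borel \<Otimes>\<^sub>M borel :: (real \<times> real) measure)"
    unfolding Q_def by (rule sets_pair_measure_cong) (simp_all add: A_def D_def)
  then have Q: "finite_measure Q" "sets Q = sets borel"
    unfolding borel_prod by (simp_all add: Q_def P.finite_measure_axioms)
  have intA: "(\<integral>x. h x \<partial>A) = (\<integral>x. h x \<partial>\<mu>X)" and intD: "(\<integral>x. h x \<partial>D) = (\<integral>x. h x \<partial>\<mu>Z)" if "h \<in> bounded_borel" for h :: "real \<Rightarrow> real"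
    unfolding A_def D_def by (rule integral_distr[OF idX bounded_borel_measurable[OF that]] integral_distr[OF idZ bounded_borel_measurable[OF that]])+
  have Qfst: "(\<integral>w. h (fst w) \<partial>Q) = (\<integral>x. h x \<partial>\<mu>X)" if h: "h \<in> bounded_borel" for h
    using P.integral_fst'[of "\<lambda>w. h (fst w)"] integrable_bounded_borel[OF Q bounded_borel_fst[OF h]]
    by (simp add: Q_def D.prob_space intA[OF h])
  have Qsnd: "(\<integral>w. h (snd w) \<partial>Q) = (\<integral>x. h x \<partial>\<mu>Z)" if h: "h \<in> bounded_borel" for h
    using P.integral_fst'[of "\<lambda>w. h (snd w)"] integrable_bounded_borel[OF Q bounded_borel_snd[OF h]]
    by (simp add: Q_def A.prob_space intD[OF h])
  have XZb: "X \<in> sets borel" "Z \<in> sets borel" using XYZ by (simp_all add: borel_closed compact_imp_closed)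
  have QX: "AE w in Q. fst w \<in> X"
  proof -
    have h: "indicator (- X) \<in> (bounded_borel :: (real \<Rightarrow> real) set)" using XZb by (intro bounded_borel_indicator) auto
    have "(\<integral>w. indicator (- X) (fst w) \<partial>Q) = (\<integral>x. indicator (- X) x \<partial>\<mu>X :: real)" by (rule Qfst[OF h])
    also have "\<dots> = (\<integral>x. 0 \<partial>\<mu>X)" by (intro Bochner_Integration.integral_cong) (auto simp: marginal)
    also have "\<dots> = 0" by simp
    finally have "AE w in Q. indicator (- X) (fst w) = (0::real)"
      using integrable_bounded_borel[OF Q bounded_borel_fst[OF h]] by (subst (asm) integral_nonneg_eq_0_iff_AE) auto
    then show ?thesis by (rule eventually_mono) (auto simp: indicator_def split: if_splits)
  qed
  have QZ: "AE w in Q. snd w \<in> Z"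
  proof -
    have h: "indicator (- Z) \<in> (bounded_borel :: (real \<Rightarrow> real) set)" using XZb by (intro bounded_borel_indicator) auto
    have "(\<integral>w. indicator (- Z) (snd w) \<partial>Q) = (\<integral>x. indicator (- Z) x \<partial>\<mu>Z :: real)" by (rule Qsnd[OF h])
    also have "\<dots> = (\<integral>x. 0 \<partial>\<mu>Z)" by (intro Bochner_Integration.integral_cong) (auto simp: marginal)
    also have "\<dots> = 0" by simp
    finally have "AE w in Q. indicator (- Z) (snd w) = (0::real)"
      using integrable_bounded_borel[OF Q bounded_borel_snd[OF h]] by (subst (asm) integral_nonneg_eq_0_iff_AE) auto
    then show ?thesis by (rule eventually_mono) (auto simp: indicator_def split: if_splits)
  qed
  obtain B where B0: "0 < B" "\<forall>x\<in>X \<union> Y \<union> Z. \<bar>x\<bar> \<le> B" by (rule bounds)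
  define \<zeta> where "\<zeta> x = max (- B) (min B x)" for x
  have \<zeta>: "\<zeta> \<in> bounded_borel" unfolding \<zeta>_def using B0(1) by (intro bounded_borelI[where B=B]) auto
  have \<zeta>_eq: "\<zeta> z = z" if "z \<in> Z" for z
  proof -
    have "\<bar>z\<bar> \<le> B" using B0(2) that by blast
    then show ?thesis by (simp add: \<zeta>_def)
  qed
  have intZ: "integrable \<mu>Z h" if hb: "h \<in> bounded_borel" for h :: "real \<Rightarrow> real"
  proof -
    obtain C where C: "\<And>x. \<bar>h x\<bar> \<le> C" using bounded_borel_bound[OF hb] by blast
    show ?thesis
      using C measurable_compose[OF idZ bounded_borel_measurable[OF hb]] by (intro \<mu>Z.integrable_const_bound[where B=C]) auto
  qed
  have slice: "\<exists>N. slice X Z \<mu>X (two_point_weight u v) u N \<and>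
      (\<forall>h\<in>bounded_borel. (\<integral>w. h (snd w) \<partial>N) = (\<integral>x. two_point_weight u v x \<partial>\<mu>X) * (\<integral>z. g z * h z \<partial>\<mu>Z))"
    if uv: "{u, v} = {y\<^sub>1, y\<^sub>2}" and g: "g \<in> bounded_borel" "\<And>z. 0 \<le> g z" "(\<integral>z. g z \<partial>\<mu>Z) = 1" "(\<integral>z. g z * \<zeta> z \<partial>\<mu>Z) = u" for u v g
  proof -
    \<comment> \<open>By \<open>between\<close> the weight lies in \<open>[0, 1]\<close> almost
      everywhere; clipping gives the bounded version, nonnegative everywhere, that a density
      requires.\<close>
    define q where "q x = max 0 (min 1 (two_point_weight u v x))" for x
    have q: "q \<in> bounded_borel" unfolding q_def two_point_weight_def by (intro bounded_borelI[where B=1]) auto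
    have q_eq: "AE x in \<mu>X. q x = two_point_weight u v x"
      using between
    proof (rule eventually_mono)
      fix x assume "y\<^sub>1 \<le> x \<and> x \<le> y\<^sub>2"
      then have "0 \<le> two_point_weight u v x \<and> two_point_weight u v x \<le> 1"
        using uv y(3) by (auto simp: doubleton_eq_iff two_point_weight_def divide_simps)
      then show "q x = two_point_weight u v x" by (simp add: q_def)
    qed
    have q_int: "(\<integral>x. q x * h x \<partial>\<mu>X) = (\<integral>x. h x * two_point_weight u v x \<partial>\<mu>X)" if h: "h \<in> bounded_borel" for h
    proof (rule integral_cong_AE)
      show "AE x in \<mu>X. q x * h x = h x * two_point_weight u v x" using q_eq by (rule eventually_mono) simp
      show "(\<lambda>x. q x * h x) \<in> borel_measurable \<mu>X" "(\<lambda>x. h x * two_point_weight u v x) \<in> borel_measurable \<mu>X"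
        using bounded_borel_measurable[OF q] bounded_borel_measurable[OF h]
        by (auto intro!: measurable_\<mu>X simp: two_point_weight_def)
    qed
    define N where "N = product_of_margins Q (\<lambda>w. q (fst w)) (\<lambda>w. g (snd w))"
    have q0: "0 \<le> q x" for x by (simp add: q_def)
    note pm = Q bounded_borel_fst[OF q] q0 bounded_borel_snd[OF g(1)] g(2)
    have N: "sets N = sets borel" "finite_measure N"
      unfolding N_def by (rule sets_product_of_margins[OF pm] finite_measure_product_of_margins[OF pm])+
    have N_int: "(\<integral>w. h (fst w) * k (snd w) \<partial>N) = (\<integral>x. h x * two_point_weight u v x \<partial>\<mu>X) * (\<integral>z. g z * k z \<partial>\<mu>Z)"
      if h: "h \<in> bounded_borel" and k: "k \<in> bounded_borel" for h k
    proof -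
      have "(\<integral>w. h (fst w) * k (snd w) \<partial>N) = (\<integral>w. q (fst w) * h (fst w) \<partial>Q) * (\<integral>w. g (snd w) * k (snd w) \<partial>Q)"
        unfolding N_def by (rule integral_product_of_margins[OF pm h k])
      also have "(\<integral>w. q (fst w) * h (fst w) \<partial>Q) = (\<integral>x. q x * h x \<partial>\<mu>X)"
        by (rule Qfst[OF bounded_borel_mult[OF q h]])
      also have "(\<integral>w. g (snd w) * k (snd w) \<partial>Q) = (\<integral>z. g z * k z \<partial>\<mu>Z)"
        by (rule Qsnd[OF bounded_borel_mult[OF g(1) k]])
      finally show ?thesis by (simp add: q_int[OF h])
    qed
    have N_supp: "AE w in N. fst w \<in> X \<and> snd w \<in> Z"
      unfolding N_def
    proof (rule AE_product_of_margins[OF pm XZb])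
      show "AE w in Q. q (fst w) \<noteq> 0 \<longrightarrow> fst w \<in> X" using QX by (rule eventually_mono) simp
      show "AE w in Q. g (snd w) \<noteq> 0 \<longrightarrow> snd w \<in> Z" using QZ by (rule eventually_mono) simp
    qed
    have "slice X Z \<mu>X (two_point_weight u v) u N"
      unfolding slice_def
    proof (intro conjI ballI N N_supp)
      fix h :: "real \<Rightarrow> real" assume h: "h \<in> bounded_borel"
      show "(\<integral>w. h (fst w) \<partial>N) = (\<integral>x. h x * two_point_weight u v x \<partial>\<mu>X)"
        using N_int[OF h bounded_borel_const[of 1]] g(3) by simp
      note [measurable] = bounded_borel_measurable[OF h] bounded_borel_measurable[OF \<zeta>]
      have i: "integrable N (\<lambda>w. h (fst w) * \<zeta> (snd w))" "integrable N (\<lambda>w. h (fst w))"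
        using h \<zeta> by (intro integrable_bounded_borel[OF N(2,1)] bounded_borel_intros; simp)+
      have "(\<integral>w. h (fst w) * (snd w - u) \<partial>N) = (\<integral>w. h (fst w) * \<zeta> (snd w) - u * h (fst w) \<partial>N)"
      proof (rule integral_cong_AE)
        show "AE w in N. h (fst w) * (snd w - u) = h (fst w) * \<zeta> (snd w) - u * h (fst w)"
          using N_supp by (rule eventually_mono) (simp add: \<zeta>_eq algebra_simps)
      qed (simp_all add: measurable_cong_sets[OF N(1) refl])
      also have "\<dots> = (\<integral>w. h (fst w) * \<zeta> (snd w) \<partial>N) - u * (\<integral>w. h (fst w) \<partial>N)" using i by simp
      also have "\<dots> = 0" using N_int[OF h \<zeta>] N_int[OF h bounded_borel_const[of 1]] g(3,4) by simp
      finally show "(\<integral>w. h (fst w) * (snd w - u) \<partial>N) = 0" .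
    qed
    moreover have "(\<integral>w. h (snd w) \<partial>N) = (\<integral>x. two_point_weight u v x \<partial>\<mu>X) * (\<integral>z. g z * h z \<partial>\<mu>Z)"
      if h: "h \<in> bounded_borel" for h
      using N_int[OF bounded_borel_const[of 1] h] by simp
    ultimately show ?thesis by blast
  qed
  define il where "il z = (indicator {..zu_minus} z :: real)" for z
  define ih where "ih z = (indicator {zl_plus..} z :: real)" for z
  have il: "il \<in> bounded_borel" and ih: "ih \<in> bounded_borel" unfolding il_def ih_def by (auto intro!: bounded_borel_indicator)
  have ilh: "il z + ih z = 1" "il z = 1 \<and> ih z = 0 \<and> zl_minus \<le> z \<and> z \<le> zu_minus \<or> il z = 0 \<and> ih z = 1 \<and> zl_plus \<le> z \<and> z \<le> zu_plus"
    if "z \<in> Z" for z using that gap y(3) by (auto simp: Z il_def ih_def indicator_def)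
  have il0: "0 \<le> il z" "0 \<le> ih z" for z by (simp_all add: il_def ih_def)
  define mL where "mL = (\<integral>z. il z \<partial>\<mu>Z)"
  define mH where "mH = (\<integral>z. ih z \<partial>\<mu>Z)"
  define SL where "SL = (\<integral>z. il z * \<zeta> z \<partial>\<mu>Z)"
  define SH where "SH = (\<integral>z. ih z * \<zeta> z \<partial>\<mu>Z)"
  have il\<zeta>: "(\<lambda>z. il z * \<zeta> z) \<in> bounded_borel" and ih\<zeta>: "(\<lambda>z. ih z * \<zeta> z) \<in> bounded_borel"
    using il ih \<zeta> by (auto intro: bounded_borel_mult)
  note ints = intZ[OF il] intZ[OF ih] intZ[OF il\<zeta>] intZ[OF ih\<zeta>]
  have "mL + mH = (\<integral>z. il z + ih z \<partial>\<mu>Z)" unfolding mL_def mH_def using ints by simp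
  also have "\<dots> = (\<integral>z. 1 \<partial>\<mu>Z)" by (intro Bochner_Integration.integral_cong) (simp_all add: marginal ilh)
  finally have m1: "mL + mH = 1" by (simp add: \<mu>Z.prob_space)
  have "SL + SH = (\<integral>z. il z * \<zeta> z + ih z * \<zeta> z \<partial>\<mu>Z)" unfolding SL_def SH_def using ints by simp
  also have "\<dots> = (\<integral>z. z \<partial>\<mu>Z)"
    by (intro Bochner_Integration.integral_cong) (simp_all add: marginal ilh \<zeta>_eq distrib_right[symmetric])
  finally have M1: "SL + SH = a\<^sub>1 * y\<^sub>1 + a\<^sub>2 * y\<^sub>2" by (simp add: mean_Z)
  have le_int: "(\<integral>z. f z \<partial>\<mu>Z) \<le> (\<integral>z. f' z \<partial>\<mu>Z)" if "integrable \<mu>Z f" "integrable \<mu>Z f'" "\<And>z. z \<in> Z \<Longrightarrow> f z \<le> f' z" for f f' :: "real \<Rightarrow> real"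
    using that by (intro integral_mono) (simp_all add: marginal)
  have m0: "0 \<le> mL" "0 \<le> mH" unfolding mL_def mH_def by (simp_all add: il0 integral_nonneg_AE)
  have "(\<integral>z. il z * \<zeta> z \<partial>\<mu>Z) \<le> (\<integral>z. zu_minus * il z \<partial>\<mu>Z)"
    by (rule le_int) (use ints ilh(2) \<zeta>_eq in \<open>fastforce+\<close>)
  then have L1: "SL \<le> zu_minus * mL" by (simp add: SL_def mL_def)
  have "(\<integral>z. zl_minus * il z \<partial>\<mu>Z) \<le> (\<integral>z. il z * \<zeta> z \<partial>\<mu>Z)"
    by (rule le_int) (use ints ilh(2) \<zeta>_eq in \<open>fastforce+\<close>)
  then have L2: "zl_minus * mL \<le> SL" by (simp add: SL_def mL_def)
  have "(\<integral>z. ih z * \<zeta> z \<partial>\<mu>Z) \<le> (\<integral>z. zu_plus * ih z \<partial>\<mu>Z)"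
    by (rule le_int) (use ints ilh(2) \<zeta>_eq in \<open>fastforce+\<close>)
  then have H1: "SH \<le> zu_plus * mH" by (simp add: SH_def mH_def)
  have "(\<integral>z. zl_plus * ih z \<partial>\<mu>Z) \<le> (\<integral>z. ih z * \<zeta> z \<partial>\<mu>Z)"
    by (rule le_int) (use ints ilh(2) \<zeta>_eq in \<open>fastforce+\<close>)
  then have H2: "zl_plus * mH \<le> SH" by (simp add: SH_def mH_def)
  have ybar: "y\<^sub>1 \<le> a\<^sub>1 * y\<^sub>1 + a\<^sub>2 * y\<^sub>2" "a\<^sub>1 * y\<^sub>1 + a\<^sub>2 * y\<^sub>2 \<le> y\<^sub>2"
  proof -
    have a1: "a\<^sub>1 = 1 - a\<^sub>2" using weights_sum by simp
    have "a\<^sub>1 * y\<^sub>1 + a\<^sub>2 * y\<^sub>2 = y\<^sub>1 + a\<^sub>2 * (y\<^sub>2 - y\<^sub>1)" "a\<^sub>1 * y\<^sub>1 + a\<^sub>2 * y\<^sub>2 = y\<^sub>2 - a\<^sub>1 * (y\<^sub>2 - y\<^sub>1)"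
      unfolding a1 by (simp_all add: algebra_simps)
    moreover have "0 \<le> a\<^sub>2 * (y\<^sub>2 - y\<^sub>1)" "0 \<le> a\<^sub>1 * (y\<^sub>2 - y\<^sub>1)" using a y(3) by simp_all
    ultimately show "y\<^sub>1 \<le> a\<^sub>1 * y\<^sub>1 + a\<^sub>2 * y\<^sub>2" "a\<^sub>1 * y\<^sub>1 + a\<^sub>2 * y\<^sub>2 \<le> y\<^sub>2" by linarith+
  qed
  \<comment> \<open>Without mass on the lower component the mean of \<open>\<mu>Z\<close> would be
    at least \<open>zl_plus\<close>, which exceeds \<open>y\<^sub>2\<close> and hence the
    barycentre. The upper component is symmetric.\<close>
  have mL: "0 < mL"
  proof (rule ccontr)
    assume "\<not> 0 < mL"
    then have "mL = 0" using m0 by simp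
    then have "SL = 0" "mH = 1" using L1 L2 m1 by simp_all
    then show False using M1 H2 ybar gap by simp
  qed
  have mH: "0 < mH"
  proof (rule ccontr)
    assume "\<not> 0 < mH"
    then have "mH = 0" using m0 by simp
    then have "SH = 0" "mL = 1" using H1 H2 m1 by simp_all
    then show False using M1 L1 ybar gap by simp
  qed
  \<comment> \<open>Determinant of the conditions \<open>\<alpha> * mL + \<beta> * mH = 1\<close>
    and \<open>\<alpha> * SL + \<beta> * SH = u\<close>, solved below by Cramer's rule; the gap
    makes it positive.\<close>
  define d where "d = mL * SH - mH * SL"
  have d: "0 < d"
  proof -
    have "mL * (zl_plus * mH) \<le> mL * SH" "mH * SL \<le> mH * (zu_minus * mL)"
      using H2 L1 mL mH by (auto intro: mult_left_mono)
    moreover have "0 < mL * mH * (zl_plus - zu_minus)" using mL mH gap y(3) by simp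
    ultimately show ?thesis unfolding d_def by (simp add: algebra_simps)
  qed
  define \<alpha> where "\<alpha> u = (SH - u * mH) / d" for u
  define \<beta> where "\<beta> u = (u * mL - SL) / d" for u
  define g where "g u z = \<alpha> u * il z + \<beta> u * ih z" for u z
  have ab0: "0 \<le> \<alpha> u" "0 \<le> \<beta> u" if "zu_minus < u" "u < zl_plus" for u
  proof -
    have "u * mH \<le> zl_plus * mH" "zu_minus * mL \<le> u * mL" using that mL mH by simp_all
    then show "0 \<le> \<alpha> u" "0 \<le> \<beta> u" using H2 L1 d by (simp_all add: \<alpha>_def \<beta>_def)
  qed
  have gb: "g u \<in> bounded_borel" for u unfolding g_def using il ih by (intro bounded_borel_intros)
  have g0: "0 \<le> g u z" if "zu_minus < u" "u < zl_plus" for u z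
    unfolding g_def using ab0[OF that] il0[of z] by (intro add_nonneg_nonneg mult_nonneg_nonneg)
  have g1: "(\<integral>z. g u z \<partial>\<mu>Z) = 1" for u
  proof -
    have "(\<integral>z. g u z \<partial>\<mu>Z) = \<alpha> u * mL + \<beta> u * mH" unfolding g_def mL_def mH_def using ints by simp
    also have "\<dots> = ((SH - u * mH) * mL + (u * mL - SL) * mH) / d" by (simp add: \<alpha>_def \<beta>_def add_divide_distrib)
    also have "(SH - u * mH) * mL + (u * mL - SL) * mH = d" by (simp add: d_def algebra_simps)
    finally show ?thesis using d by simp
  qed
  have gu: "(\<integral>z. g u z * \<zeta> z \<partial>\<mu>Z) = u" for u
  proof -
    have "(\<integral>z. g u z * \<zeta> z \<partial>\<mu>Z) = (\<integral>z. \<alpha> u * (il z * \<zeta> z) + \<beta> u * (ih z * \<zeta> z) \<partial>\<mu>Z)" by (simp add: g_def algebra_simps)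
    also have "\<dots> = \<alpha> u * SL + \<beta> u * SH" unfolding SL_def SH_def using ints by simp
    also have "\<dots> = ((SH - u * mH) * SL + (u * mL - SL) * SH) / d" by (simp add: \<alpha>_def \<beta>_def add_divide_distrib)
    also have "(SH - u * mH) * SL + (u * mL - SL) * SH = u * d" by (simp add: d_def algebra_simps)
    finally show ?thesis using d by simp
  qed
  \<comment> \<open>\<open>\<alpha>\<close> is affine in \<open>u\<close>, so averaging over the
    atoms evaluates it at the common mean, where the constant density \<open>1\<close> is the
    solution. The same holds for \<open>\<beta>\<close>; hence the two laws of \<open>z\<close> mix
    to \<open>\<mu>Z\<close>.\<close>
  have \<alpha>1: "a\<^sub>1 * \<alpha> y\<^sub>1 + a\<^sub>2 * \<alpha> y\<^sub>2 = 1"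
  proof -
    have "a\<^sub>1 * \<alpha> y\<^sub>1 + a\<^sub>2 * \<alpha> y\<^sub>2 = ((a\<^sub>1 + a\<^sub>2) * SH - (a\<^sub>1 * y\<^sub>1 + a\<^sub>2 * y\<^sub>2) * mH) / d"
      by (simp add: \<alpha>_def algebra_simps add_divide_distrib diff_divide_distrib)
    also have "(a\<^sub>1 + a\<^sub>2) * SH - (a\<^sub>1 * y\<^sub>1 + a\<^sub>2 * y\<^sub>2) * mH = (mL + mH) * SH - (SL + SH) * mH"
      unfolding weights_sum m1 M1 ..
    also have "\<dots> = d" by (simp add: d_def algebra_simps)
    finally show ?thesis using d by simp
  qed
  have \<beta>1: "a\<^sub>1 * \<beta> y\<^sub>1 + a\<^sub>2 * \<beta> y\<^sub>2 = 1"
  proof -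
    have "a\<^sub>1 * \<beta> y\<^sub>1 + a\<^sub>2 * \<beta> y\<^sub>2 = ((a\<^sub>1 * y\<^sub>1 + a\<^sub>2 * y\<^sub>2) * mL - (a\<^sub>1 + a\<^sub>2) * SL) / d"
      by (simp add: \<beta>_def algebra_simps add_divide_distrib diff_divide_distrib)
    also have "(a\<^sub>1 * y\<^sub>1 + a\<^sub>2 * y\<^sub>2) * mL - (a\<^sub>1 + a\<^sub>2) * SL = (SL + SH) * mL - (mL + mH) * SL"
      unfolding weights_sum m1 M1 ..
    also have "\<dots> = d" by (simp add: d_def algebra_simps)
    finally show ?thesis using d by simp
  qed
  have gs: "a\<^sub>1 * g y\<^sub>1 z + a\<^sub>2 * g y\<^sub>2 z = 1" if "z \<in> Z" for z
  proof -
    have "a\<^sub>1 * g y\<^sub>1 z + a\<^sub>2 * g y\<^sub>2 z = (a\<^sub>1 * \<alpha> y\<^sub>1 + a\<^sub>2 * \<alpha> y\<^sub>2) * il z + (a\<^sub>1 * \<beta> y\<^sub>1 + a\<^sub>2 * \<beta> y\<^sub>2) * ih z"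
      by (simp add: g_def algebra_simps)
    then show ?thesis unfolding \<alpha>1 \<beta>1 using ilh(1)[OF that] by simp
  qed
  have y1: "zu_minus < y\<^sub>1" "y\<^sub>1 < zl_plus" and y2: "zu_minus < y\<^sub>2" "y\<^sub>2 < zl_plus" using gap y(3) by simp_all
  obtain N\<^sub>1 where N1: "slice X Z \<mu>X p\<^sub>1 y\<^sub>1 N\<^sub>1" "\<forall>h\<in>bounded_borel. (\<integral>w. h (snd w) \<partial>N\<^sub>1) = (\<integral>x. p\<^sub>1 x \<partial>\<mu>X) * (\<integral>z. g y\<^sub>1 z * h z \<partial>\<mu>Z)"
    using slice[OF refl gb g0[OF y1] g1 gu] by blast
  obtain N\<^sub>2 where N2: "slice X Z \<mu>X p\<^sub>2 y\<^sub>2 N\<^sub>2" "\<forall>h\<in>bounded_borel. (\<integral>w. h (snd w) \<partial>N\<^sub>2) = (\<integral>x. p\<^sub>2 x \<partial>\<mu>X) * (\<integral>z. g y\<^sub>2 z * h z \<partial>\<mu>Z)"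
    using slice[OF insert_commute gb g0[OF y2] g1 gu] by blast
  have "slices N\<^sub>1 N\<^sub>2"
    unfolding slice_pair_def
  proof (intro conjI ballI N1(1) N2(1))
    fix h :: "real \<Rightarrow> real" assume h: "h \<in> bounded_borel"
    have i: "integrable \<mu>Z (\<lambda>z. g u z * h z)" for u by (rule intZ[OF bounded_borel_mult[OF gb h]])
    have "(\<integral>w. h (snd w) \<partial>N\<^sub>1) + (\<integral>w. h (snd w) \<partial>N\<^sub>2) = a\<^sub>1 * (\<integral>z. g y\<^sub>1 z * h z \<partial>\<mu>Z) + a\<^sub>2 * (\<integral>z. g y\<^sub>2 z * h z \<partial>\<mu>Z)"
      using N1(2) N2(2) h integral_weights by simp
    also have "\<dots> = (\<integral>z. a\<^sub>1 * (g y\<^sub>1 z * h z) + a\<^sub>2 * (g y\<^sub>2 z * h z) \<partial>\<mu>Z)" using i by simp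
    also have "\<dots> = (\<integral>z. h z \<partial>\<mu>Z)"
    proof (rule Bochner_Integration.integral_cong)
      fix z assume "z \<in> space \<mu>Z"
      then have "z \<in> Z" by (simp add: marginal)
      have "a\<^sub>1 * (g y\<^sub>1 z * h z) + a\<^sub>2 * (g y\<^sub>2 z * h z) = (a\<^sub>1 * g y\<^sub>1 z + a\<^sub>2 * g y\<^sub>2 z) * h z" by (simp add: algebra_simps)
      then show "a\<^sub>1 * (g y\<^sub>1 z * h z) + a\<^sub>2 * (g y\<^sub>2 z * h z) = h z" unfolding gs[OF \<open>z \<in> Z\<close>] by simp
    qed simp
    finally show "(\<integral>w. h (snd w) \<partial>N\<^sub>1) + (\<integral>w. h (snd w) \<partial>N\<^sub>2) = (\<integral>z. h z \<partial>\<mu>Z)" .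
  qed
  then show ?thesis by blast
qed

end

section \<open>Extension of the costs, consequences of convex order and non-atomicity\<close>

lemma continuous_extension_plane:
  fixes f :: "real \<Rightarrow> real \<Rightarrow> real"
  assumes "compact S" "compact T" "continuous_on (S \<times> T) (\<lambda>(x, y). f x y)"
  obtains F :: "real \<times> real \<Rightarrow> real" where "continuous_on UNIV F" "F \<in> bounded_borel"
    "\<forall>x\<in>S. \<forall>y\<in>T. F (x, y) = f x y"
proof -
  have K: "compact (S \<times> T)" using assms by (intro compact_Times)
  have "bounded ((\<lambda>(x, y). f x y) ` (S \<times> T))"
    by (rule compact_imp_bounded[OF compact_continuous_image[OF assms(3) K]])
  then obtain B where B: "0 < B" "\<forall>v\<in>(\<lambda>(x, y). f x y) ` (S \<times> T). norm v \<le> B" unfolding bounded_pos by blast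
  \<comment> \<open>The costs are continuous on their domains only, whereas slices and weak limits
    are tested with functions on the whole plane; Tietze's theorem extends them with the same
    bound.\<close>
  obtain F :: "real \<times> real \<Rightarrow> real" where F: "continuous_on UNIV F" "\<And>w. w \<in> S \<times> T \<Longrightarrow> F w = (\<lambda>(x, y). f x y) w"
    "\<And>w. w \<in> UNIV \<Longrightarrow> norm (F w) \<le> B"
  proof (rule Tietze[OF assms(3), of UNIV B])
    show "closedin (top_of_set UNIV) (S \<times> T)" using compact_imp_closed[OF K] by simp
    show "norm ((\<lambda>(x, y). f x y) w) \<le> B" if "w \<in> S \<times> T" for w using B(2) that by blast
  qed (use B in auto)
  show ?thesis
  proof (rule that)
    show "F \<in> bounded_borel"
      using F(3) by (intro bounded_borelI[of _ B] borel_measurable_continuous_onI[OF F(1)]) simp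
  qed (use F in auto)
qed

lemma convex_on_max_0_affine: "convex_on UNIV (\<lambda>x :: real. max 0 (m * x + n))"
proof (rule convex_onI)
  fix t x y :: real assume t: "0 < t" "t < 1"
  have "m * ((1 - t) *\<^sub>R x + t *\<^sub>R y) + n = (1 - t) * (m * x + n) + t * (m * y + n)" by (simp add: algebra_simps)
  also have "\<dots> \<le> (1 - t) * max 0 (m * x + n) + t * max 0 (m * y + n)"
    using t by (intro add_mono mult_left_mono) auto
  finally show "max 0 (m * ((1 - t) *\<^sub>R x + t *\<^sub>R y) + n) \<le> (1 - t) * max 0 (m * x + n) + t * max 0 (m * y + n)"
    using t by (intro max.boundedI) auto
qed simp

lemma convex_on_affine: "convex_on UNIV (\<lambda>x :: real. m * x)"
  by (rule convex_onI) (simp_all add: algebra_simps)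

text \<open>The order can be tested on \<open>x\<close> and on \<open>- x\<close>, both of which are
  convex.\<close>

lemma convex_order_mean:
  assumes "\<mu> \<preceq>\<^sub>c \<nu>" shows "(\<integral>x. x \<partial>\<mu>) = (\<integral>x. x \<partial>\<nu>)"
proof -
  have "(\<integral>x. m * x \<partial>\<mu>) \<le> (\<integral>x. m * x \<partial>\<nu>)" for m :: real
    using assms convex_on_affine[of m] unfolding convex_order_def by blast
  from this[of 1] this[of "-1"] show ?thesis by simp
qed

text \<open>A singleton has no subsets besides itself and the empty set, so positive mass would make
  it an atom; points outside \<open>S\<close> are not in the space at all.\<close>

lemma non_atomic_singleton:
  fixes \<mu> :: "real measure"
  assumes \<mu>: "sets \<mu> = sets (restrict_space borel S)" and "non_atomic \<mu>" and S: "closed S"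
  shows "AE x in \<mu>. x \<noteq> s"
proof (cases "s \<in> S")
  case True
  have "{s} \<in> sets \<mu>" using True S by (simp add: \<mu> sets_restrict_space_iff)
  moreover have "emeasure \<mu> {s} = 0"
  proof (rule ccontr)
    assume "emeasure \<mu> {s} \<noteq> 0"
    then have "atom \<mu> {s}" using \<open>{s} \<in> sets \<mu>\<close> unfolding atom_def by (auto simp: subset_singleton_iff zero_less_iff_neq_zero)
    then show False using assms(2) by (auto simp: non_atomic_def)
  qed
  ultimately show ?thesis by (intro AE_I[where N="{s}"]) auto
next
  case False
  then show ?thesis using sets_eq_imp_space_eq[OF \<mu>] by (intro AE_I2) (auto simp: space_restrict_space)
qed

theorem theorem4p2:
  fixes X Y Z :: "real set"
    and zl_minus zu_minus zl_plus zu_plus y\<^sub>1 y\<^sub>2 a\<^sub>1 a\<^sub>2 :: real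
    and \<mu>X \<mu>Y \<mu>Z :: "real measure"
    and c :: "real \<Rightarrow> real \<Rightarrow> real \<Rightarrow> real"
    and c\<^sub>1 c\<^sub>2 c\<^sub>3 :: "real \<Rightarrow> real \<Rightarrow> real"
  assumes "compact X" and "compact Y"
    and Z: "Z = {zl_minus..zu_minus} \<union> {zl_plus..zu_plus}"
    and "\<mu>X \<in> borel_probs X" and "\<mu>Y \<in> borel_probs Y" and "\<mu>Z \<in> borel_probs Z"
    and "\<mu>X \<preceq>\<^sub>c \<mu>Y" and "\<mu>Y \<preceq>\<^sub>c \<mu>Z"
    and "non_atomic \<mu>X"
    and "y\<^sub>1 \<in> Y" and "y\<^sub>2 \<in> Y" and "a\<^sub>1 > 0" and "a\<^sub>2 > 0"
    and muY: "\<And>A. A \<in> sets \<mu>Y \<Longrightarrow> emeasure \<mu>Y A =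
          ennreal a\<^sub>1 * emeasure (return \<mu>Y y\<^sub>1) A + ennreal a\<^sub>2 * emeasure (return \<mu>Y y\<^sub>2) A"
    and "zu_minus < y\<^sub>1" and "y\<^sub>1 < y\<^sub>2" and "y\<^sub>2 < zl_plus"
    and c: "\<And>x y z. x \<in> X \<Longrightarrow> y \<in> Y \<Longrightarrow> z \<in> Z \<Longrightarrow> c x y z = c\<^sub>1 x y + c\<^sub>2 y z + c\<^sub>3 x z"
    and "continuous_on (X \<times> Y) (\<lambda>(x, y). c\<^sub>1 x y)"
    and "continuous_on (Y \<times> Z) (\<lambda>(y, z). c\<^sub>2 y z)"
    and "continuous_on (X \<times> Z) (\<lambda>(x, z). c\<^sub>3 x z)"
    and "\<And>x z. x \<in> X \<Longrightarrow> z \<in> Z \<Longrightarrow> (\<lambda>x'. c\<^sub>3 x' z) differentiable (at x within X)"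
    and "martingale_spence_mirrlees X Z c\<^sub>3"
  shows "\<exists>!\<pi>. mot_optimal X Y Z \<mu>X \<mu>Y \<mu>Z c \<pi>"
proof -
  have closed: "closed X" "compact Z"
    using \<open>compact X\<close> unfolding Z by (simp_all add: compact_imp_closed compact_Un)
  have marg: "prob_space \<mu>X" "sets \<mu>X = sets (restrict_space borel X)" "sets \<mu>Y = sets (restrict_space borel Y)"
    using \<open>\<mu>X \<in> borel_probs X\<close> \<open>\<mu>Y \<in> borel_probs Y\<close> by (auto simp: borel_probs_def space_prob_algebra)
  have int_Y: "(\<integral>y. F y \<partial>\<mu>Y) = a\<^sub>1 * F y\<^sub>1 + a\<^sub>2 * F y\<^sub>2" if "F \<in> borel_measurable borel" for F :: "real \<Rightarrow> real"
    by (rule integral_two_points[OF marg(3) \<open>y\<^sub>1 \<in> Y\<close> \<open>y\<^sub>2 \<in> Y\<close> \<open>a\<^sub>1 > 0\<close> \<open>a\<^sub>2 > 0\<close> muY that])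
  have mean_Y: "(\<integral>y. y \<partial>\<mu>Y) = a\<^sub>1 * y\<^sub>1 + a\<^sub>2 * y\<^sub>2" by (rule int_Y) simp
  have mean_X: "(\<integral>x. x \<partial>\<mu>X) = a\<^sub>1 * y\<^sub>1 + a\<^sub>2 * y\<^sub>2" using convex_order_mean[OF \<open>\<mu>X \<preceq>\<^sub>c \<mu>Y\<close>] mean_Y by simp
  have mean_Z: "(\<integral>z. z \<partial>\<mu>Z) = a\<^sub>1 * y\<^sub>1 + a\<^sub>2 * y\<^sub>2" using convex_order_mean[OF \<open>\<mu>Y \<preceq>\<^sub>c \<mu>Z\<close>] mean_Y by simp
  interpret two_point_coupling X Y Z \<mu>X \<mu>Y \<mu>Z y\<^sub>1 y\<^sub>2 a\<^sub>1 a\<^sub>2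
    by unfold_locales (use assms closed mean_X in auto)
  \<comment> \<open>A function \<open>max 0 (m * x + n)\<close> that vanishes at both atoms has
    integral \<open>0\<close> under \<open>\<mu>Y\<close>, hence under \<open>\<mu>X\<close>. The
    choices \<open>x - y\<^sub>2\<close> and \<open>y\<^sub>1 - x\<close> confine
    \<open>\<mu>X\<close> to the segment between the atoms.\<close>
  have outside: "AE x in \<mu>X. m * x + n \<le> 0" if mn: "m * y\<^sub>1 + n \<le> 0" "m * y\<^sub>2 + n \<le> 0" for m n
  proof -
    let ?\<phi> = "\<lambda>x. max 0 (m * x + n)"
    have "(\<integral>x. ?\<phi> x \<partial>\<mu>X) \<le> (\<integral>y. ?\<phi> y \<partial>\<mu>Y)"
      using \<open>\<mu>X \<preceq>\<^sub>c \<mu>Y\<close> convex_on_max_0_affine[of m n] unfolding convex_order_def by blast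
    also have "\<dots> = 0" using mn by (subst int_Y) simp_all
    finally have le: "(\<integral>x. ?\<phi> x \<partial>\<mu>X) \<le> 0" .
    have "integrable \<mu>X (\<lambda>x. m * x + n)" using integrable_\<mu>X[OF bounded_borel_const[of 1], of m n] by simp
    then have i: "integrable \<mu>X ?\<phi>" by (intro integrable_max) simp_all
    have "(\<integral>x. ?\<phi> x \<partial>\<mu>X) = 0" using le integral_nonneg_AE[of ?\<phi> \<mu>X] by (intro antisym) simp_all
    then have "AE x in \<mu>X. ?\<phi> x = 0" using integral_nonneg_eq_0_iff_AE[OF i] by simp
    then show ?thesis by (rule eventually_mono) (simp add: max_def split: if_splits)
  qed
  have "AE x in \<mu>X. 1 * x + - y\<^sub>2 \<le> 0" "AE x in \<mu>X. - 1 * x + y\<^sub>1 \<le> 0"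
    using \<open>y\<^sub>1 < y\<^sub>2\<close> by (intro outside; simp)+
  then have between: "AE x in \<mu>X. y\<^sub>1 \<le> x \<and> x \<le> y\<^sub>2" by eventually_elim simp
  have ex: "\<exists>N\<^sub>1 N\<^sub>2. slices N\<^sub>1 N\<^sub>2"
    by (rule weight_slices_exist[OF Z \<open>zu_minus < y\<^sub>1\<close> \<open>y\<^sub>2 < zl_plus\<close> mean_Z between])
  obtain C\<^sub>1 :: "real \<times> real \<Rightarrow> real" where C1: "continuous_on UNIV C\<^sub>1" "C\<^sub>1 \<in> bounded_borel" "\<forall>x\<in>X. \<forall>y\<in>Y. C\<^sub>1 (x, y) = c\<^sub>1 x y"
    using continuous_extension_plane[OF \<open>compact X\<close> \<open>compact Y\<close> \<open>continuous_on (X \<times> Y) (\<lambda>(x, y). c\<^sub>1 x y)\<close>] .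
  obtain C\<^sub>2 :: "real \<times> real \<Rightarrow> real" where C2: "continuous_on UNIV C\<^sub>2" "C\<^sub>2 \<in> bounded_borel" "\<forall>y\<in>Y. \<forall>z\<in>Z. C\<^sub>2 (y, z) = c\<^sub>2 y z"
    using continuous_extension_plane[OF \<open>compact Y\<close> closed(2) \<open>continuous_on (Y \<times> Z) (\<lambda>(y, z). c\<^sub>2 y z)\<close>] .
  obtain C\<^sub>3 :: "real \<times> real \<Rightarrow> real" where C3: "continuous_on UNIV C\<^sub>3" "C\<^sub>3 \<in> bounded_borel" "\<forall>x\<in>X. \<forall>z\<in>Z. C\<^sub>3 (x, z) = c\<^sub>3 x z"
    using continuous_extension_plane[OF \<open>compact X\<close> closed(2) \<open>continuous_on (X \<times> Z) (\<lambda>(x, z). c\<^sub>3 x z)\<close>] .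
  have "strictly_concave_on Z (\<lambda>z. C\<^sub>3 (x', z) - C\<^sub>3 (x, z))" if x: "x \<in> X" "x' \<in> X" "x < x'" for x x'
  proof -
    have "strictly_concave_on Z (\<lambda>z. c\<^sub>3 x' z - c\<^sub>3 x z)"
      using \<open>martingale_spence_mirrlees X Z c\<^sub>3\<close> x unfolding martingale_spence_mirrlees_def by blast
    then show ?thesis unfolding strictly_concave_on_def using C3(3) x by simp
  qed
  then have sm: "martingale_spence_mirrlees X Z (\<lambda>x z. C\<^sub>3 (x, z))" unfolding martingale_spence_mirrlees_def by blast
  \<comment> \<open>The given \<open>c\<close> is controlled only on
    \<open>X \<times> Y \<times> Z\<close>, the space of every coupling; \<open>F\<close> is a
    bounded Borel cost defined everywhere with the same integrals.\<close>
  define F :: "real \<times> real \<times> real \<Rightarrow> real" where "F w = C\<^sub>1 (fst w, fst (snd w)) + C\<^sub>2 (snd w) + C\<^sub>3 (fst w, snd (snd w))" for w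
  have F: "F \<in> bounded_borel"
    unfolding F_def
    by (intro bounded_borel_add bounded_borel_compose[OF C1(2)] bounded_borel_compose[OF C2(2)] bounded_borel_compose[OF C3(2)]) measurable
  have cost: "(\<integral>(x, y, z). c x y z \<partial>\<pi>) = (\<integral>w. F w \<partial>\<pi>)" if "\<pi> \<in> couplings" for \<pi>
    by (rule Bochner_Integration.integral_cong) (auto simp: coupling_space[OF that] F_def C1(3) C2(3) C3(3) c)
  \<comment> \<open>With \<open>y\<close> frozen, the first cost term depends on \<open>x\<close>
    alone and the second on \<open>z\<close> alone, the form that
    \<open>unique_optimal_slice_pair\<close> asks for.\<close>
  define k where "k y w = F (fst w, y, snd w)" for y and w :: "real \<times> real"
  have k_split: "k y w = C\<^sub>1 (fst w, y) + C\<^sub>2 (y, snd w) + C\<^sub>3 w" for y w by (simp add: k_def F_def)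
  have parts: "(\<lambda>x. C\<^sub>1 (x, y)) \<in> bounded_borel" "(\<lambda>z. C\<^sub>2 (y, z)) \<in> bounded_borel" for y
    by (rule bounded_borel_pair[OF C1(2)] bounded_borel_pair[OF C2(2)]; simp)+
  have k_b: "k y \<in> bounded_borel" for y
    unfolding k_split using bounded_borel_fst[OF parts(1)] bounded_borel_snd[OF parts(2)] C3(2)
    by (intro bounded_borel_add)
  have k_c: "continuous_on UNIV (k y)" for y
    unfolding k_split
    by (intro continuous_on_add continuous_on_compose2[OF C1(1)] continuous_on_compose2[OF C2(1)] C3(1) continuous_intros) auto
  define J where "J M\<^sub>1 M\<^sub>2 = (\<integral>w. k y\<^sub>1 w \<partial>M\<^sub>1) + (\<integral>w. k y\<^sub>2 w \<partial>M\<^sub>2)" for M\<^sub>1 M\<^sub>2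
  have "\<exists>N\<^sub>1 N\<^sub>2. slices N\<^sub>1 N\<^sub>2 \<and> (\<forall>M\<^sub>1 M\<^sub>2. slices M\<^sub>1 M\<^sub>2 \<longrightarrow>
      J N\<^sub>1 N\<^sub>2 \<le> J M\<^sub>1 M\<^sub>2 \<and> (J M\<^sub>1 M\<^sub>2 \<le> J N\<^sub>1 N\<^sub>2 \<longrightarrow> M\<^sub>1 = N\<^sub>1 \<and> M\<^sub>2 = N\<^sub>2))"
    unfolding J_def
  proof (rule unique_optimal_slice_pair[OF \<open>compact X\<close> Z _ _ _ _ _ _ _ k_c[of y\<^sub>1] k_b[of y\<^sub>1] k_c[of y\<^sub>2] k_b[of y\<^sub>2]
        k_split k_split parts(1,2) parts(1,2) C3(2) sm ex])
    show "AE x in \<mu>X. x \<noteq> s" for s by (rule non_atomic_singleton[OF marg(2) \<open>non_atomic \<mu>X\<close> closed(1)])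
    show "0 < (\<integral>x. p\<^sub>1 x \<partial>\<mu>X)" "0 < (\<integral>x. p\<^sub>2 x \<partial>\<mu>X)" using integral_weights \<open>a\<^sub>1 > 0\<close> \<open>a\<^sub>2 > 0\<close> by simp_all
  qed (use \<open>zu_minus < y\<^sub>1\<close> \<open>y\<^sub>1 < y\<^sub>2\<close> \<open>y\<^sub>2 < zl_plus\<close> in simp_all)
  then obtain N\<^sub>1 N\<^sub>2 where N: "slices N\<^sub>1 N\<^sub>2" and opt: "\<forall>M\<^sub>1 M\<^sub>2. slices M\<^sub>1 M\<^sub>2 \<longrightarrow>
      J N\<^sub>1 N\<^sub>2 \<le> J M\<^sub>1 M\<^sub>2 \<and> (J M\<^sub>1 M\<^sub>2 \<le> J N\<^sub>1 N\<^sub>2 \<longrightarrow> M\<^sub>1 = N\<^sub>1 \<and> M\<^sub>2 = N\<^sub>2)" by blast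
  obtain \<pi> where \<pi>: "\<pi> \<in> couplings" and \<pi>_int: "(\<integral>w. F w \<partial>\<pi>) = J N\<^sub>1 N\<^sub>2"
    using coupling_of_slices[OF N] F unfolding k_def J_def by blast
  have int: "(\<integral>w. F w \<partial>\<rho>) = J (slice_of \<rho> y\<^sub>1) (slice_of \<rho> y\<^sub>2)" if "\<rho> \<in> couplings" for \<rho>
    using coupling_integral[OF that F] unfolding k_def J_def .
  have min: "(\<integral>w. F w \<partial>\<pi>) \<le> (\<integral>w. F w \<partial>\<rho>)" if "\<rho> \<in> couplings" for \<rho>
    unfolding \<pi>_int int[OF that] using opt slices_of_coupling[OF that] by blast
  have slices_opt: "slice_of \<rho> y\<^sub>1 = N\<^sub>1 \<and> slice_of \<rho> y\<^sub>2 = N\<^sub>2" if \<rho>: "\<rho> \<in> couplings" "(\<integral>w. F w \<partial>\<rho>) \<le> (\<integral>w. F w \<partial>\<pi>)" for \<rho>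
    using \<rho>(2) opt slices_of_coupling[OF \<rho>(1)] unfolding \<pi>_int int[OF \<rho>(1)] by blast
  show ?thesis
  proof (rule ex1I)
    show "mot_optimal X Y Z \<mu>X \<mu>Y \<mu>Z c \<pi>"
      unfolding mot_optimal_def is_arg_min_def using \<pi> min by (auto simp: cost not_less)
    fix \<rho> assume "mot_optimal X Y Z \<mu>X \<mu>Y \<mu>Z c \<rho>"
    then have \<rho>: "\<rho> \<in> couplings" "(\<integral>w. F w \<partial>\<rho>) \<le> (\<integral>w. F w \<partial>\<pi>)"
      using \<pi> unfolding mot_optimal_def is_arg_min_def by (auto simp: cost not_less)
    show "\<rho> = \<pi>"
      by (rule coupling_eqI[OF \<rho>(1) \<pi>]) (use slices_opt[OF \<rho>] slices_opt[OF \<pi>] in simp_all)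
  qed
qed

end
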